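(* There is an absolute constant $C>0$ with the following property. Let $p$ be a prime with $p\not\equiv1\pmod4$, let $r\in\mathbb{Z}_{\geq0}$ and $m_2,m_3,n_2,n_3\in\mathbb{Z}_p$. Assume all of the following: - If $p\equiv3\pmod4$ and $r>2$, or if $p=2$ and $r>3$, then $(n_2n_3,p)=1$ and at least one of $m_2n_3-m_3n_2$, $m_2n_2+m_3n_3$ is non-zero in $\mathbb{Z}/p^{\lfloor r/4\rfloor}\mathbb{Z}$. - If $p\equiv3\pmod4$ and $r=2$, then $(m_2,m_3,p)=(n_2,n_3,p)=(m_2n_3+m_3n_2,p)=1$. - If $p\equiv3\pmod4$ and $r=4t+2$ for some $t\in\mathbb{Z}_{\geq1}$, then $(m_2^2+m_3^2,p)=1$. - If $p=2$ and $r$ is even, then $(m_2m_3,p)=1$. Then $$|S_4(m_2,m_3,n_2,n_3;p^r)|\leq C\,p^{r/2}.$$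
   Context: $(\cdot,\ldots,p)=1$ means that the listed $p$-adic integers are not all divisible by $p$. $e(x)=\exp(2\pi ix)$, extended to $\mathbb{Q}_p$ via $\mathbb{Q}_p/\mathbb{Z}_p\cong\mathbb{Z}[1/p]/\mathbb{Z}$. The sum $S_4(m_2,m_3,n_2,n_3;p^r)$ is defined by: - if $p\equiv3\pmod 4$ and $r$ is even, $$S_4=\sum_{\substack{x,y\,(\mathrm{mod}\,p^{r/2})\\(x,y,p)=1}}e\left(-2\,\frac{(m_2x-m_3y)\,\overline{(x^2+y^2)}}{p^{r/2}}\right)e\left(\frac{n_2x+n_3y}{p^{r/2}}\right);$$ - if $p=2$ and $r\geq3$ is odd, $$S_4=\sum_{\substack{x,y\,(\mathrm{mod}\,p^{(r-1)/2})\\(x,y,p)=1,\ p\mid xy}}e\left(-\frac{(m_2x-m_3y)\,\overline{(x^2+y^2)}}{p^{(r-1)/2}}\right)e\left(\frac{n_2x+n_3y}{p^{(r-1)/2}}\right);$$ - if $p=2$ and $r$ is even, $$S_4=\sum_{\substack{x,y\,(\mathrm{mod}\,p^{r/2})\\(xy,p)=1}}e\left(-\frac{(m_2x-m_3y)\,\overline{(x^2+y^2)p^{-1}}}{p^{r/2}}\right)e\left(\frac{n_2x+n_3y}{p^{r/2}}\right);$$ - $S_4=0$ otherwise. An overline denotes the inverse modulo the power of $p$ in the denominator of the same fraction. When $p=2$ and $r$ is even, for odd residues $x,y$ modulo $2^{r/2}$ the squares are well defined modulo $2^{r/2+1}$ and $x^2+y^2$ has $2$-adic valuation $1$, so $(x^2+y^2)2^{-1}$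 is well defined and invertible modulo $2^{r/2}$. For $r=0$ the coprimality conditions are regarded as vacuous, so $S_4(m_2,m_3,n_2,n_3;1)=1$. *)

theory Defs
  imports
    "HOL-Analysis.Analysis"
    "HOL-Algebra.Divisibility"
    "HOL-Algebra.Ring"
    "HOL-Number_Theory.Modular_Inverse"
begin

hide_const (open) Divisibility.prime

section \<open>The ring of $p$-adic integers\<close>

text \<open>
  The ring is the inverse limit of the rings \<open>\<int>/p\<^sup>n\<close>: the component \<open>x n\<close> of an element \<open>x\<close>
  is the representative in \<open>{0..<p ^ n}\<close> of its image in \<open>\<int>/p\<^sup>n\<close>.
  A carrier depending on \<open>p\<close> is used (rather than a type) because the constant in the theorem
  has to be chosen before \<open>p\<close>.
\<close>

type_synonym padic = "nat \<Rightarrow> int"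

definition Zp :: "nat \<Rightarrow> padic ring" where
  "Zp p = \<lparr>carrier = {x. \<forall>n. x n \<in> {0..<int p ^ n} \<and> x (Suc n) mod int p ^ n = x n},
           mult = (\<lambda>x y n. (x n * y n) mod int p ^ n),
           one = (\<lambda>n. 1 mod int p ^ n),
           zero = (\<lambda>n. 0),
           add = (\<lambda>x y n. (x n + y n) mod int p ^ n)\<rparr>"

definition Zp_of_int :: "nat \<Rightarrow> int \<Rightarrow> padic" where
  "Zp_of_int p a = (\<lambda>n. a mod int p ^ n)"

text \<open>The image in \<open>\<int>/p\<^sup>k\<close>, as an integer in \<open>{0..<p ^ k}\<close>.\<close>

definition Zp_residue :: "nat \<Rightarrow> padic \<Rightarrow> int" where
  "Zp_residue k z = z k"

text \<open>\<open>(x\<^sub>1, \<dots>, x\<^sub>n, p) = 1\<close> for \<open>X = {x\<^sub>1, \<dots>, x\<^sub>n}\<close>.\<close>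

definition Zp_coprime :: "nat \<Rightarrow> padic set \<Rightarrow> bool" where
  "Zp_coprime p X \<longleftrightarrow> \<not> (\<forall>x\<in>X. Zp_of_int p (int p) divides\<^bsub>Zp p\<^esub> x)"

text \<open>
  \<open>Zp_e p k z\<close> is \<open>e(z/p\<^sup>k)\<close> for a \<open>p\<close>-adic integer \<open>z\<close>. Every \<open>p\<close>-adic number has the form
  \<open>z/p\<^sup>k\<close>, and \<open>z/p\<^sup>k\<close> differs from the element \<open>z k/p\<^sup>k\<close> of \<open>\<int>[1/p]\<close> by a \<open>p\<close>-adic integer.
\<close>

definition Zp_e :: "nat \<Rightarrow> nat \<Rightarrow> padic \<Rightarrow> complex" where
  "Zp_e p k z = exp (2 * of_real pi * \<i> * (of_int (Zp_residue k z) / of_nat p ^ k))"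


section \<open>The exponential sum\<close>

text \<open>
  \<open>S4_term p k c w x y\<close> is the summand
  \<open>e(c (m\<^sub>2 x - m\<^sub>3 y) w\<^sup>-\<^sup>1 / p\<^sup>k) e((n\<^sub>2 x + n\<^sub>3 y) / p\<^sup>k)\<close>, where \<open>w\<^sup>-\<^sup>1\<close> is the inverse modulo \<open>p\<^sup>k\<close>.
\<close>

definition S4_term ::
  "nat \<Rightarrow> padic \<Rightarrow> padic \<Rightarrow> padic \<Rightarrow> padic \<Rightarrow> nat \<Rightarrow> int \<Rightarrow> int \<Rightarrow> int \<Rightarrow> int \<Rightarrow> complex" where
  "S4_term p m2 m3 n2 n3 k c w x y =
     Zp_e p k (Zp_of_int p c \<otimes>\<^bsub>Zp p\<^esub>
       ((m2 \<otimes>\<^bsub>Zp p\<^esub> Zp_of_int p x) \<ominus>\<^bsub>Zp p\<^esub> (m3 \<otimes>\<^bsub>Zp p\<^esub> Zp_of_int p y)) \<otimes>\<^bsub>Zp p\<^esub>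
       Zp_of_int p (modular_inverse (int p ^ k) w)) *
     Zp_e p k ((n2 \<otimes>\<^bsub>Zp p\<^esub> Zp_of_int p x) \<oplus>\<^bsub>Zp p\<^esub> (n3 \<otimes>\<^bsub>Zp p\<^esub> Zp_of_int p y))"

text \<open>
  The disjunct \<open>r = 0\<close> makes the coprimality conditions vacuous in that case.
  For \<open>p = 2\<close> and even \<open>r\<close>, the residue of \<open>(x\<^sup>2 + y\<^sup>2) div 2\<close> modulo \<open>2\<^sup>r\<^sup>/\<^sup>2\<close> does not
  depend on the representatives \<open>x\<close>, \<open>y\<close> of the odd residue classes modulo \<open>2\<^sup>r\<^sup>/\<^sup>2\<close>.
\<close>

definition S4 :: "padic \<Rightarrow> padic \<Rightarrow> padic \<Rightarrow> padic \<Rightarrow> nat \<Rightarrow> nat \<Rightarrow> complex" where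
  "S4 m2 m3 n2 n3 p r =
    (if p mod 4 = 3 \<and> even r then
       \<Sum>(x, y) \<in> {(x, y). x \<in> {0..<int p ^ (r div 2)} \<and> y \<in> {0..<int p ^ (r div 2)} \<and>
                       (r = 0 \<or> \<not> (int p dvd x \<and> int p dvd y))}.
         S4_term p m2 m3 n2 n3 (r div 2) (-2) (x\<^sup>2 + y\<^sup>2) x y
     else if p = 2 \<and> odd r \<and> r \<ge> 3 then
       \<Sum>(x, y) \<in> {(x, y). x \<in> {0..<int p ^ ((r - 1) div 2)} \<and> y \<in> {0..<int p ^ ((r - 1) div 2)} \<and>
                       \<not> (int p dvd x \<and> int p dvd y) \<and> int p dvd x * y}.
         S4_term p m2 m3 n2 n3 ((r - 1) div 2) (-1) (x\<^sup>2 + y\<^sup>2) x y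
     else if p = 2 \<and> even r then
       \<Sum>(x, y) \<in> {(x, y). x \<in> {0..<int p ^ (r div 2)} \<and> y \<in> {0..<int p ^ (r div 2)} \<and>
                       (r = 0 \<or> \<not> int p dvd x * y)}.
         S4_term p m2 m3 n2 n3 (r div 2) (-1) ((x\<^sup>2 + y\<^sup>2) div int p) x y
     else 0)"


section \<open>Basic facts\<close>

lemma Zp_closedI:
  assumes "p > 0" and "\<And>n. [f (Suc n) = f n] (mod int p ^ n)"
  shows   "(\<lambda>n. f n mod int p ^ n) \<in> carrier (Zp p)"
proof -
  have "f (Suc n) mod int p ^ Suc n mod int p ^ n = f n mod int p ^ n" for n
  proof -
    have "f (Suc n) mod int p ^ Suc n mod int p ^ n = f (Suc n) mod int p ^ n"
      by (rule mod_mod_cancel) simp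
    then show ?thesis using assms(2)[of n] by (simp add: cong_def)
  qed
  then show ?thesis using assms(1) by (simp add: Zp_def)
qed

lemma Zp_cong_Suc:
  assumes "x \<in> carrier (Zp p)"
  shows   "[x (Suc n) = x n] (mod int p ^ n)"
proof -
  have "x (Suc n) mod int p ^ n = x n" "x n \<in> {0..<int p ^ n}"
    using assms by (auto simp: Zp_def)
  then show ?thesis by (simp add: cong_def)
qed

lemma Zp_mod_self: "x \<in> carrier (Zp p) \<Longrightarrow> x n mod int p ^ n = x n"
  by (simp add: Zp_def)

lemma Zp_of_int_closed: "p > 0 \<Longrightarrow> Zp_of_int p a \<in> carrier (Zp p)"
  unfolding Zp_of_int_def by (rule Zp_closedI) auto

lemma Zp_mult_closed:
  assumes "p > 0" "x \<in> carrier (Zp p)" "y \<in> carrier (Zp p)"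
  shows   "x \<otimes>\<^bsub>Zp p\<^esub> y \<in> carrier (Zp p)"
proof -
  have "(\<lambda>n. (x n * y n) mod int p ^ n) \<in> carrier (Zp p)"
    by (intro Zp_closedI cong_mult Zp_cong_Suc assms)
  then show ?thesis by (simp add: Zp_def)
qed

lemma Zp_add_closed:
  assumes "p > 0" "x \<in> carrier (Zp p)" "y \<in> carrier (Zp p)"
  shows   "x \<oplus>\<^bsub>Zp p\<^esub> y \<in> carrier (Zp p)"
proof -
  have "(\<lambda>n. (x n + y n) mod int p ^ n) \<in> carrier (Zp p)"
    by (intro Zp_closedI cong_add Zp_cong_Suc assms)
  then show ?thesis by (simp add: Zp_def)
qed

lemma Zp_cring:
  assumes p: "p > 0"
  shows   "cring (Zp p)"
proof (rule cringI)
  show "abelian_group (Zp p)"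
  proof (rule abelian_groupI)
    show "\<zero>\<^bsub>Zp p\<^esub> \<in> carrier (Zp p)" using p by (simp add: Zp_def)
    show "\<exists>y\<in>carrier (Zp p). y \<oplus>\<^bsub>Zp p\<^esub> x = \<zero>\<^bsub>Zp p\<^esub>" if "x \<in> carrier (Zp p)" for x
    proof
      show "(\<lambda>n. (- x n) mod int p ^ n) \<in> carrier (Zp p)"
        using Zp_cong_Suc[OF that] by (intro Zp_closedI p) (simp add: cong_minus_minus_iff)
      show "(\<lambda>n. (- x n) mod int p ^ n) \<oplus>\<^bsub>Zp p\<^esub> x = \<zero>\<^bsub>Zp p\<^esub>"
        by (simp add: Zp_def mod_add_left_eq)
    qed
    show "x \<oplus>\<^bsub>Zp p\<^esub> y \<in> carrier (Zp p)"
      if "x \<in> carrier (Zp p)" "y \<in> carrier (Zp p)" for x y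
      using that by (rule Zp_add_closed[OF p])
    show "(x \<oplus>\<^bsub>Zp p\<^esub> y) \<oplus>\<^bsub>Zp p\<^esub> z = x \<oplus>\<^bsub>Zp p\<^esub> (y \<oplus>\<^bsub>Zp p\<^esub> z)" for x y z
      by (simp add: Zp_def mod_add_left_eq mod_add_right_eq add.assoc)
    show "x \<oplus>\<^bsub>Zp p\<^esub> y = y \<oplus>\<^bsub>Zp p\<^esub> x" for x y
      by (simp add: Zp_def add.commute)
    show "\<zero>\<^bsub>Zp p\<^esub> \<oplus>\<^bsub>Zp p\<^esub> x = x" if "x \<in> carrier (Zp p)" for x
      using Zp_mod_self[OF that] by (simp add: Zp_def)
  qed
  show "comm_monoid (Zp p)"
  proof (rule comm_monoidI)
    show "\<one>\<^bsub>Zp p\<^esub> \<in> carrier (Zp p)"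
      using Zp_of_int_closed[OF p, of 1] by (simp add: Zp_of_int_def Zp_def)
    show "x \<otimes>\<^bsub>Zp p\<^esub> y \<in> carrier (Zp p)"
      if "x \<in> carrier (Zp p)" "y \<in> carrier (Zp p)" for x y
      using that by (rule Zp_mult_closed[OF p])
    show "(x \<otimes>\<^bsub>Zp p\<^esub> y) \<otimes>\<^bsub>Zp p\<^esub> z = x \<otimes>\<^bsub>Zp p\<^esub> (y \<otimes>\<^bsub>Zp p\<^esub> z)" for x y z
      by (simp add: Zp_def mod_mult_left_eq mod_mult_right_eq mult.assoc)
    show "x \<otimes>\<^bsub>Zp p\<^esub> y = y \<otimes>\<^bsub>Zp p\<^esub> x" for x y
      by (simp add: Zp_def mult.commute)
    show "\<one>\<^bsub>Zp p\<^esub> \<otimes>\<^bsub>Zp p\<^esub> x = x" if "x \<in> carrier (Zp p)" for x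
      using Zp_mod_self[OF that] by (simp add: Zp_def mod_mult_left_eq)
  qed
  show "(x \<oplus>\<^bsub>Zp p\<^esub> y) \<otimes>\<^bsub>Zp p\<^esub> z = x \<otimes>\<^bsub>Zp p\<^esub> z \<oplus>\<^bsub>Zp p\<^esub> y \<otimes>\<^bsub>Zp p\<^esub> z" for x y z
    by (simp add: Zp_def mod_mult_left_eq mod_add_eq distrib_right)
qed

lemma Zp_minus_apply:
  assumes p: "p > 0" and x: "x \<in> carrier (Zp p)" and y: "y \<in> carrier (Zp p)"
  shows   "(x \<ominus>\<^bsub>Zp p\<^esub> y) n = (x n - y n) mod int p ^ n"
proof -
  interpret cring "Zp p" by (rule Zp_cring[OF p])
  define z where "z = x \<ominus>\<^bsub>Zp p\<^esub> y"
  have z: "z \<in> carrier (Zp p)" using x y by (simp add: z_def)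
  have "z \<oplus>\<^bsub>Zp p\<^esub> y = x"
    using x y by (simp add: z_def a_minus_def a_assoc l_neg)
  then have "(z \<oplus>\<^bsub>Zp p\<^esub> y) n = x n"
    by simp
  then have "(z n + y n) mod int p ^ n = x n"
    by (simp add: Zp_def)
  then have "(x n - y n) mod int p ^ n = ((z n + y n) mod int p ^ n - y n) mod int p ^ n"
    by simp
  also have "\<dots> = z n mod int p ^ n"
    by (simp add: mod_diff_left_eq)
  finally have "(x n - y n) mod int p ^ n = z n mod int p ^ n" .
  then show ?thesis using Zp_mod_self[OF z] by (simp add: z_def)
qed

text \<open>The value \<open>e(z/p\<^sup>k)\<close> depends only on the \<open>p\<close>-adic number \<open>z/p\<^sup>k\<close>.\<close>

lemma Zp_e_scale:
  assumes p: "p > 0" and z: "z \<in> carrier (Zp p)"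
  shows   "Zp_e p (Suc k) (Zp_of_int p (int p) \<otimes>\<^bsub>Zp p\<^esub> z) = Zp_e p k z"
proof -
  have "(Zp_of_int p (int p) \<otimes>\<^bsub>Zp p\<^esub> z) (Suc k) = (int p * z (Suc k)) mod int p ^ Suc k"
    by (simp add: Zp_of_int_def Zp_def mod_mult_left_eq)
  also have "\<dots> = int p * (z (Suc k) mod int p ^ k)"
    by (simp only: mult_mod_right power_Suc)
  also have "z (Suc k) mod int p ^ k = z k"
    using z by (simp add: Zp_def)
  finally show ?thesis using p by (simp add: Zp_e_def Zp_residue_def)
qed

end

theory Submission
  imports Defs "HOL-Algebra.Algebraic_Closure_Type" "HOL-Number_Theory.Residues"
begin

hide_const (open) Divisibility.prime Coset.order up_ring.coeff up_ring.monom
  module.smult Polynomials.degree Polynomials.lead_coeff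

text \<open>
  Write \<open>z = x + i y\<close>, \<open>m = m\<^sub>2 + i m\<^sub>3\<close> and \<open>n = n\<^sub>2 + i n\<^sub>3\<close>, and let a bar denote complex conjugation.
  Since \<open>x\<^sup>2 + y\<^sup>2\<close> is the norm of \<open>z\<close>, the fraction \<open>(m\<^sub>2 x - m\<^sub>3 y) / (x\<^sup>2 + y\<^sup>2)\<close> is the real part
  of \<open>bar m / z\<close>, and \<open>n\<^sub>2 x + n\<^sub>3 y\<close> is the real part of \<open>bar n z\<close>. So the sum is a Kloosterman sum
  of \<open>e(Re(a z + b / z) / p\<^sup>k)\<close> over the units of \<open>\<int>[i] / p\<^sup>k\<close>, where \<open>k\<close> is \<open>r / 2\<close> rounded down and
  \<open>a = bar n\<close>; for \<open>p = 2\<close> and even \<open>r\<close> the variable is an odd multiple of \<open>1 + i\<close>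
  and one writes \<open>z = (1 + i) u\<close> with \<open>u\<close> of odd norm. As the ring has \<open>p\<^sup>2\<^sup>k\<close> elements, the theorem
  claims square-root cancellation.

  For \<open>k \<ge> 2\<close> this is the method of stationary phase. If \<open>k = j + t\<close> with \<open>j \<ge> t\<close>, then replacing \<open>z\<close> by
  \<open>z + p\<^sup>j w\<close> multiplies a summand by \<open>e(Re(w (a - b / z\<^sup>2)) / p\<^sup>t)\<close>, and averaging over \<open>w\<close> removes all
  \<open>z\<close> except those with \<open>a z\<^sup>2 = b\<close> modulo \<open>p\<^sup>t\<close> (\<open>stationary_phase\<close>, \<open>kloos_stationary\<close>). Here \<open>a\<close> is a unit,
  or nearly one for \<open>p = 2\<close>, so any two critical points agree up to sign modulo \<open>p\<^sup>t\<close> (modulo \<open>2\<^sup>t\<^sup>-\<^sup>4\<close>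
  for \<open>p = 2\<close>), which bounds their number. For \<open>p = 2\<close>, and for \<open>p = 3 mod 4\<close> with \<open>k\<close> even, the
  trivial bound for what remains suffices. For \<open>p = 3 mod 4\<close> and odd \<open>k\<close> it would
  lose a factor \<open>p\<close>, which comes back from the next term of the expansion of \<open>1 / z\<close>: it contributes a
  quadratic Gauss sum over the field with \<open>p\<^sup>2\<close> elements (\<open>inert_odd_bound\<close>).

  For \<open>p = 3 mod 4\<close> and \<open>k = 1\<close> one needs the Weil bound \<open>2 \<surd>q\<close> for Kloosterman sums over the field with
  \<open>q = p\<^sup>2\<close> elements (\<open>weil_kloosterman\<close>). The proof combines two facts about the sum \<open>K\<^sub>q\<close> over a field with
  \<open>q\<close> elements. First, passing to the quadratic extension gives \<open>K\<^sub>q\<^sub>*\<^sub>q = 2 q - K\<^sub>q\<^sup>2\<close>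
  (\<open>kloosterman_quadratic\<close>), so a violation \<open>\<bar>K\<^sub>q\<bar> > 2 \<surd>q\<close> would make \<open>\<bar>K\<bar> / \<surd>q\<close> grow beyond all bounds along the
  tower of iterated quadratic extensions. Secondly, for \<open>q = s\<^sup>2\<close> the polynomial method of Stepanov, in the form given by Bombieri,
  yields \<open>\<bar>K\<^sub>q\<bar> \<le> 7 p s + 1\<close> (\<open>kloosterman_bound_square\<close>), which keeps that quotient bounded.

  The fields live in an algebraic closure, which is a type, whereas \<open>p\<close> is a variable. This is resolved by
  constructing the prime field for a single prime, chosen such that the bound holds
  for all \<open>p\<close> if it holds for this one (\<open>test_prime\<close>).
\<close>


section \<open>Gaussian integers and stationary phase\<close>

datatype gint = GI (gre: int) (gim: int)

lemma gint_eq_iff: "z = w \<longleftrightarrow> gre z = gre w \<and> gim z = gim w"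
  by (cases z; cases w) auto

instantiation gint :: comm_ring_1
begin

definition "0 = GI 0 0"
definition "1 = GI 1 0"
definition "z + w = GI (gre z + gre w) (gim z + gim w)"
definition "- z = GI (- gre z) (- gim z)"
definition "z - w = GI (gre z - gre w) (gim z - gim w)"
definition "z * w = GI (gre z * gre w - gim z * gim w) (gre z * gim w + gim z * gre w)"

instance
  by standard (simp_all add: gint_eq_iff zero_gint_def one_gint_def plus_gint_def uminus_gint_def
    minus_gint_def times_gint_def algebra_simps)

end

lemma gint_sel [simp]:
  "gre 0 = 0" "gim 0 = 0" "gre 1 = 1" "gim 1 = 0"
  "gre (z + w) = gre z + gre w" "gim (z + w) = gim z + gim w"
  "gre (- z) = - gre z" "gim (- z) = - gim z"
  "gre (z - w) = gre z - gre w" "gim (z - w) = gim z - gim w"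
  "gre (z * w) = gre z * gre w - gim z * gim w"
  "gim (z * w) = gre z * gim w + gim z * gre w"
  by (simp_all add: zero_gint_def one_gint_def plus_gint_def uminus_gint_def minus_gint_def times_gint_def)

lemma gint_of_int [simp]: "gre (of_int n) = n" "gim (of_int n) = 0"
proof -
  have nat: "gre (of_nat m) = int m" "gim (of_nat m) = 0" for m by (induction m) auto
  show "gre (of_int n) = n" "gim (of_int n) = 0" by (cases n rule: int_diff_cases; simp add: nat)+
qed

lemma of_int_dvd_gint_iff: "of_int d dvd z \<longleftrightarrow> d dvd gre z \<and> d dvd gim z"
proof
  assume "of_int d dvd z"
  then obtain w where "z = of_int d * w" by blast
  thus "d dvd gre z \<and> d dvd gim z" by simp
next
  assume "d dvd gre z \<and> d dvd gim z"
  then obtain a b where "gre z = d * a" "gim z = d * b" by (auto elim!: dvdE)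
  hence "z = of_int d * GI a b" by (simp add: gint_eq_iff)
  thus "of_int d dvd z" by simp
qed

definition gcnj :: "gint \<Rightarrow> gint" where "gcnj z = GI (gre z) (- gim z)"
definition gnorm :: "gint \<Rightarrow> int" where "gnorm z = (gre z)\<^sup>2 + (gim z)\<^sup>2"

lemma gcnj_sel [simp]: "gre (gcnj z) = gre z" "gim (gcnj z) = - gim z"
  by (simp_all add: gcnj_def)

lemma mult_gcnj: "z * gcnj z = of_int (gnorm z)"
  by (simp add: gint_eq_iff gnorm_def power2_eq_square)

lemma gnorm_mult: "gnorm (z * w) = gnorm z * gnorm w"
  by (simp add: gnorm_def power2_eq_square algebra_simps)

lemma gnorm_of_int: "gnorm (of_int n) = n\<^sup>2"
  by (simp add: gnorm_def)

lemma dvd_mult_gnorm: "of_int d dvd z * w \<Longrightarrow> of_int d dvd of_int (gnorm z) * w"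
  by (metis dvd_mult2 mult.assoc mult.commute mult_gcnj)

lemma of_int_dvd_coprime_mult:
  assumes "coprime d n" "of_int d dvd of_int n * z"
  shows "of_int d dvd (z :: gint)"
  using assms by (auto simp: of_int_dvd_gint_iff coprime_dvd_mult_right_iff)

definition gbox :: "int \<Rightarrow> gint set" where
  "gbox q = {z. gre z \<in> {0..<q} \<and> gim z \<in> {0..<q}}"

definition gmod :: "int \<Rightarrow> gint \<Rightarrow> gint" where
  "gmod q z = GI (gre z mod q) (gim z mod q)"

lemma box_altdef: "gbox q = (\<lambda>(x, y). GI x y) ` ({0..<q} \<times> {0..<q})"
proof (intro equalityI subsetI)
  fix z assume "z \<in> gbox q"
  hence "z = (\<lambda>(x, y). GI x y) (gre z, gim z)" "(gre z, gim z) \<in> {0..<q} \<times> {0..<q}" by (auto simp: gbox_def)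
  thus "z \<in> (\<lambda>(x, y). GI x y) ` ({0..<q} \<times> {0..<q})" by (rule image_eqI)
qed (auto simp: gbox_def)

lemma inj_GI: "inj_on (\<lambda>(x, y). GI x y) A"
  by (auto simp: inj_on_def)

lemma finite_box [simp, intro]: "finite (gbox q)" by (simp add: box_altdef)

lemma card_box: "q \<ge> 0 \<Longrightarrow> card (gbox q) = (nat q)\<^sup>2"
  by (simp add: box_altdef card_image[OF inj_GI] card_cartesian_product power2_eq_square)

lemma sum_box: "(\<Sum>z\<in>gbox q. f z) = (\<Sum>x\<in>{0..<q}. \<Sum>y\<in>{0..<q}. f (GI x y))"
  unfolding box_altdef sum.reindex[OF inj_GI] by (simp add: sum.cartesian_product case_prod_unfold)

lemma gmod_box: "q > 0 \<Longrightarrow> gmod q z \<in> gbox q"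
  by (simp add: gmod_def gbox_def)

lemma gmod_dvd: "of_int q dvd gmod q z - z"
  by (simp add: gmod_def of_int_dvd_gint_iff mod_eq_dvd_iff[symmetric])

lemma box_unique: "z \<in> gbox q \<Longrightarrow> w \<in> gbox q \<Longrightarrow> of_int q dvd z - w \<Longrightarrow> z = w"
  by (auto simp: gbox_def of_int_dvd_gint_iff gint_eq_iff mod_eq_dvd_iff[symmetric])

text \<open>
  The square \<open>gbox q\<close> represents \<open>\<int>[i] / q\<close>, so a sum of a periodic function over it is
  invariant under translation.
\<close>

lemma sum_box_shift:
  assumes q: "q > 0" and f: "\<And>z w. of_int q dvd z - w \<Longrightarrow> f z = f w"
  shows "(\<Sum>z\<in>gbox q. f (z + h)) = (\<Sum>z\<in>gbox q. f z)"
proof (rule sum.reindex_bij_witness[of _ "\<lambda>z. gmod q (z - h)" "\<lambda>z. gmod q (z + h)"])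
  fix z assume z: "z \<in> gbox q"
  have *: "of_int q dvd gmod q (gmod q (z + g) - g) - z" for g
  proof -
    have "gmod q (gmod q (z + g) - g) - z = (gmod q (gmod q (z + g) - g) - (gmod q (z + g) - g)) + (gmod q (z + g) - (z + g))"
      by simp
    thus ?thesis using dvd_add[OF gmod_dvd gmod_dvd] by metis
  qed
  show "gmod q (gmod q (z + h) - h) = z" using *[of h] z gmod_box[OF q] box_unique by blast
  show "gmod q (gmod q (z - h) + h) = z" using *[of "-h"] z gmod_box[OF q] box_unique by fastforce
  show "gmod q (z - h) \<in> gbox q" "gmod q (z + h) \<in> gbox q" using gmod_box[OF q] by auto
  show "f (gmod q (z + h)) = f (z + h)" by (rule f) (rule gmod_dvd)
qed

definition ee :: "int \<Rightarrow> int \<Rightarrow> complex" where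
  "ee q n = exp (2 * of_real pi * \<i> * (of_int n / of_int q))"

lemma ee_add: "ee q (m + n) = ee q m * ee q n"
  by (simp add: ee_def exp_add[symmetric] add_divide_distrib distrib_left)

lemma ee_0 [simp]: "ee q 0 = 1" by (simp add: ee_def)

lemma norm_ee [simp]: "cmod (ee q n) = 1"
proof -
  have "ee q n = exp (\<i> * of_real (2 * pi * of_int n / of_int q))" by (simp add: ee_def mult_ac)
  thus ?thesis by (simp only: norm_exp_i_times)
qed

lemma ee_scale: "r \<noteq> 0 \<Longrightarrow> ee (r * q) (r * n) = ee q n" by (simp add: ee_def)

lemma ee_eq_1_iff: "q \<noteq> 0 \<Longrightarrow> ee q n = 1 \<longleftrightarrow> q dvd n"
proof -
  assume q: "q \<noteq> 0"
  have "ee q n = 1 \<longleftrightarrow> (\<exists>k::int. 2 * pi * (of_int n / real_of_int q) = of_int (2 * k) * pi)"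
    by (simp add: ee_def exp_eq_1)
  also have "\<dots> \<longleftrightarrow> (\<exists>k::int. of_int n / real_of_int q = of_int k)"
  proof (intro ex_cong1)
    fix k :: int
    have "2 * pi * (of_int n / real_of_int q) = of_int (2 * k) * pi \<longleftrightarrow> (2 * pi) * (of_int n / real_of_int q) = (2 * pi) * of_int k"
      by (simp add: mult_ac)
    thus "2 * pi * (of_int n / real_of_int q) = of_int (2 * k) * pi \<longleftrightarrow> of_int n / real_of_int q = of_int k"
      by (subst (asm) mult_cancel_left) simp
  qed
  also have "\<dots> \<longleftrightarrow> (\<exists>k. n = k * q)"
    using q by (simp add: field_simps) (metis of_int_eq_iff of_int_mult mult.commute)
  finally show ?thesis by (auto simp: dvd_def mult.commute)
qed

lemma ee_cong: "q dvd m - n \<Longrightarrow> ee q m = ee q n"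
proof (cases "q = 0")
  case False
  assume "q dvd m - n"
  hence "ee q (m - n) = 1" using False by (simp add: ee_eq_1_iff)
  thus ?thesis using ee_add[of q "m - n" n] by simp
qed auto

lemma sum_ee:
  assumes q: "q > 0"
  shows "(\<Sum>x\<in>{0..<q}. ee q (n * x)) = (if q dvd n then of_int q else 0)"
proof (cases "q dvd n")
  case True
  hence "ee q (n * x) = 1" for x using q by (simp add: ee_eq_1_iff)
  thus ?thesis using True q by simp
next
  case False
  have "(\<Sum>x\<in>{0..<q}. ee q (n * x)) = (\<Sum>x\<in>{0..<q}. ee q (n * (x + 1)))"
  proof (rule sum.reindex_bij_witness[of _ "\<lambda>x. (x + 1) mod q" "\<lambda>x. (x - 1) mod q"])
    fix x assume "x \<in> {0..<q}"
    have "[n * ((x - 1) mod q + 1) = n * (x - 1 + 1)] (mod q)" by (intro cong_mult cong_add) (auto simp: cong_def)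
    thus "ee q (n * ((x - 1) mod q + 1)) = ee q (n * x)" by (intro ee_cong) (simp add: cong_iff_dvd_diff)
  qed (use q in \<open>auto simp: mod_simps\<close>)
  also have "\<dots> = ee q n * (\<Sum>x\<in>{0..<q}. ee q (n * x))"
    by (simp add: distrib_left ee_add sum_distrib_left mult.commute)
  finally have "(1 - ee q n) * (\<Sum>x\<in>{0..<q}. ee q (n * x)) = 0" by (simp add: algebra_simps)
  moreover have "ee q n \<noteq> 1" using False q by (simp add: ee_eq_1_iff)
  ultimately show ?thesis using False by simp
qed

text \<open>
  Orthogonality. The pairing \<open>(w, l) \<mapsto> e(Re(w l) / q)\<close> on \<open>\<int>[i] / q\<close> is perfect: \<open>w = 1\<close> and \<open>w = i\<close>
  recover both coordinates of \<open>l\<close>.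
\<close>

lemma sum_box_ee:
  assumes q: "q > 0"
  shows "(\<Sum>w\<in>gbox q. ee q (gre (w * l))) = (if of_int q dvd l then of_int (q\<^sup>2) else 0)"
proof -
  have "(\<Sum>w\<in>gbox q. ee q (gre (w * l))) = (\<Sum>x\<in>{0..<q}. \<Sum>y\<in>{0..<q}. ee q (gre l * x) * ee q (- gim l * y))"
    by (simp add: sum_box ee_add[symmetric] algebra_simps)
  also have "\<dots> = (\<Sum>x\<in>{0..<q}. ee q (gre l * x)) * (\<Sum>y\<in>{0..<q}. ee q (- gim l * y))"
    by (simp add: sum_product)
  also have "\<dots> = (if of_int q dvd l then of_int (q\<^sup>2) else 0)"
    unfolding sum_ee[OF q] by (simp add: of_int_dvd_gint_iff power2_eq_square)
  finally show ?thesis .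
qed

text \<open>
  If a shift by \<open>P w\<close> multiplies \<open>f z\<close> by a character in \<open>w\<close> modulo \<open>M\<close>, then summing over \<open>w\<close> annihilates
  every \<open>z\<close> for which this character is nontrivial.
\<close>

lemma stationary_phase:
  assumes q: "q > 0" and M: "M > 0" and per: "\<And>z w. of_int q dvd z - w \<Longrightarrow> f z = f w"
    and shift: "\<And>z w. f (z + P * w) = f z * ee M (gre (w * l z))"
  shows "(\<Sum>z\<in>gbox q. f z) = (\<Sum>z\<in>{z \<in> gbox q. of_int M dvd l z}. f z)"
proof -
  have "of_int (M\<^sup>2) * (\<Sum>z\<in>gbox q. f z) = (\<Sum>w\<in>gbox M. \<Sum>z\<in>gbox q. f z)"
    using M by (simp add: card_box)
  also have "\<dots> = (\<Sum>w\<in>gbox M. \<Sum>z\<in>gbox q. f (z + P * w))"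
    using sum_box_shift[OF q, of f, OF per] by simp
  also have "\<dots> = (\<Sum>z\<in>gbox q. f z * (\<Sum>w\<in>gbox M. ee M (gre (w * l z))))"
    unfolding shift by (subst sum.swap) (simp add: sum_distrib_left)
  also have "\<dots> = of_int (M\<^sup>2) * (\<Sum>z\<in>gbox q. if of_int M dvd l z then f z else 0)"
    unfolding sum_box_ee[OF M] by (simp add: sum_distrib_left mult.commute if_distrib cong: if_cong)
  finally have "(\<Sum>z\<in>gbox q. f z) = (\<Sum>z\<in>gbox q. if of_int M dvd l z then f z else 0)"
    using M by simp
  thus ?thesis by (simp add: sum.inter_filter)
qed

lemma card_box_congruent:
  assumes d: "d > 0" "d dvd q" "q > 0"
  shows "card {z \<in> gbox q. of_int d dvd z - z0} \<le> (nat (q div d))\<^sup>2"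
proof -
  let ?g = "\<lambda>z. GI (gre z div d) (gim z div d)"
  have "inj_on ?g {z \<in> gbox q. of_int d dvd z - z0}"
  proof (rule inj_onI)
    fix z w assume z: "z \<in> {z \<in> gbox q. of_int d dvd z - z0}" and w: "w \<in> {z \<in> gbox q. of_int d dvd z - z0}"
      and e: "?g z = ?g w"
    have "of_int d dvd (z - z0) - (w - z0)" using z w dvd_diff by blast
    hence "gre z mod d = gre w mod d" "gim z mod d = gim w mod d" by (simp_all add: of_int_dvd_gint_iff mod_eq_dvd_iff)
    moreover have "gre z div d = gre w div d" "gim z div d = gim w div d" using e by simp_all
    ultimately show "z = w" unfolding gint_eq_iff by (metis div_mult_mod_eq)
  qed
  moreover have "?g ` {z \<in> gbox q. of_int d dvd z - z0} \<subseteq> gbox (q div d)"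
  proof clarify
    fix z assume z: "z \<in> gbox q"
    obtain r where r: "q = d * r" using d by blast
    have "x div d < r" if "x < q" for x
    proof (rule ccontr)
      assume "\<not> x div d < r"
      hence "d * r \<le> d * (x div d)" using d by simp
      also have "\<dots> \<le> x" using d by (simp add: minus_mod_eq_mult_div[symmetric])
      finally show False using that r by simp
    qed
    thus "?g z \<in> gbox (q div d)" using z d r by (auto simp: gbox_def pos_imp_zdiv_nonneg_iff)
  qed
  ultimately have "card {z \<in> gbox q. of_int d dvd z - z0} \<le> card (gbox (q div d))"
    by (rule card_inj_on_le) simp
  also have "\<dots> = (nat (q div d))\<^sup>2" using d by (intro card_box) (simp add: pos_imp_zdiv_nonneg_iff)
  finally show ?thesis .
qed

text \<open>
  This is how critical points are counted: they form at most two residue classes modulo a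
  large divisor \<open>d\<close> of \<open>q\<close>.
\<close>

lemma card_box_plus_minus:
  assumes d: "d > 0" "d dvd q" "q > 0" and V: "V \<subseteq> gbox q"
    and pm: "\<And>z w. z \<in> V \<Longrightarrow> w \<in> V \<Longrightarrow> of_int d dvd z - w \<or> of_int d dvd z + w"
  shows "card V \<le> 2 * (nat (q div d))\<^sup>2"
proof (cases "V = {}")
  case False
  then obtain w where w: "w \<in> V" by blast
  have "V \<subseteq> {z \<in> gbox q. of_int d dvd z - w} \<union> {z \<in> gbox q. of_int d dvd z - (- w)}"
    using pm[OF _ w] V by auto
  hence "card V \<le> card ({z \<in> gbox q. of_int d dvd z - w} \<union> {z \<in> gbox q. of_int d dvd z - (- w)})"
    by (intro card_mono) auto
  also have "\<dots> \<le> card {z \<in> gbox q. of_int d dvd z - w} + card {z \<in> gbox q. of_int d dvd z - (- w)}"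
    by (rule card_Un_le)
  also have "\<dots> \<le> 2 * (nat (q div d))\<^sup>2"
    using card_box_congruent[OF d, of w] card_box_congruent[OF d, of "-w"] by linarith
  finally show ?thesis .
qed auto


section \<open>Kloosterman sums over the Gaussian integers modulo prime powers\<close>

lemma inverse_unique_mod:
  fixes a b u d :: "'a::comm_ring_1"
  assumes "d dvd u * a - 1" "d dvd u * b - 1"
  shows "d dvd a - b"
proof -
  have "a - b = b * (u * a - 1) - a * (u * b - 1)" by (simp add: algebra_simps)
  thus ?thesis using assms by (metis dvd_diff dvd_mult)
qed

text \<open>
  The expansion \<open>1 / (z + h) = 1 / z - h / z\<^sup>2 + h\<^sup>2 / z\<^sup>3 - \<dots>\<close>, with \<open>J\<close> and \<open>J'\<close> in place of the inverses.
\<close>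

lemma inverse_shift_mod:
  fixes z h J d :: "'a::comm_ring_1"
  assumes "d dvd z * J - 1" "d dvd (z + h) * J' - 1" "d dvd h ^ 3"
  shows "d dvd J' - (J - h * J\<^sup>2 + h\<^sup>2 * J ^ 3)"
proof (rule inverse_unique_mod)
  have "(z + h) * (J - h * J\<^sup>2 + h\<^sup>2 * J ^ 3) - 1
      = (1 - h * J + h\<^sup>2 * J\<^sup>2) * (z * J - 1) + J ^ 3 * h ^ 3"
    by (simp add: algebra_simps power2_eq_square power3_eq_cube)
  thus "d dvd (z + h) * (J - h * J\<^sup>2 + h\<^sup>2 * J ^ 3) - 1" using assms by simp
qed (use assms in simp)

definition ginv :: "int \<Rightarrow> gint \<Rightarrow> gint" where
  "ginv q z = gcnj z * of_int (modular_inverse q (gnorm z))"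

lemma ginv:
  assumes "coprime (gnorm z) q"
  shows "of_int q dvd z * ginv q z - 1"
proof -
  have "q dvd gnorm z * modular_inverse q (gnorm z) - 1"
    using cong_modular_inverse1[OF assms] by (simp add: cong_iff_dvd_diff)
  hence "of_int q dvd (of_int (gnorm z * modular_inverse q (gnorm z) - 1) :: gint)"
    by (simp only: of_int_dvd_gint_iff gint_of_int) simp
  thus ?thesis by (simp add: ginv_def mult.assoc[symmetric] mult_gcnj)
qed

text \<open>
  The summand is extended by zero to all of \<open>\<int>[i]\<close>, so that the sum can run over \<open>gbox q\<close>.
\<close>

definition kloos :: "int \<Rightarrow> gint \<Rightarrow> gint \<Rightarrow> gint \<Rightarrow> complex" where
  "kloos q a b z = (if coprime (gnorm z) q then ee q (gre (a * z + b * ginv q z)) else 0)"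

lemma norm_kloos: "cmod (kloos q a b z) \<le> 1"
  by (simp add: kloos_def)

lemma ee_gcong: "of_int q dvd x - y \<Longrightarrow> ee q (gre x) = ee q (gre y)"
  by (intro ee_cong) (simp add: of_int_dvd_gint_iff)

lemma gnorm_add: "gnorm (z + h) = gnorm z + 2 * gre (z * gcnj h) + gnorm h"
  by (simp add: gnorm_def power2_eq_square algebra_simps)

lemma dvd_gnorm: "of_int p dvd z \<Longrightarrow> p dvd gnorm z"
  by (simp add: of_int_dvd_gint_iff gnorm_def power2_eq_square)

lemma coprime_gnorm_add:
  assumes "prime p" "of_int p dvd h"
  shows "coprime (gnorm (z + h)) (p ^ k) \<longleftrightarrow> coprime (gnorm z) (p ^ k)"
proof -
  have "p dvd gre (z * gcnj h)" "p dvd gnorm h"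
    using assms(2) dvd_gnorm by (auto simp: of_int_dvd_gint_iff)
  hence "p dvd 2 * gre (z * gcnj h) + gnorm h" by (intro dvd_add dvd_mult)
  hence iff: "p dvd gnorm (z + h) \<longleftrightarrow> p dvd gnorm z"
    unfolding gnorm_add add.assoc by (rule dvd_add_left_iff)
  have "coprime n p \<longleftrightarrow> \<not> p dvd n" for n
    using assms(1) by (metis coprime_commute prime_imp_coprime not_prime_unit coprime_absorb_left)
  thus ?thesis using iff by simp
qed

text \<open>
  The quadratic term in \<open>h\<close> is what produces Gauss sums when \<open>h\<^sup>2\<close> does not vanish modulo \<open>q\<close>.
\<close>

lemma kloos_shift3:
  assumes "coprime (gnorm (z + h)) q \<longleftrightarrow> coprime (gnorm z) q" "of_int q dvd h ^ 3"
  shows "kloos q a b (z + h) = kloos q a b z * ee q (gre (h * (a - b * (ginv q z)\<^sup>2) + h\<^sup>2 * (b * ginv q z ^ 3)))"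
proof (cases "coprime (gnorm z) q")
  case True
  let ?J = "ginv q z" and ?J' = "ginv q (z + h)"
  have J: "of_int q dvd ?J' - (?J - h * ?J\<^sup>2 + h\<^sup>2 * ?J ^ 3)"
    using True assms by (intro inverse_shift_mod[OF ginv ginv]) auto
  have "(a * (z + h) + b * ?J') - ((a * z + b * ?J) + (h * (a - b * ?J\<^sup>2) + h\<^sup>2 * (b * ?J ^ 3)))
      = b * (?J' - (?J - h * ?J\<^sup>2 + h\<^sup>2 * ?J ^ 3))"
    by (simp add: algebra_simps)
  hence "ee q (gre (a * (z + h) + b * ?J')) = ee q (gre ((a * z + b * ?J) + (h * (a - b * ?J\<^sup>2) + h\<^sup>2 * (b * ?J ^ 3))))"
    using J by (intro ee_gcong) simp
  also have "\<dots> = ee q (gre (a * z + b * ?J)) * ee q (gre (h * (a - b * ?J\<^sup>2) + h\<^sup>2 * (b * ?J ^ 3)))"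
    by (simp only: gint_sel(5) ee_add)
  finally show ?thesis using True assms by (simp only: kloos_def if_True)
qed (use assms in \<open>simp add: kloos_def\<close>)

lemma kloos_shift:
  assumes "coprime (gnorm (z + h)) q \<longleftrightarrow> coprime (gnorm z) q" "of_int q dvd h\<^sup>2"
  shows "kloos q a b (z + h) = kloos q a b z * ee q (gre (h * (a - b * (ginv q z)\<^sup>2)))"
proof -
  have "of_int q dvd h ^ 3" using assms(2) by (metis dvd_triv_left dvd_trans power2_eq_square power3_eq_cube)
  moreover have "ee q (gre (h * (a - b * (ginv q z)\<^sup>2) + h\<^sup>2 * (b * ginv q z ^ 3))) = ee q (gre (h * (a - b * (ginv q z)\<^sup>2)))"
    using assms(2) by (intro ee_gcong) simp
  ultimately show ?thesis using kloos_shift3[OF assms(1)] by simp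
qed

lemma kloos_periodic:
  assumes "prime p" "k > 0" "of_int (p ^ k) dvd z - w"
  shows "kloos (p ^ k) a b z = kloos (p ^ k) a b w"
proof -
  have p: "of_int p dvd z - w"
  proof -
    have "(of_int p :: gint) dvd of_int (p ^ k)" using assms(2) by simp
    thus ?thesis using assms(3) dvd_trans by blast
  qed
  have "of_int (p ^ k) dvd (z - w)\<^sup>2" using assms(3) by (simp add: power2_eq_square)
  hence "kloos (p ^ k) a b (w + (z - w)) = kloos (p ^ k) a b w * ee (p ^ k) (gre ((z - w) * (a - b * (ginv (p ^ k) w)\<^sup>2)))"
    by (rule kloos_shift[OF coprime_gnorm_add[OF assms(1) p]])
  also have "ee (p ^ k) (gre ((z - w) * (a - b * (ginv (p ^ k) w)\<^sup>2))) = ee (p ^ k) (gre 0)"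
    using assms(3) by (intro ee_gcong) simp
  finally show ?thesis by simp
qed

lemma ee_gscale: "r \<noteq> 0 \<Longrightarrow> ee (r * q) (gre (of_int r * z)) = ee q (gre z)"
  by (simp add: ee_scale)

text \<open>
  With \<open>J = 1 / z\<close> the stationary points are the solutions of \<open>a z\<^sup>2 = b\<close>.
\<close>

lemma critical_equation:
  assumes J: "of_int q dvd z * J - 1" and M: "M dvd q" and c: "of_int M dvd a - b * J\<^sup>2"
  shows "of_int M dvd a * z\<^sup>2 - (b :: gint)"
proof -
  have "of_int M dvd z * J - 1"
  proof -
    have "(of_int M :: gint) dvd of_int q" using M by (simp add: of_int_dvd_gint_iff)
    thus ?thesis using J dvd_trans by blast
  qed
  moreover have "a * z\<^sup>2 - b = z\<^sup>2 * (a - b * J\<^sup>2) + b * (z * J + 1) * (z * J - 1)"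
    by (simp add: algebra_simps power2_eq_square)
  ultimately show ?thesis using c by simp
qed

lemma kloos_stationary:
  assumes p: "prime p" and k: "k = j + t" "t \<le> j" "j > 0"
  shows "(\<Sum>z\<in>gbox (p ^ k). kloos (p ^ k) a b z)
       = (\<Sum>z\<in>{z \<in> gbox (p ^ k). of_int (p ^ t) dvd a - b * (ginv (p ^ k) z)\<^sup>2}. kloos (p ^ k) a b z)"
proof (rule stationary_phase)
  have p0: "p > 0" using p prime_gt_0_int by blast
  show "0 < p ^ k" "0 < p ^ t" using p0 by simp_all
  show "kloos (p ^ k) a b z = kloos (p ^ k) a b w" if "of_int (p ^ k) dvd z - w" for z w
    using kloos_periodic[OF p _ that] k by simp
  fix z w :: gint
  let ?h = "of_int (p ^ j) * w"
  have "of_int p dvd ?h" using k by (simp add: dvd_mult2)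
  moreover have "of_int (p ^ k) dvd ?h\<^sup>2"
  proof -
    have "(of_int (p ^ k) :: gint) dvd of_int (p ^ (j + j))"
      unfolding of_int_power by (rule le_imp_power_dvd) (use k in simp)
    thus ?thesis by (simp add: power2_eq_square power_add mult_ac dvd_mult2)
  qed
  ultimately have "kloos (p ^ k) a b (z + ?h) = kloos (p ^ k) a b z * ee (p ^ k) (gre (?h * (a - b * (ginv (p ^ k) z)\<^sup>2)))"
    by (intro kloos_shift coprime_gnorm_add p)
  also have "ee (p ^ k) (gre (?h * (a - b * (ginv (p ^ k) z)\<^sup>2))) = ee (p ^ t) (gre (w * (a - b * (ginv (p ^ k) z)\<^sup>2)))"
    unfolding mult.assoc k(1) power_add by (rule ee_gscale) (use p0 in simp)
  finally show "kloos (p ^ k) a b (z + of_int (p ^ j) * w) = kloos (p ^ k) a b z *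
     ee (p ^ t) (gre (w * (a - b * (ginv (p ^ k) z)\<^sup>2)))" .
qed

lemma sum_kloos_le_card:
  "cmod (\<Sum>z\<in>{z \<in> gbox q. R z}. kloos q a b z) \<le> card {z \<in> gbox q. coprime (gnorm z) q \<and> R z}"
proof -
  have "(\<Sum>z\<in>{z \<in> gbox q. R z}. kloos q a b z) = (\<Sum>z\<in>{z \<in> gbox q. coprime (gnorm z) q \<and> R z}. kloos q a b z)"
    by (rule sum.mono_neutral_right) (auto simp: kloos_def)
  also have "cmod \<dots> \<le> (\<Sum>z\<in>{z \<in> gbox q. coprime (gnorm z) q \<and> R z}. 1)"
    by (rule sum_norm_le) (rule norm_kloos)
  finally show ?thesis by simp
qed

text \<open>
  Such primes stay prime in \<open>\<int>[i]\<close>. If \<open>x\<^sup>2 = - y\<^sup>2\<close> modulo \<open>p\<close> with invertible \<open>x\<close> and \<open>y\<close>, then raising to the odd power \<open>(p - 1) / 2\<close>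
  contradicts Fermat's theorem.
\<close>

lemma prime_3_mod_4_dvd_sum_squares:
  fixes x y :: int
  assumes p: "prime p" "p mod 4 = 3" and d: "int p dvd x\<^sup>2 + y\<^sup>2"
  shows "int p dvd x"
proof (rule ccontr)
  assume x: "\<not> int p dvd x"
  have pp: "prime (int p)" using p by simp
  have y: "\<not> int p dvd y"
  proof
    assume "int p dvd y"
    hence "int p dvd y\<^sup>2" by (simp add: power2_eq_square)
    hence "int p dvd x\<^sup>2" using d by (simp add: dvd_add_left_iff)
    thus False using x pp prime_dvd_power by blast
  qed
  have fermat: "[z ^ (p - 1) = 1] (mod int p)" if z: "\<not> int p dvd z" for z :: int
  proof -
    define n where "n = nat (z mod int p)"
    have n: "int n = z mod int p" using p(1) prime_gt_0_nat by (simp add: n_def)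
    have "\<not> p dvd n"
    proof
      assume "p dvd n"
      hence "int p dvd z mod int p" using n by (metis of_nat_dvd_iff)
      thus False using z by (simp add: dvd_mod_iff)
    qed
    from fermat_theorem[OF p(1) this] have "[int n ^ (p - 1) = 1] (mod int p)"
      by (metis cong_int_iff of_nat_1 of_nat_power)
    thus ?thesis unfolding n by (simp add: cong_def power_mod)
  qed
  obtain m where m: "p = 4 * m + 3" using p(2) by (metis mult.commute mod_mult_div_eq add.commute div_mult_mod_eq)
  have e: "(p - 1) = 2 * (2 * m + 1)" using m by simp
  have "[x\<^sup>2 = - (y\<^sup>2)] (mod int p)" using d by (simp add: cong_iff_dvd_diff)
  hence "[(x\<^sup>2) ^ (2 * m + 1) = (- (y\<^sup>2)) ^ (2 * m + 1)] (mod int p)" by (rule cong_pow)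
  hence "[x ^ (p - 1) = - (y ^ (p - 1))] (mod int p)" unfolding e power_mult by simp
  moreover have "[- (y ^ (p - 1)) = - 1] (mod int p)" using fermat[OF y] by (simp add: cong_minus_minus_iff)
  ultimately have "[1 = - 1] (mod int p)" using fermat[OF x] cong_trans cong_sym by blast
  hence "int p dvd 2" by (simp add: cong_iff_dvd_diff)
  hence "int p \<le> 2" by (rule zdvd_imp_le) simp
  thus False using m by simp
qed

lemma inert_dvd:
  assumes p: "prime p" "p mod 4 = 3" and d: "int p dvd gnorm z"
  shows "of_int (int p) dvd z"
  using prime_3_mod_4_dvd_sum_squares[OF p, of "gre z" "gim z"] prime_3_mod_4_dvd_sum_squares[OF p, of "gim z" "gre z"] d
  unfolding gnorm_def of_int_dvd_gint_iff by (simp add: add.commute)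

context
  fixes p :: nat and P :: int
  assumes p: "prime p" "p mod 4 = 3" and P: "P = int p"
begin

lemma P_prime: "prime P" "P > 2"
proof -
  show "prime P" using p by (simp add: P)
  have "p \<noteq> 2" using p(2) by auto
  thus "P > 2" using prime_ge_2_nat[OF p(1)] by (simp add: P)
qed

lemma coprime_P: "coprime n (P ^ k) \<longleftrightarrow> k = 0 \<or> \<not> P dvd n"
  using P_prime by (metis coprime_commute prime_imp_coprime coprime_absorb_left coprime_power_right_iff not_prime_unit gr0I power_0 coprime_1_right)

lemma coprime_P_power: "\<not> P dvd n \<Longrightarrow> coprime (P ^ k) n"
  using coprime_P[of n k] by (simp add: coprime_commute)

text \<open>
  Both solutions satisfy \<open>(z - w) (z + w) = 0\<close> modulo \<open>P\<^sup>t\<close>, and \<open>P\<close> cannot divide both factors because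
  it does not divide their sum \<open>2 z\<close>.
\<close>

lemma inert_square_roots:
  assumes a: "\<not> P dvd gnorm a" and z: "\<not> P dvd gnorm z" and t: "t > 0"
    and e: "of_int (P ^ t) dvd a * z\<^sup>2 - b" "of_int (P ^ t) dvd a * w\<^sup>2 - b"
  shows "of_int (P ^ t) dvd z - w \<or> of_int (P ^ t) dvd z + w"
proof -
  have "a * ((z - w) * (z + w)) = (a * z\<^sup>2 - b) - (a * w\<^sup>2 - b)" by (simp add: algebra_simps power2_eq_square)
  hence "of_int (P ^ t) dvd a * ((z - w) * (z + w))" using e by (metis dvd_diff)
  hence "of_int (P ^ t) dvd of_int (gnorm a) * ((z - w) * (z + w))" by (rule dvd_mult_gnorm)
  moreover have "coprime (P ^ t) (gnorm a)" using a by (rule coprime_P_power)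
  ultimately have zw: "of_int (P ^ t) dvd (z - w) * (z + w)" by (rule of_int_dvd_coprime_mult[rotated])
  consider "\<not> P dvd gnorm (z - w)" | "\<not> P dvd gnorm (z + w)" | "P dvd gnorm (z - w)" "P dvd gnorm (z + w)" by blast
  thus ?thesis
  proof cases
    case 1
    hence "coprime (P ^ t) (gnorm (z - w))" by (rule coprime_P_power)
    thus ?thesis using dvd_mult_gnorm[OF zw] of_int_dvd_coprime_mult by blast
  next
    case 2
    hence "coprime (P ^ t) (gnorm (z + w))" by (rule coprime_P_power)
    moreover have "of_int (P ^ t) dvd of_int (gnorm (z + w)) * (z - w)"
      using zw by (intro dvd_mult_gnorm) (simp only: mult.commute)
    ultimately show ?thesis using of_int_dvd_coprime_mult by blast
  next
    case 3
    hence "of_int P dvd z - w" "of_int P dvd z + w" using inert_dvd[OF p] by (simp_all add: P)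
    hence "of_int P dvd (z - w) + (z + w)" by (rule dvd_add)
    hence "of_int P dvd of_int 2 * z" by simp
    moreover have "coprime P 2" using P_prime by (simp add: prime_odd_int coprime_right_2_iff_odd)
    ultimately have "of_int P dvd z" using of_int_dvd_coprime_mult by blast
    thus ?thesis using z dvd_gnorm by blast
  qed
qed

text \<open>
  The second claim holds because \<open>b = a z\<^sup>2\<close> modulo \<open>P\<close> for a unit \<open>z\<close>; it is what makes the Gauss sum nondegenerate.
\<close>

lemma inert_critical_set:
  fixes a b k t
  defines "V \<equiv> {z \<in> gbox (P ^ k). coprime (gnorm z) (P ^ k) \<and> of_int (P ^ t) dvd a - b * (ginv (P ^ k) z)\<^sup>2}"
  assumes a: "\<not> P dvd gnorm a" and t: "t > 0" "t \<le> k"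
  shows "card V \<le> 2 * nat (P ^ (k - t)) ^ 2" "V \<noteq> {} \<Longrightarrow> \<not> P dvd gnorm b"
proof -
  have crit: "of_int (P ^ t) dvd a * z\<^sup>2 - b" "\<not> P dvd gnorm z" if "z \<in> V" for z
  proof -
    have "of_int (P ^ k) dvd z * ginv (P ^ k) z - 1" using that by (intro ginv) (simp add: V_def)
    thus "of_int (P ^ t) dvd a * z\<^sup>2 - b"
      by (rule critical_equation) (use that t in \<open>auto simp: V_def intro: le_imp_power_dvd\<close>)
    have "coprime (gnorm z) (P ^ k)" using that unfolding V_def by blast
    thus "\<not> P dvd gnorm z" unfolding coprime_P using t by simp
  qed
  have P0: "P > 0" using P_prime by simp
  have "card V \<le> 2 * (nat (P ^ k div P ^ t))\<^sup>2"
  proof (rule card_box_plus_minus)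
    show "0 < P ^ t" "0 < P ^ k" using P0 by simp_all
    show "P ^ t dvd P ^ k" using t by (intro le_imp_power_dvd)
    show "V \<subseteq> gbox (P ^ k)" by (auto simp: V_def)
    show "of_int (P ^ t) dvd z - w \<or> of_int (P ^ t) dvd z + w" if "z \<in> V" "w \<in> V" for z w
      using inert_square_roots[OF a _ t(1)] crit that by blast
  qed
  thus "card V \<le> 2 * nat (P ^ (k - t)) ^ 2" using t P0 by (simp add: power_diff)
  assume "V \<noteq> {}"
  then obtain z where z: "z \<in> V" by blast
  show "\<not> P dvd gnorm b"
  proof
    assume "P dvd gnorm b"
    hence "of_int P dvd b" using inert_dvd[OF p] by (simp add: P)
    moreover have "of_int P dvd a * z\<^sup>2 - b"
    proof -
      have "(of_int P :: gint) dvd of_int (P ^ t)" using t(1) by simp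
      thus ?thesis using crit(1)[OF z] dvd_trans by blast
    qed
    ultimately have "of_int P dvd (a * z\<^sup>2 - b) + b" by (rule dvd_add[rotated])
    hence "of_int P dvd a * z\<^sup>2" by simp
    hence "P dvd gnorm (a * z\<^sup>2)" by (rule dvd_gnorm)
    hence "P dvd gnorm a * gnorm z * gnorm z" by (simp add: gnorm_mult power2_eq_square mult.assoc)
    thus False using a crit(2)[OF z] P_prime(1) by (auto simp: prime_dvd_mult_iff)
  qed
qed

lemma inert_even_bound:
  assumes a: "\<not> P dvd gnorm a" and t: "t > 0"
  shows "cmod (\<Sum>z\<in>gbox (P ^ (2 * t)). kloos (P ^ (2 * t)) a b z) \<le> 2 * P ^ (2 * t)"
proof -
  have "(\<Sum>z\<in>gbox (P ^ (2 * t)). kloos (P ^ (2 * t)) a b z)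
      = (\<Sum>z\<in>{z \<in> gbox (P ^ (2 * t)). of_int (P ^ t) dvd a - b * (ginv (P ^ (2 * t)) z)\<^sup>2}. kloos (P ^ (2 * t)) a b z)"
    by (rule kloos_stationary[where j = t]) (use t P_prime in auto)
  also have "cmod \<dots>
      \<le> card {z \<in> gbox (P ^ (2 * t)). coprime (gnorm z) (P ^ (2 * t)) \<and> of_int (P ^ t) dvd a - b * (ginv (P ^ (2 * t)) z)\<^sup>2}"
    by (rule sum_kloos_le_card)
  also have "\<dots> \<le> real (2 * nat (P ^ (2 * t - t)) ^ 2)"
    unfolding of_nat_le_iff by (rule inert_critical_set(1)) (use a t in auto)
  also have "\<dots> = 2 * P ^ (2 * t)" using P_prime by (simp add: power_mult mult.commute[of 2])
  finally show ?thesis .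
qed

text \<open>
  Opening the square of the absolute value and translating one variable turns the quadratic phase into
  a linear one, so only the diagonal remains and the square equals \<open>P\<^sup>2\<close>.
\<close>

lemma gauss_sum_bound:
  assumes "\<not> P dvd gnorm \<beta>"
  shows "cmod (\<Sum>w\<in>gbox P. ee P (gre (w * \<delta> + w\<^sup>2 * \<beta>))) \<le> P"
proof -
  have P0: "P > 0" using P_prime by simp
  let ?f = "\<lambda>w. ee P (gre (w * \<delta> + w\<^sup>2 * \<beta>))"
  let ?G = "\<Sum>w\<in>gbox P. ?f w"
  have per: "?f z = ?f w" if "of_int P dvd z - w" for z w
  proof (rule ee_gcong)
    have "(z * \<delta> + z\<^sup>2 * \<beta>) - (w * \<delta> + w\<^sup>2 * \<beta>) = (z - w) * (\<delta> + (z + w) * \<beta>)"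
      by (simp add: algebra_simps power2_eq_square)
    thus "of_int P dvd (z * \<delta> + z\<^sup>2 * \<beta>) - (w * \<delta> + w\<^sup>2 * \<beta>)" using that by simp
  qed
  have cnj_ee: "cnj (ee q n) = ee q (- n)" for q n by (simp add: ee_def exp_cnj)
  have "?G * cnj ?G = (\<Sum>w\<in>gbox P. (\<Sum>z\<in>gbox P. ?f z) * cnj (?f w))"
    by (simp add: sum_distrib_left)
  also have "\<dots> = (\<Sum>w\<in>gbox P. (\<Sum>z\<in>gbox P. ?f (z + w)) * cnj (?f w))"
    using sum_box_shift[OF P0, of ?f, OF per] by simp
  also have "\<dots> = (\<Sum>w\<in>gbox P. \<Sum>z\<in>gbox P. ?f z * ee P (gre (w * (of_int 2 * \<beta> * z))))"
    unfolding sum_distrib_right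
  proof (intro sum.cong refl)
    fix z w
    have "?f (z + w) * cnj (?f w) = ee P (gre ((z + w) * \<delta> + (z + w)\<^sup>2 * \<beta>) + (- gre (w * \<delta> + w\<^sup>2 * \<beta>)))"
      by (simp only: cnj_ee ee_add)
    also have "gre ((z + w) * \<delta> + (z + w)\<^sup>2 * \<beta>) + (- gre (w * \<delta> + w\<^sup>2 * \<beta>))
        = gre (z * \<delta> + z\<^sup>2 * \<beta>) + gre (w * (of_int 2 * \<beta> * z))"
      by (simp add: algebra_simps power2_eq_square)
    finally show "?f (z + w) * cnj (?f w) = ?f z * ee P (gre (w * (of_int 2 * \<beta> * z)))"
      by (simp only: ee_add)
  qed
  also have "\<dots> = (\<Sum>z\<in>gbox P. ?f z * (\<Sum>w\<in>gbox P. ee P (gre (w * (of_int 2 * \<beta> * z)))))"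
    by (subst sum.swap) (simp only: sum_distrib_left)
  also have "\<dots> = (\<Sum>z\<in>gbox P. if z = 0 then of_int (P\<^sup>2) else 0)"
  proof (rule sum.cong[OF refl])
    fix z assume z: "z \<in> gbox P"
    have "of_int P dvd of_int 2 * \<beta> * z \<longleftrightarrow> z = 0"
    proof
      assume "of_int P dvd of_int 2 * \<beta> * z"
      hence "of_int P dvd of_int 2 * (\<beta> * z)" by (simp only: mult.assoc)
      moreover have "coprime P 2" using P_prime by (simp add: prime_odd_int coprime_right_2_iff_odd)
      ultimately have "of_int P dvd \<beta> * z" using of_int_dvd_coprime_mult by blast
      hence "of_int P dvd of_int (gnorm \<beta>) * z" by (rule dvd_mult_gnorm)
      moreover have "coprime P (gnorm \<beta>)" using assms P_prime(1) prime_imp_coprime by blast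
      ultimately have "of_int P dvd z" using of_int_dvd_coprime_mult by blast
      hence "of_int P dvd z - 0" by simp
      thus "z = 0" using z P0 by (intro box_unique[of z P 0]) (auto simp: gbox_def)
    qed simp
    thus "?f z * (\<Sum>w\<in>gbox P. ee P (gre (w * (of_int 2 * \<beta> * z)))) = (if z = 0 then of_int (P\<^sup>2) else 0)"
      unfolding sum_box_ee[OF P0] by simp
  qed
  also have "\<dots> = of_int (P\<^sup>2)" 
  proof -
    have "0 \<in> gbox P" using P0 by (simp add: gbox_def)
    thus ?thesis by (simp add: sum.delta)
  qed
  finally have "complex_of_real ((cmod ?G)\<^sup>2) = complex_of_real (real_of_int (P\<^sup>2))"
    by (simp only: complex_norm_square of_real_of_int_eq)
  hence "(cmod ?G)\<^sup>2 = (real_of_int P)\<^sup>2" by (simp only: of_real_eq_iff of_int_power)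
  hence "(cmod ?G)\<^sup>2 \<le> (real_of_int P)\<^sup>2" by (rule eq_refl)
  thus ?thesis by (rule power2_le_imp_le) (use P0 in simp)
qed

text \<open>
  With \<open>k = 2 t + 1\<close> the critical points are determined only modulo \<open>P\<^sup>t\<close>, and there can be about
  \<open>2 P\<^sup>k\<^sup>+\<^sup>1\<close> of them. They come in classes that are invariant under \<open>z \<mapsto> z + P\<^sup>t w\<close>; on such a class the summand is
  a quadratic phase in \<open>w\<close> modulo \<open>P\<close>, and averaging over \<open>w\<close> saves the missing factor \<open>P\<close>.
\<close>

lemma inert_odd_bound:
  assumes a: "\<not> P dvd gnorm a" and t: "t > 0" and k: "k = 2 * t + 1"
  shows "cmod (\<Sum>z\<in>gbox (P ^ k). kloos (P ^ k) a b z) \<le> 2 * P ^ k"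
proof -
  let ?q = "P ^ k" and ?J = "ginv (P ^ k)"
  have P0: "P > 0" using P_prime by simp
  have q0: "?q > 0" using P0 by simp
  let ?C = "\<lambda>z. of_int (P ^ t) dvd a - b * (?J z)\<^sup>2"
  define f where "f = (\<lambda>z. if ?C z then kloos ?q a b z else 0)"
  define V where "V = {z \<in> gbox ?q. coprime (gnorm z) ?q \<and> ?C z}"
  have V: "card V \<le> 2 * nat (P ^ (k - t)) ^ 2" "V \<noteq> {} \<Longrightarrow> \<not> P dvd gnorm b"
    using inert_critical_set[OF a t, of k b] k unfolding V_def by auto
  have S: "(\<Sum>z\<in>gbox ?q. kloos ?q a b z) = (\<Sum>z\<in>gbox ?q. f z)"
  proof -
    have "(\<Sum>z\<in>gbox ?q. kloos ?q a b z) = (\<Sum>z\<in>{z \<in> gbox ?q. ?C z}. kloos ?q a b z)"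
      by (rule kloos_stationary[where j = "t + 1"]) (use k P_prime in auto)
    also have "\<dots> = (\<Sum>z\<in>gbox ?q. f z)" unfolding f_def by (rule sum.inter_filter) simp
    finally show ?thesis .
  qed
  have shiftC: "?C (z + h) \<longleftrightarrow> ?C z" if cop: "coprime (gnorm z) ?q" "coprime (gnorm (z + h)) ?q" and h: "of_int (P ^ t) dvd h" for z h
  proof -
    have Pt: "(of_int (P ^ t) :: gint) dvd of_int ?q" using k by (simp only: of_int_power) (rule le_imp_power_dvd, simp)
    have "of_int (P ^ t) dvd z * ?J z - 1" using ginv[OF cop(1)] Pt dvd_trans by blast
    moreover have "of_int (P ^ t) dvd z * ?J (z + h) - 1"
    proof -
      have "of_int (P ^ t) dvd (z + h) * ?J (z + h) - 1" using ginv[OF cop(2)] Pt dvd_trans by blast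
      hence "of_int (P ^ t) dvd ((z + h) * ?J (z + h) - 1) - h * ?J (z + h)" using dvd_mult2[OF h] by (rule dvd_diff)
      thus ?thesis by (simp add: algebra_simps)
    qed
    ultimately have "of_int (P ^ t) dvd ?J z - ?J (z + h)" by (rule inverse_unique_mod)
    hence d: "of_int (P ^ t) dvd (?J z - ?J (z + h)) * (b * (?J z + ?J (z + h)))" by (rule dvd_mult2)
    have "(a - b * (?J (z + h))\<^sup>2) = (a - b * (?J z)\<^sup>2) + (?J z - ?J (z + h)) * (b * (?J z + ?J (z + h)))"
      by (simp add: algebra_simps power2_eq_square)
    thus ?thesis using d by (metis dvd_add_left_iff)
  qed
  have per: "f z = f w" if zw: "of_int ?q dvd z - w" for z w
  proof (cases "coprime (gnorm w) ?q")
    case True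
    have kk: "kloos ?q a b z = kloos ?q a b w" using kloos_periodic[OF P_prime(1) _ zw] k by simp
    have "coprime (gnorm (w + (z - w))) ?q"
    proof -
      have "(of_int P :: gint) dvd of_int ?q" using k by simp
      hence "of_int P dvd z - w" using zw dvd_trans by blast
      thus ?thesis using True coprime_gnorm_add[OF P_prime(1)] by blast
    qed
    moreover have "of_int (P ^ t) dvd z - w"
    proof -
      have "(of_int (P ^ t) :: gint) dvd of_int ?q" using k by (simp only: of_int_power) (rule le_imp_power_dvd, simp)
      thus ?thesis using zw dvd_trans by blast
    qed
    ultimately have "?C (w + (z - w)) \<longleftrightarrow> ?C w" by (intro shiftC True)
    thus ?thesis using kk by (simp add: f_def)
  next
    case False
    hence "kloos ?q a b w = 0" by (simp add: kloos_def)
    moreover have "kloos ?q a b z = kloos ?q a b w" using kloos_periodic[OF P_prime(1) _ zw] k by simp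
    ultimately show ?thesis by (simp add: f_def)
  qed
  have inner: "cmod (\<Sum>w\<in>gbox P. f (z + of_int (P ^ t) * w)) \<le> (if z \<in> V then P else 0)" if z: "z \<in> gbox ?q" for z
  proof -
    have "(of_int P :: gint) dvd of_int (P ^ t)" using t by simp
    hence Pd: "of_int P dvd of_int (P ^ t) * w" for w :: gint by (rule dvd_mult2)
    have cop: "coprime (gnorm (z + of_int (P ^ t) * w)) ?q \<longleftrightarrow> coprime (gnorm z) ?q" for w
      by (rule coprime_gnorm_add[OF P_prime(1) Pd])
    show ?thesis
    proof (cases "z \<in> V")
      case False
      have "f (z + of_int (P ^ t) * w) = 0" for w
      proof (cases "coprime (gnorm z) ?q")
        case True
        hence "\<not> ?C z" using False z by (simp add: V_def)
        hence "\<not> ?C (z + of_int (P ^ t) * w)" using shiftC[of z "of_int (P ^ t) * w"] True cop by simp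
        thus ?thesis by (simp add: f_def)
      qed (use cop in \<open>simp add: f_def kloos_def\<close>)
      thus ?thesis using False by simp
    next
      case True
      hence cz: "coprime (gnorm z) ?q" "?C z" by (auto simp: V_def)
      then obtain \<delta> where \<delta>: "a - b * (?J z)\<^sup>2 = of_int (P ^ t) * \<delta>" by blast
      define \<beta> where "\<beta> = b * ?J z ^ 3"
      have "\<not> P dvd gnorm b" using V(2) True by blast
      moreover have "\<not> P dvd gnorm (?J z)"
      proof
        assume "P dvd gnorm (?J z)"
        hence J: "of_int P dvd ?J z" using inert_dvd[OF p] by (simp add: P)
        have "of_int P dvd z * ?J z - 1"
        proof -
          have "(of_int P :: gint) dvd of_int ?q" using k by simp
          thus ?thesis using ginv[OF cz(1)] dvd_trans by blast
        qed
        with dvd_mult[OF J] have "of_int P dvd z * ?J z - (z * ?J z - 1)" by (rule dvd_diff)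
        hence "P dvd 1" by (simp add: of_int_dvd_gint_iff)
        thus False using P_prime by simp
      qed
      ultimately have \<beta>: "\<not> P dvd gnorm \<beta>"
        unfolding \<beta>_def gnorm_mult power3_eq_cube using P_prime(1) by (auto simp: prime_dvd_mult_iff)
      have "f (z + of_int (P ^ t) * w) = kloos ?q a b z * ee P (gre (w * \<delta> + w\<^sup>2 * \<beta>))" for w
      proof -
        let ?h = "of_int (P ^ t) * w"
        have "of_int ?q dvd ?h ^ 3"
        proof -
          have "(of_int ?q :: gint) dvd of_int (P ^ (t * 3))"
            unfolding of_int_power by (rule le_imp_power_dvd) (use k t in simp)
          thus ?thesis by (simp add: power_mult_distrib power_mult dvd_mult2)
        qed
        with cop have "kloos ?q a b (z + ?h) = kloos ?q a b z * ee ?q (gre (?h * (a - b * (?J z)\<^sup>2) + ?h\<^sup>2 * (b * ?J z ^ 3)))"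
          by (rule kloos_shift3)
        also have "?h * (a - b * (?J z)\<^sup>2) + ?h\<^sup>2 * (b * ?J z ^ 3) = of_int (P ^ (2 * t)) * (w * \<delta> + w\<^sup>2 * \<beta>)"
        proof -
          have "(of_int (P ^ (2 * t)) :: gint) = of_int (P ^ t) * of_int (P ^ t)" by (simp add: mult_2 power_add)
          thus ?thesis unfolding \<delta> \<beta>_def by (simp add: algebra_simps power2_eq_square)
        qed
        also have "ee ?q (gre (of_int (P ^ (2 * t)) * (w * \<delta> + w\<^sup>2 * \<beta>))) = ee P (gre (w * \<delta> + w\<^sup>2 * \<beta>))"
          unfolding k power_add power_one_right using P0 by (intro ee_gscale) simp
        finally have "kloos ?q a b (z + ?h) = kloos ?q a b z * ee P (gre (w * \<delta> + w\<^sup>2 * \<beta>))" .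
        moreover have "?C (z + ?h)" using shiftC[of z ?h] cz cop by simp
        ultimately show ?thesis by (simp add: f_def)
      qed
      hence "cmod (\<Sum>w\<in>gbox P. f (z + of_int (P ^ t) * w)) = cmod (kloos ?q a b z) * cmod (\<Sum>w\<in>gbox P. ee P (gre (w * \<delta> + w\<^sup>2 * \<beta>)))"
        by (simp only: sum_distrib_left[symmetric] norm_mult)
      also have "\<dots> \<le> 1 * real_of_int P" using gauss_sum_bound[OF \<beta>] norm_kloos by (intro mult_mono) auto
      finally show ?thesis using True by simp
    qed
  qed
  have "of_int (P\<^sup>2) * (\<Sum>z\<in>gbox ?q. f z) = (\<Sum>w\<in>gbox P. \<Sum>z\<in>gbox ?q. f z)"
    using P0 by (simp add: card_box)
  also have "\<dots> = (\<Sum>w\<in>gbox P. \<Sum>z\<in>gbox ?q. f (z + of_int (P ^ t) * w))"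
    using sum_box_shift[OF q0, of f, OF per] by simp
  also have "\<dots> = (\<Sum>z\<in>gbox ?q. \<Sum>w\<in>gbox P. f (z + of_int (P ^ t) * w))" by (rule sum.swap)
  finally have avg: "of_int (P\<^sup>2) * (\<Sum>z\<in>gbox ?q. f z) = (\<Sum>z\<in>gbox ?q. \<Sum>w\<in>gbox P. f (z + of_int (P ^ t) * w))" .
  have "real_of_int (P\<^sup>2) * cmod (\<Sum>z\<in>gbox ?q. f z) = cmod (of_int (P\<^sup>2) * (\<Sum>z\<in>gbox ?q. f z))"
    by (simp add: norm_mult norm_power)
  also have "\<dots> \<le> (\<Sum>z\<in>gbox ?q. if z \<in> V then real_of_int P else 0)"
    unfolding avg
  proof (rule sum_norm_le)
    fix z assume "z \<in> gbox ?q"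
    from inner[OF this] show "cmod (\<Sum>w\<in>gbox P. f (z + of_int (P ^ t) * w)) \<le> (if z \<in> V then real_of_int P else 0)"
      by (cases "z \<in> V") auto
  qed
  also have "\<dots> = real_of_int P * real (card V)"
  proof -
    have "gbox ?q \<inter> {z. z \<in> V} = V" by (auto simp: V_def)
    thus ?thesis by (simp add: sum.If_cases)
  qed
  also have "\<dots> \<le> real_of_int P * real (2 * nat (P ^ (k - t)) ^ 2)"
    using V(1) P0 by (intro mult_left_mono of_nat_mono) auto
  also have "\<dots> = real_of_int (P\<^sup>2) * (2 * real_of_int (P ^ k))"
  proof -
    have "real (nat (P ^ (t + 1))) = real_of_int P ^ (t + 1)" using P0 by simp
    moreover have "k - t = t + 1" using k by simp
    ultimately have "real (2 * nat (P ^ (k - t)) ^ 2) = 2 * (real_of_int P ^ (t + 1))\<^sup>2" by (simp only: of_nat_mult of_nat_power of_nat_numeral)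
    also have "\<dots> = 2 * real_of_int P ^ (2 * t + 2)" unfolding power_mult[symmetric] by (simp add: algebra_simps)
    finally have e: "real (2 * nat (P ^ (k - t)) ^ 2) = 2 * real_of_int P ^ (2 * t + 2)" .
    show ?thesis unfolding e by (simp add: k power2_eq_square)
  qed
  finally have le: "real_of_int (P\<^sup>2) * cmod (\<Sum>z\<in>gbox ?q. f z) \<le> real_of_int (P\<^sup>2) * (2 * real_of_int (P ^ k))" .
  have "0 < real_of_int (P\<^sup>2)" using P0 by simp
  hence "cmod (\<Sum>z\<in>gbox ?q. f z) \<le> 2 * real_of_int (P ^ k)" using le by (rule mult_le_cancel_left_pos[THEN iffD1])
  thus ?thesis unfolding S by simp
qed

end


section \<open>Powers of two\<close>

lemma dvd_of_not_8_dvd: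
  fixes n x :: int
  assumes "\<not> 8 dvd n" "2 ^ t dvd n * x"
  shows "2 ^ (t - 2) dvd x"
proof -
  have odd_case: "2 ^ s dvd y" if "odd m" "2 ^ s dvd m * y" for m y :: int and s
    using that by (metis coprime_dvd_mult_right_iff coprime_power_left_iff coprime_left_2_iff_odd)
  have mono: "2 ^ (t - 2) dvd x" if "2 ^ s dvd x" "t - 2 \<le> s" for s
    using that by (meson dvd_trans le_imp_power_dvd)
  have strip: "2 ^ (s - 1) dvd y" if "2 ^ s dvd 2 * y" for y :: int and s
    using that by (cases s) auto
  show ?thesis
  proof (cases "odd n")
    case True
    from odd_case[OF this assms(2)] show ?thesis by (rule mono) simp
  next
    case False
    then obtain m where m: "n = 2 * m" by blast
    have 1: "2 ^ (t - 1) dvd m * x" using strip[of t "m * x"] assms(2) by (simp add: m mult.assoc)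
    show ?thesis
    proof (cases "odd m")
      case True
      from odd_case[OF this 1] show ?thesis by (rule mono) simp
    next
      case False
      then obtain l where l: "m = 2 * l" by blast
      have "2 ^ (t - 1 - 1) dvd l * x" using strip[of "t - 1" "l * x"] 1 by (simp add: l mult.assoc)
      moreover have "odd l" using assms(1) m l by auto
      ultimately have "2 ^ (t - 1 - 1) dvd x" using odd_case by blast
      thus ?thesis by (rule mono) simp
    qed
  qed
qed

lemma gdvd_of_not_8_dvd:
  assumes "\<not> 8 dvd n" "of_int (2 ^ t) dvd of_int n * w"
  shows "of_int (2 ^ (t - 2)) dvd (w :: gint)"
  using assms dvd_of_not_8_dvd[OF assms(1), of t] unfolding of_int_dvd_gint_iff by simp

text \<open>
  The two factors \<open>z - w\<close> and \<open>z + w\<close> add up to \<open>2 z\<close>, whose norm is 4 times an odd number. So one of the two norms is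
  not divisible by 8, and that factor accounts for at most \<open>2\<^sup>2\<close> of the power of 2 dividing the product. The coefficient \<open>a\<close> accounts for
  another \<open>2\<^sup>2\<close>, whence the exponent \<open>t - 4\<close>.
\<close>

lemma dyadic_square_roots:
  assumes a: "\<not> 8 dvd gnorm a" and z: "odd (gnorm z)"
    and e: "of_int (2 ^ t) dvd a * z\<^sup>2 - b" "of_int (2 ^ t) dvd a * w\<^sup>2 - b"
  shows "of_int (2 ^ (t - 4)) dvd z - w \<or> of_int (2 ^ (t - 4)) dvd z + w"
proof -
  have "a * ((z - w) * (z + w)) = (a * z\<^sup>2 - b) - (a * w\<^sup>2 - b)" by (simp add: algebra_simps power2_eq_square)
  hence "of_int (2 ^ t) dvd a * ((z - w) * (z + w))" using e by (metis dvd_diff)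
  hence "of_int (2 ^ t) dvd of_int (gnorm a) * ((z - w) * (z + w))" by (rule dvd_mult_gnorm)
  with a have zw: "of_int (2 ^ (t - 2)) dvd (z - w) * (z + w)" by (rule gdvd_of_not_8_dvd)
  have t4: "t - 2 - 2 = t - 4" by simp
  show ?thesis
  proof (cases "8 dvd gnorm (z - w)")
    case False
    from gdvd_of_not_8_dvd[OF this dvd_mult_gnorm[OF zw]] show ?thesis unfolding t4 by blast
  next
    case True
    have "\<not> 8 dvd gnorm (z + w)"
    proof
      assume 8: "8 dvd gnorm (z + w)"
      define x y where "x = gre (z - w)" and "y = gim (z - w)"
      have "8 dvd x\<^sup>2 + y\<^sup>2" using True by (simp add: gnorm_def x_def y_def)
      have "even x \<and> even y"
      proof -
        have par: "even x \<longleftrightarrow> even y"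
        proof -
          have "even (x\<^sup>2 + y\<^sup>2)" using \<open>8 dvd x\<^sup>2 + y\<^sup>2\<close> by (meson dvd_trans dvd_triv_left even_numeral)
          thus ?thesis by simp
        qed
        have "even x"
        proof (rule ccontr)
          assume "odd x"
          hence "odd y" using par by simp
          obtain m n where "x = 2 * m + 1" "y = 2 * n + 1" using \<open>odd x\<close> \<open>odd y\<close> by (auto elim!: oddE)
          hence "x\<^sup>2 + y\<^sup>2 = 4 * (m * m + m + n * n + n) + 2" by (simp add: power2_eq_square algebra_simps)
          moreover have "4 dvd x\<^sup>2 + y\<^sup>2" using \<open>8 dvd x\<^sup>2 + y\<^sup>2\<close> by (rule dvd_trans[rotated]) simp
          ultimately show False by presburger
        qed
        thus ?thesis using par by simp
      qed
      then obtain m n where mn: "x = 2 * m" "y = 2 * n" by blast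
      have "gnorm (z + w) = 4 * gnorm z - 8 * (m * gre z + n * gim z) + gnorm (z - w)"
      proof -
        have w: "gre w = gre z - 2 * m" "gim w = gim z - 2 * n" using mn by (simp_all add: x_def y_def)
        show ?thesis by (simp add: gnorm_def w power2_eq_square algebra_simps)
      qed
      hence "8 dvd 4 * gnorm z - 8 * (m * gre z + n * gim z)" using 8 True by (metis dvd_add_left_iff)
      hence "8 dvd 4 * gnorm z" by presburger
      thus False using z by presburger
    qed
    moreover have "of_int (2 ^ (t - 2)) dvd of_int (gnorm (z + w)) * (z - w)"
      using zw by (intro dvd_mult_gnorm) (simp only: mult.commute)
    ultimately have "of_int (2 ^ (t - 2 - 2)) dvd z - w" by (rule gdvd_of_not_8_dvd)
    thus ?thesis unfolding t4 by blast
  qed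
qed

text \<open>
  The parameter \<open>c\<close> is 1 for the sum over units and \<open>1 + i\<close> for the sum over odd multiples of \<open>1 + i\<close>.
\<close>

lemma dyadic_critical_set:
  assumes a: "\<not> 8 dvd gnorm a" and V: "V \<subseteq> gbox (2 ^ k)"
    and u: "\<And>z. z \<in> V \<Longrightarrow> z = c * u z" "\<And>z. z \<in> V \<Longrightarrow> odd (gnorm (u z))"
      "\<And>z. z \<in> V \<Longrightarrow> of_int (2 ^ (k div 2)) dvd a * (u z)\<^sup>2 - b"
  shows "real (card V) \<le> 1024 * 2 ^ k"
proof -
  let ?t = "k div 2"
  have "card V \<le> 2 * (nat (2 ^ k div 2 ^ (?t - 4)))\<^sup>2"
  proof (rule card_box_plus_minus[OF _ _ _ V])
    show "(2::int) ^ (?t - 4) dvd 2 ^ k" by (intro le_imp_power_dvd) simp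
    fix z w assume zw: "z \<in> V" "w \<in> V"
    from dyadic_square_roots[OF a u(2)[OF zw(1)] u(3)[OF zw(1)] u(3)[OF zw(2)]]
    have "of_int (2 ^ (?t - 4)) dvd c * (u z - u w) \<or> of_int (2 ^ (?t - 4)) dvd c * (u z + u w)"
      by (blast intro: dvd_mult)
    thus "of_int (2 ^ (?t - 4)) dvd z - w \<or> of_int (2 ^ (?t - 4)) dvd z + w"
      using u(1)[OF zw(1)] u(1)[OF zw(2)] by (metis distrib_left right_diff_distrib)
  qed simp_all
  also have "nat (2 ^ k div 2 ^ (?t - 4)) = 2 ^ (k - (?t - 4))"
    by (simp add: power_diff[symmetric] nat_power_eq)
  also have "2 * (2 ^ (k - (?t - 4)))\<^sup>2 = (2::nat) ^ (1 + 2 * (k - (?t - 4)))"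
    by (simp add: power_mult[symmetric] mult.commute)
  also have "\<dots> \<le> 2 ^ (10 + k)" by (rule power_increasing) auto
  also have "\<dots> = 1024 * 2 ^ k" by (simp add: power_add)
  finally have "real (card V) \<le> real (1024 * 2 ^ k)" by (simp only: of_nat_le_iff)
  thus ?thesis by simp
qed

lemma dyadic_bound:
  assumes a: "\<not> 8 dvd gnorm a" and k: "k > 0"
  shows "cmod (\<Sum>z\<in>gbox (2 ^ k). kloos (2 ^ k) a b z) \<le> 1024 * 2 ^ k"
proof -
  let ?t = "k div 2"
  have "(\<Sum>z\<in>gbox (2 ^ k). kloos (2 ^ k) a b z)
      = (\<Sum>z\<in>{z \<in> gbox (2 ^ k). of_int (2 ^ ?t) dvd a - b * (ginv (2 ^ k) z)\<^sup>2}. kloos (2 ^ k) a b z)"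
    by (rule kloos_stationary[where j = "k - ?t"]) (use k in auto)
  also have "cmod \<dots> \<le> card {z \<in> gbox (2 ^ k). coprime (gnorm z) (2 ^ k) \<and> of_int (2 ^ ?t) dvd a - b * (ginv (2 ^ k) z)\<^sup>2}"
    (is "_ \<le> real (card ?V)") by (rule sum_kloos_le_card)
  also have "\<dots> \<le> 1024 * 2 ^ k"
  proof (rule dyadic_critical_set[OF a, where c = 1 and u = "\<lambda>z. z"])
    fix z assume z: "z \<in> ?V"
    show "odd (gnorm z)" using z k by (simp add: coprime_right_2_iff_odd)
    have "of_int (2 ^ k) dvd z * ginv (2 ^ k) z - 1" using z by (intro ginv) blast
    thus "of_int (2 ^ ?t) dvd a * z\<^sup>2 - b"
      by (rule critical_equation) (use z in \<open>auto intro: le_imp_power_dvd\<close>)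
  qed auto
  finally show ?thesis .
qed

text \<open>
  The quotient \<open>z / (1 + i)\<close>; it is exact precisely when the coordinates of \<open>z\<close> have the same parity.
\<close>

definition ghalf :: "gint \<Rightarrow> gint" where
  "ghalf z = GI ((gre z + gim z) div 2) ((gim z - gre z) div 2)"

lemma ghalf_shift:
  "even (gre (z + GI 1 1 * h) + gim (z + GI 1 1 * h)) \<longleftrightarrow> even (gre z + gim z)"
  "ghalf (z + GI 1 1 * h) = ghalf z + h"
proof -
  show "even (gre (z + GI 1 1 * h) + gim (z + GI 1 1 * h)) \<longleftrightarrow> even (gre z + gim z)"
    by simp
  show "ghalf (z + GI 1 1 * h) = ghalf z + h"
    by (simp add: ghalf_def gint_eq_iff) presburger
qed

lemma ghalf:
  assumes "even (gre z + gim z)"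
  shows "z = GI 1 1 * ghalf z"
proof -
  from assms show ?thesis by (simp add: ghalf_def gint_eq_iff) presburger
qed

text \<open>
  The unit \<open>u = z / (1 + i)\<close> is determined by \<open>z\<close> modulo \<open>2\<^sup>k\<close> only up to multiples of \<open>2\<^sup>k\<^sup>-\<^sup>1 (1 - i)\<close>. The summand
  is nevertheless periodic in \<open>z\<close>, because the coefficients of \<open>u\<close> and \<open>1 / u\<close> contain the factors \<open>1 + i\<close> and \<open>1 - i\<close>.
\<close>

lemma dyadic_ramified_bound:
  fixes a b :: gint
  assumes a: "gnorm a mod 4 = 2" and k: "k \<ge> 2"
  defines "f \<equiv> (\<lambda>z. if even (gre z + gim z) then kloos (2 ^ k) (a * GI 1 1) (b * GI 1 (-1)) (ghalf z) else 0)"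
  shows "cmod (\<Sum>z\<in>gbox (2 ^ k). f z) \<le> 1024 * 2 ^ k"
proof -
  define \<alpha> where "\<alpha> = a * GI 1 1"
  define \<beta> where "\<beta> = b * GI 1 (-1)"
  let ?q = "2 ^ k :: int" and ?t = "k div 2" and ?J = "ginv (2 ^ k)"
  have f: "f z = (if even (gre z + gim z) then kloos ?q \<alpha> \<beta> (ghalf z) else 0)" for z
    by (simp add: f_def \<alpha>_def \<beta>_def)
  have \<alpha>8: "\<not> 8 dvd gnorm \<alpha>"
  proof -
    have "gnorm \<alpha> = 2 * gnorm a" by (simp add: \<alpha>_def gnorm_mult) (simp add: gnorm_def)
    thus ?thesis using a by presburger
  qed
  have shift: "f (z + GI 1 1 * h) = f z * ee ?q (gre (h * (\<alpha> - \<beta> * (?J (ghalf z))\<^sup>2)))"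
    if h: "of_int 2 dvd h" "of_int ?q dvd h\<^sup>2" for z h
  proof (cases "even (gre z + gim z)")
    case True
    have "kloos ?q \<alpha> \<beta> (ghalf z + h) = kloos ?q \<alpha> \<beta> (ghalf z) * ee ?q (gre (h * (\<alpha> - \<beta> * (?J (ghalf z))\<^sup>2)))"
      by (rule kloos_shift[OF coprime_gnorm_add[OF _ h(1)] h(2)]) simp
    thus ?thesis using True unfolding f ghalf_shift by simp
  next
    case False
    thus ?thesis unfolding f ghalf_shift by simp
  qed
  have "(\<Sum>z\<in>gbox ?q. f z) = (\<Sum>z\<in>{z \<in> gbox ?q. of_int (2 ^ ?t) dvd \<alpha> - \<beta> * (?J (ghalf z))\<^sup>2}. f z)"
  proof (rule stationary_phase[where P = "GI 1 1 * of_int (2 ^ (k - ?t))"])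
    fix z w :: gint
    assume "of_int ?q dvd z - w"
    then obtain g where g: "z - w = of_int ?q * g" by blast
    \<comment> \<open>A shift of \<open>z\<close> by \<open>2\<^sup>k g\<close> is a shift of \<open>u\<close> by \<open>2\<^sup>k g / (1 + i) = (1 - i) 2\<^sup>k\<^sup>-\<^sup>1 g\<close>.\<close>
    define h where "h = GI 1 (-1) * of_int (2 ^ (k - 1)) * g"
    have k': "(2::int) ^ k = 2 * 2 ^ (k - 1)" using k by (metis One_nat_def Suc_pred power_Suc not_numeral_le_zero gr0I)
    have II: "GI 1 1 * GI 1 (-1) = of_int 2" "GI 1 (-1) * GI 1 (-1) = of_int 2 * GI 0 (-1)" by (simp_all add: gint_eq_iff del: of_int_numeral)
    have "GI 1 1 * h = (GI 1 1 * GI 1 (-1)) * of_int (2 ^ (k - 1)) * g" by (simp add: h_def mult.assoc)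
    also have "\<dots> = z - w" unfolding II g k' by (simp add: mult.assoc)
    finally have z: "z = w + GI 1 1 * h" by simp
    have h2: "of_int 2 dvd h"
    proof -
      have "(of_int 2 :: gint) dvd of_int (2 ^ (k - 1))" unfolding of_int_dvd_gint_iff gint_of_int using k by simp
      thus ?thesis unfolding h_def by (intro dvd_mult2 dvd_mult)
    qed
    have hq: "of_int ?q dvd h\<^sup>2"
    proof -
      have "(of_int ?q :: gint) dvd of_int (2 ^ (k - 1) * 2 ^ (k - 1))"
        unfolding power_add[symmetric] of_int_power by (rule le_imp_power_dvd) (use k in simp)
      moreover have "h\<^sup>2 = of_int (2 ^ (k - 1) * 2 ^ (k - 1)) * (GI 1 (-1) * g)\<^sup>2"
        by (simp add: h_def power2_eq_square mult_ac)
      ultimately show ?thesis by (metis dvd_mult2)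
    qed
    have "of_int ?q dvd h * (\<alpha> - \<beta> * (?J (ghalf w))\<^sup>2) - 0"
    proof -
      have "h * (\<alpha> - \<beta> * (?J (ghalf w))\<^sup>2)
          = (GI 1 1 * GI 1 (-1)) * of_int (2 ^ (k - 1)) * (g * a) - (GI 1 (-1) * GI 1 (-1)) * of_int (2 ^ (k - 1)) * (g * b * (?J (ghalf w))\<^sup>2)"
        by (simp add: h_def \<alpha>_def \<beta>_def algebra_simps)
      also have "\<dots> = of_int ?q * (g * a - GI 0 (-1) * (g * b * (?J (ghalf w))\<^sup>2))"
        unfolding II k' by (simp add: algebra_simps)
      finally show ?thesis by simp
    qed
    hence "ee ?q (gre (h * (\<alpha> - \<beta> * (?J (ghalf w))\<^sup>2))) = ee ?q (gre 0)" by (rule ee_gcong)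
    thus "f z = f w" unfolding z shift[OF h2 hq] by simp
  next
    fix z w :: gint
    let ?h = "of_int (2 ^ (k - ?t)) * w"
    have h2: "of_int 2 dvd ?h"
    proof -
      have "(of_int 2 :: gint) dvd of_int (2 ^ (k - ?t))" unfolding of_int_dvd_gint_iff gint_of_int using k by simp
      thus ?thesis by (rule dvd_mult2)
    qed
    have hq: "of_int ?q dvd ?h\<^sup>2"
    proof -
      have "(of_int ?q :: gint) dvd of_int (2 ^ (k - ?t) * 2 ^ (k - ?t))"
        unfolding power_add[symmetric] of_int_power by (rule le_imp_power_dvd) linarith
      moreover have "?h\<^sup>2 = of_int (2 ^ (k - ?t) * 2 ^ (k - ?t)) * w\<^sup>2"
        by (simp add: power2_eq_square mult_ac)
      ultimately show ?thesis by (metis dvd_mult2)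
    qed
    define l where "l = \<alpha> - \<beta> * (?J (ghalf z))\<^sup>2"
    have "?q = 2 ^ (k - ?t) * 2 ^ ?t" by (simp add: power_add[symmetric])
    hence "ee ?q (gre (?h * l)) = ee (2 ^ ?t) (gre (w * l))"
      unfolding mult.assoc by (simp only:) (rule ee_gscale, simp)
    thus "f (z + GI 1 1 * of_int (2 ^ (k - ?t)) * w) = f z * ee (2 ^ ?t) (gre (w * (\<alpha> - \<beta> * (?J (ghalf z))\<^sup>2)))"
      using shift[OF h2 hq, of z] by (simp only: mult.assoc l_def)
  qed simp_all
  also have "\<dots> = (\<Sum>z\<in>{z \<in> gbox ?q. even (gre z + gim z) \<and> coprime (gnorm (ghalf z)) ?q \<and> of_int (2 ^ ?t) dvd \<alpha> - \<beta> * (?J (ghalf z))\<^sup>2}. f z)"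
    (is "_ = sum f ?V") by (rule sum.mono_neutral_right) (auto simp: f kloos_def)
  finally have S: "(\<Sum>z\<in>gbox ?q. f z) = sum f ?V" .
  have "cmod (sum f ?V) \<le> (\<Sum>z\<in>?V. 1)"
  proof (rule sum_norm_le)
    fix z show "cmod (f z) \<le> 1" unfolding f using norm_kloos by (cases "even (gre z + gim z)") simp_all
  qed
  also have "\<dots> = real (card ?V)" by (simp only: sum_constant mult_1_right)
  also have "\<dots> \<le> 1024 * 2 ^ k"
  proof (rule dyadic_critical_set[OF \<alpha>8, where c = "GI 1 1" and u = ghalf])
    fix z assume z: "z \<in> ?V"
    show "z = GI 1 1 * ghalf z" using z by (intro ghalf) blast
    show "odd (gnorm (ghalf z))" using z k by (simp add: coprime_right_2_iff_odd)
    have "of_int ?q dvd ghalf z * ?J (ghalf z) - 1" using z by (intro ginv) blast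
    thus "of_int (2 ^ ?t) dvd \<alpha> * (ghalf z)\<^sup>2 - \<beta>"
      by (rule critical_equation) (use z in \<open>auto intro: le_imp_power_dvd\<close>)
  qed auto
  finally show ?thesis unfolding S .
qed


section \<open>Kloosterman sums over finite fields and their quadratic extensions\<close>

text \<open>
  Inside an algebraically closed field of characteristic \<open>p\<close> this is, for a power \<open>q\<close> of \<open>p\<close>, the unique subfield
  with \<open>q\<close> elements. Working with these subsets makes towers of extensions available in one type.
\<close>

definition fix_field :: "nat \<Rightarrow> 'a::field set" where
  "fix_field q = {x. x ^ q = x}"

lemma of_nat_char_power: "n > 0 \<Longrightarrow> of_nat (CHAR('a::field) ^ n) = (0::'a)"
  by (simp add: power_0_left)

text \<open>
  The polynomial \<open>T\<^sup>q - T\<close> has \<open>q\<close> distinct roots, since its derivative is \<open>-1\<close>.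
\<close>

lemma fix_field_card:
  assumes p: "prime CHAR('a::alg_closed_field)" and n: "n > 0"
  shows "card (fix_field (CHAR('a) ^ n) :: 'a set) = CHAR('a) ^ n"
proof -
  define q where "q = CHAR('a) ^ n"
  have q: "q > 1" unfolding q_def using p n by (metis one_less_power prime_gt_1_nat)
  define P where "P = monom (1::'a) q - [:0, 1:]"
  have c: "coeff P q = 1" using q by (cases q) (auto simp: P_def coeff_pCons split: nat.splits)
  have "degree P \<le> q" unfolding P_def using q by (intro degree_diff_le degree_monom_le) auto
  with c have deg: "degree P = q" by (intro antisym le_degree) auto
  have "pderiv P = - 1"
    using of_nat_char_power[OF n, where ?'a = 'a] unfolding q_def[symmetric] by (simp add: P_def pderiv_diff pderiv_monom pderiv_pCons one_pCons)
  obtain A where A: "size A = degree P" "P = smult (lead_coeff P) (\<Prod>x\<in>#A. [:-x, 1:])"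
    using alg_closed_imp_factorization[of P] c by (metis coeff_0 zero_neq_one)
  have lc: "lead_coeff P = 1" using c deg by simp
  hence PA: "P = (\<Prod>x\<in>#A. [:-x, 1:])" using A(2) by simp
  have P0: "P \<noteq> 0" using c by auto
  have cA: "count A x \<le> 1" for x
  proof (rule ccontr)
    assume "\<not> count A x \<le> 1"
    then have "2 \<le> count A x" by simp
    then have "replicate_mset 2 x \<subseteq># A" by (simp add: count_le_replicate_mset_subset_eq)
    then obtain B where "A = replicate_mset 2 x + B" by (metis subset_mset.le_iff_add)
    hence "P = [:-x,1:]^2 * (\<Prod>x\<in>#B. [:-x, 1:])" unfolding PA by simp
    then obtain R where R: "P = [:-x,1:]^2 * R" by blast
    have "poly (pderiv P) x = 0" by (simp only: R power2_eq_square pderiv_mult poly_add poly_mult) simp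
    thus False using \<open>pderiv P = - 1\<close> by simp
  qed
  hence "A = mset_set (set_mset A)"
  proof (intro multiset_eqI)
    fix x show "count A x = count (mset_set (set_mset A)) x"
      using cA[of x] count_greater_zero_iff[of A x] by (cases "x \<in># A") (auto simp: not_in_iff simp del: count_greater_zero_iff)
  qed
  hence "size A = card (set_mset A)" by (metis size_mset_set)
  moreover have "set_mset A = fix_field q"
  proof -
    have "poly P x = 0 \<longleftrightarrow> x \<in># A" for x
      unfolding PA by (auto simp: poly_prod_mset prod_mset_zero_iff)
    moreover have "poly P x = 0 \<longleftrightarrow> x \<in> fix_field q" for x
      by (simp add: P_def poly_monom fix_field_def)
    ultimately show ?thesis by auto
  qed
  ultimately show ?thesis using A(1) deg q_def by simp
qed

lemma char_pow_add:
  assumes "prime CHAR('a::field)"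
  shows "(x + y :: 'a) ^ (CHAR('a) ^ n) = x ^ (CHAR('a) ^ n) + y ^ (CHAR('a) ^ n)"
  using freshmans_dream'[OF assms refl] .

lemma char_pow_sum:
  assumes "prime CHAR('a::field)"
  shows "(sum f A :: 'a) ^ (CHAR('a) ^ n) = (\<Sum>i\<in>A. f i ^ (CHAR('a) ^ n))"
  using freshmans_dream_sum'[OF assms refl] .

lemma char_pow_uminus:
  assumes "prime CHAR('a::field)"
  shows "(- x :: 'a) ^ (CHAR('a) ^ n) = - (x ^ (CHAR('a) ^ n))"
proof -
  have "(- x + x) ^ (CHAR('a) ^ n) = 0"
    using assms prime_gt_0_nat by (simp add: power_0_left) 
  thus ?thesis unfolding char_pow_add[OF assms] by (simp add: eq_neg_iff_add_eq_0)
qed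

lemma char_pow_diff:
  assumes "prime CHAR('a::field)"
  shows "(x - y :: 'a) ^ (CHAR('a) ^ n) = x ^ (CHAR('a) ^ n) - y ^ (CHAR('a) ^ n)"
  using char_pow_add[OF assms, of x "-y"] by (simp add: char_pow_uminus[OF assms])

locale finite_subfield =
  fixes q n :: nat and F :: "'a::alg_closed_field set"
  assumes p: "prime CHAR('a)" and q: "q = CHAR('a) ^ n" and n: "n > 0" and F: "F = fix_field q"
begin

lemma fix_field_gt_1: "q > 1"
  using p n unfolding q by (metis one_less_power prime_gt_1_nat)

lemma fix_field_iff: "x \<in> F \<longleftrightarrow> x ^ q = x"
  by (simp add: F fix_field_def)

lemma fix_field_0 [simp, intro]: "0 \<in> F" using fix_field_gt_1 by (simp add: fix_field_iff)
lemma fix_field_1 [simp, intro]: "1 \<in> F" by (simp add: fix_field_iff)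
lemma fix_field_add [intro]: "x \<in> F \<Longrightarrow> y \<in> F \<Longrightarrow> x + y \<in> F"
  unfolding fix_field_iff q char_pow_add[OF p] by simp
lemma fix_field_uminus [intro]: "x \<in> F \<Longrightarrow> - x \<in> F"
  unfolding fix_field_iff q char_pow_uminus[OF p] by simp
lemma fix_field_diff [intro]: "x \<in> F \<Longrightarrow> y \<in> F \<Longrightarrow> x - y \<in> F"
  unfolding fix_field_iff q char_pow_diff[OF p] by simp
lemma fix_field_mult [intro]: "x \<in> F \<Longrightarrow> y \<in> F \<Longrightarrow> x * y \<in> F"
  by (simp add: fix_field_iff power_mult_distrib)
lemma fix_field_divide [intro]: "x \<in> F \<Longrightarrow> y \<in> F \<Longrightarrow> x / y \<in> F"
  by (simp add: fix_field_iff power_divide)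
lemma fix_field_power [intro]: "x \<in> F \<Longrightarrow> x ^ k \<in> F"
  unfolding fix_field_iff by (metis power_mult mult.commute)
lemma fix_field_sum [intro]: "(\<And>i. i \<in> A \<Longrightarrow> f i \<in> F) \<Longrightarrow> sum f A \<in> F"
  by (induction A rule: infinite_finite_induct) auto
lemma fix_field_of_nat [intro]: "of_nat k \<in> F"
  by (induction k) auto
lemma fix_field_numeral [intro]: "numeral k \<in> F"
  using fix_field_of_nat[of "numeral k"] by simp
lemma finite_F: "finite F"
  using fix_field_card[OF p n] fix_field_gt_1 unfolding F q by (metis card.infinite not_less_zero)
lemma card_F: "card F = q"
  using fix_field_card[OF p n] by (simp add: F q)

end

text \<open>
  Nontrivial additive characters that are invariant under the Frobenius map. Invariance makes them
  trivial on all elements \<open>z\<^sup>p - z\<close>, which is what the point count below relies on.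
\<close>

definition add_char :: "'a::field set \<Rightarrow> ('a \<Rightarrow> complex) \<Rightarrow> bool" where
  "add_char F \<psi> \<longleftrightarrow> (\<forall>x\<in>F. \<forall>y\<in>F. \<psi> (x + y) = \<psi> x * \<psi> y) \<and> (\<forall>x\<in>F. cmod (\<psi> x) = 1) \<and>
     (\<forall>x\<in>F. \<psi> (x ^ CHAR('a)) = \<psi> x) \<and> (\<exists>x\<in>F. \<psi> x \<noteq> 1)"

definition kloosterman :: "'a::field set \<Rightarrow> ('a \<Rightarrow> complex) \<Rightarrow> 'a \<Rightarrow> complex" where
  "kloosterman F \<psi> c = (\<Sum>x\<in>F - {0}. \<psi> (x + c / x))"

lemma add_char_0:
  assumes "add_char F \<psi>" "0 \<in> F"
  shows "\<psi> 0 = 1"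
proof -
  have "\<psi> (0 + 0) = \<psi> 0 * \<psi> 0" "cmod (\<psi> 0) = 1" using assms unfolding add_char_def by blast+
  thus ?thesis by auto
qed

context finite_subfield
begin

lemma add_char_sum:
  assumes \<psi>: "add_char F \<psi>" and a: "a \<in> F"
  shows "(\<Sum>x\<in>F. \<psi> (a * x)) = (if a = 0 then of_nat q else 0)"
proof (cases "a = 0")
  case True thus ?thesis using add_char_0[OF \<psi>] card_F by simp
next
  case False
  obtain u where u: "u \<in> F" "\<psi> u \<noteq> 1" using \<psi> by (auto simp: add_char_def)
  let ?v = "u / a"
  have v: "?v \<in> F" using u a by auto
  have av: "a * ?v = u" using False by simp
  have "(\<Sum>x\<in>F. \<psi> (a * x)) = (\<Sum>x\<in>F. \<psi> (a * (x + ?v)))"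
    by (rule sum.reindex_bij_witness[of _ "\<lambda>x. x + ?v" "\<lambda>x. x - ?v"]) (use v in auto)
  also have "\<dots> = (\<Sum>x\<in>F. \<psi> (a * x) * \<psi> u)"
  proof (rule sum.cong[OF refl])
    fix x assume "x \<in> F"
    then have "a * x \<in> F" using a by auto
    then show "\<psi> (a * (x + ?v)) = \<psi> (a * x) * \<psi> u"
      using \<psi> u(1) False unfolding distrib_left av add_char_def by blast
  qed
  also have "\<dots> = (\<Sum>x\<in>F. \<psi> (a * x)) * \<psi> u" by (simp add: sum_distrib_right)
  finally have "(\<Sum>x\<in>F. \<psi> (a * x)) * (1 - \<psi> u) = 0" by (simp add: algebra_simps)
  thus ?thesis using u(2) False by simp
qed

lemma finite_subfield_square: "finite_subfield (q\<^sup>2) (2 * n) (fix_field (q\<^sup>2) :: 'a set)"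
  by (rule finite_subfield.intro) (use p n in \<open>auto simp: q power_mult[symmetric] mult.commute\<close>)

text \<open>
  The polynomial with root sum \<open>t\<close> and root product \<open>d\<close> splits in the algebraic closure, and the map \<open>x \<mapsto> x\<^sup>q\<close>
  permutes its roots. If it fixes them, they give pairs in the subfield; if it swaps them, they
  are conjugate elements of the quadratic extension. A double root is counted once on each side.
\<close>

lemma card_conjugate_pairs:
  fixes t d :: 'a
  assumes t: "t \<in> F" and d: "d \<in> F" "d \<noteq> 0"
  shows "card {(x, y) \<in> (F - {0}) \<times> (F - {0}). x + y = t \<and> x * y = d}
       + card {x \<in> fix_field (q\<^sup>2) - {0}. x + x ^ q = t \<and> x * x ^ q = d} = 2"
    (is "card ?A + card ?B = 2")
proof -
  have "degree [:d, -t, 1:] > 0" by simp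
  then obtain \<alpha> where "poly [:d, -t, 1:] \<alpha> = 0" using alg_closed_imp_poly_has_root by blast
  hence \<alpha>: "\<alpha> * (t - \<alpha>) = d" by (simp add: algebra_simps)
  define \<beta> where "\<beta> = t - \<alpha>"
  have ab: "\<alpha> + \<beta> = t" "\<alpha> * \<beta> = d" "\<alpha> \<noteq> 0" "\<beta> \<noteq> 0" using \<alpha> d by (auto simp: \<beta>_def)
  have roots: "x = \<alpha> \<and> y = \<beta> \<or> x = \<beta> \<and> y = \<alpha>" if "x + y = t" "x * y = d" for x y
  proof -
    have y: "y = t - x" using that by (simp add: algebra_simps)
    have "(x - \<alpha>) * (x - \<beta>) = x * x - (\<alpha> + \<beta>) * x + \<alpha> * \<beta>" by (simp add: algebra_simps)
    also have "\<dots> = 0" using that unfolding ab y by (simp add: algebra_simps)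
    finally show ?thesis using y ab(1) by (auto simp: \<beta>_def)
  qed
  have qadd: "(x + y) ^ q = x ^ q + y ^ q" for x y :: 'a unfolding q by (rule char_pow_add[OF p])
  have "\<alpha> ^ q + \<beta> ^ q = t" "\<alpha> ^ q * \<beta> ^ q = d"
    using t d(1) qadd[of \<alpha> \<beta>] power_mult_distrib[of \<alpha> \<beta> q] unfolding ab fix_field_iff by simp_all
  from roots[OF this] consider "\<alpha> ^ q = \<alpha>" "\<beta> ^ q = \<beta>" | "\<alpha> ^ q = \<beta>" "\<beta> ^ q = \<alpha>" "\<alpha> \<noteq> \<beta>" by metis
  thus ?thesis
  proof cases
    case 1
    have F2: "\<alpha> \<in> fix_field (q\<^sup>2)" using 1 by (simp add: fix_field_def power2_eq_square power_mult)
    have A: "?A = {(\<alpha>, \<beta>), (\<beta>, \<alpha>)}"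
      using roots ab 1 by (auto simp: fix_field_iff add.commute mult.commute)
    have B: "?B = (if \<alpha> = \<beta> then {\<alpha>} else {})"
    proof -
      have "x = \<alpha> \<and> \<alpha> = \<beta>" if "x + x ^ q = t" "x * x ^ q = d" for x
        using roots[OF that] 1 by auto
      thus ?thesis using 1 F2 ab by auto
    qed
    show ?thesis unfolding A B by auto
  next
    case 2
    have "\<not> (x \<in> F \<and> y \<in> F)" if "x + y = t" "x * y = d" for x y
      using roots[OF that] 2 by (auto simp: fix_field_iff)
    hence A: "?A = {}" by blast
    have F2: "\<alpha> \<in> fix_field (q\<^sup>2)" "\<beta> \<in> fix_field (q\<^sup>2)"
      using 2 by (simp_all add: fix_field_def power2_eq_square power_mult)
    have B: "?B = {\<alpha>, \<beta>}"
      using roots ab 2 F2 by (auto simp: add.commute mult.commute)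
    show ?thesis unfolding A B using 2 by simp
  qed
qed

text \<open>
  The square of the sum runs over pairs \<open>(x, y)\<close> in the subfield, and the sum over the extension over conjugate
  pairs \<open>(x, x\<^sup>q)\<close>; in both cases the summand depends only on the sum \<open>t\<close> and the product \<open>d\<close> of the pair. By the preceding lemma every
  \<open>(t, d)\<close> arises twice in total, and the resulting complete sum over \<open>t\<close> vanishes unless \<open>d = - c\<close>.
\<close>

lemma kloosterman_quadratic:
  assumes \<psi>: "add_char F \<psi>" and c: "c \<in> F" "c \<noteq> 0"
  shows "kloosterman (fix_field (q\<^sup>2)) (\<lambda>x. \<psi> (x + x ^ q)) c = 2 * of_nat q - (kloosterman F \<psi> c)\<^sup>2"
proof -
  let ?F = "F - {0}" and ?F2 = "fix_field (q\<^sup>2) - {0} :: 'a set"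
  let ?T = "F \<times> ?F"
  let ?h = "\<lambda>(t, d). \<psi> (t * (1 + c / d))"
  interpret E: finite_subfield "q\<^sup>2" "2 * n" "fix_field (q\<^sup>2) :: 'a set"
    by (rule finite_subfield_square)
  have fin: "finite F" "finite ?F2" "finite ?T" using finite_F E.finite_F by auto
  have qadd: "(x + y) ^ q = x ^ q + y ^ q" for x y :: 'a unfolding q by (rule char_pow_add[OF p])
  let ?g1 = "\<lambda>(x, y). (x + y, x * y)" and ?g2 = "\<lambda>x. (x + x ^ q, x * x ^ q)"
  have "(kloosterman F \<psi> c)\<^sup>2 = (\<Sum>(x, y)\<in>?F \<times> ?F. \<psi> (x + c / x) * \<psi> (y + c / y))"
    by (simp add: kloosterman_def power2_eq_square sum_product sum.cartesian_product)
  also have "\<dots> = (\<Sum>z\<in>?F \<times> ?F. ?h (?g1 z))"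
  proof (rule sum.cong[OF refl])
    fix z assume "z \<in> ?F \<times> ?F"
    then obtain x y where z: "z = (x, y)" and xy: "x \<in> F" "y \<in> F" "x \<noteq> 0" "y \<noteq> 0" by blast
    have "\<psi> (x + c / x) * \<psi> (y + c / y) = \<psi> ((x + c / x) + (y + c / y))"
    proof -
      have "x + c / x \<in> F" "y + c / y \<in> F" using xy c by auto
      thus ?thesis using \<psi> unfolding add_char_def by simp
    qed
    also have "(x + c / x) + (y + c / y) = (x + y) * (1 + c / (x * y))"
      using xy by (simp add: field_simps)
    finally have "\<psi> (x + c / x) * \<psi> (y + c / y) = ?h (?g1 (x, y))" by simp
    thus "(case z of (x, y) \<Rightarrow> \<psi> (x + c / x) * \<psi> (y + c / y)) = ?h (?g1 z)" by (simp add: z)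
  qed
  also have "\<dots> = (\<Sum>u\<in>?T. \<Sum>z\<in>{z \<in> ?F \<times> ?F. ?g1 z = u}. ?h (?g1 z))"
    by (rule sum.group[symmetric]) (use fin in auto)
  also have "\<dots> = (\<Sum>u\<in>?T. of_nat (card {z \<in> ?F \<times> ?F. ?g1 z = u}) * ?h u)"
    by (rule sum.cong[OF refl]) simp
  finally have K1: "(kloosterman F \<psi> c)\<^sup>2 = \<dots>" .
  have "kloosterman (fix_field (q\<^sup>2)) (\<lambda>x. \<psi> (x + x ^ q)) c = (\<Sum>x\<in>?F2. ?h (?g2 x))"
    unfolding kloosterman_def
  proof (rule sum.cong[OF refl])
    fix x assume x: "x \<in> ?F2"
    have "(x + c / x) + (x + c / x) ^ q = (x + x ^ q) * (1 + c / (x * x ^ q))"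
      using c x unfolding qadd power_divide fix_field_iff by (simp add: field_simps)
    thus "\<psi> ((x + c / x) + (x + c / x) ^ q) = ?h (?g2 x)" by simp
  qed
  also have "\<dots> = (\<Sum>u\<in>?T. \<Sum>z\<in>{z \<in> ?F2. ?g2 z = u}. ?h (?g2 z))"
  proof (rule sum.group[symmetric])
    have "x + x ^ q \<in> F" "x * x ^ q \<in> F" if "x \<in> fix_field (q\<^sup>2)" for x
    proof -
      have "(x ^ q) ^ q = x" using that by (simp add: fix_field_def power2_eq_square power_mult)
      thus "x + x ^ q \<in> F" "x * x ^ q \<in> F"
        by (simp_all add: fix_field_iff qadd power_mult_distrib add.commute mult.commute)
    qed
    thus "?g2 ` ?F2 \<subseteq> ?T" by auto
  qed (use fin in auto)
  also have "\<dots> = (\<Sum>u\<in>?T. of_nat (card {z \<in> ?F2. ?g2 z = u}) * ?h u)"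
    by (rule sum.cong[OF refl]) simp
  finally have K2: "kloosterman (fix_field (q\<^sup>2)) (\<lambda>x. \<psi> (x + x ^ q)) c = \<dots>" .
  have "(kloosterman F \<psi> c)\<^sup>2 + kloosterman (fix_field (q\<^sup>2)) (\<lambda>x. \<psi> (x + x ^ q)) c = (\<Sum>u\<in>?T. 2 * ?h u)"
    unfolding K1 K2 sum.distrib[symmetric]
  proof (rule sum.cong[OF refl])
    fix u assume u: "u \<in> ?T"
    obtain t d where td: "u = (t, d)" by force
    have "card {z \<in> ?F \<times> ?F. ?g1 z = u} + card {z \<in> ?F2. ?g2 z = u} = 2"
    proof -
      have "{z \<in> ?F \<times> ?F. ?g1 z = u} = {(x, y) \<in> ?F \<times> ?F. x + y = t \<and> x * y = d}" by (auto simp: td)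
      thus ?thesis using card_conjugate_pairs[of t d] u td by simp
    qed
    hence "of_nat (card {z \<in> ?F \<times> ?F. ?g1 z = u}) + of_nat (card {z \<in> ?F2. ?g2 z = u}) = (2 :: complex)"
      by (simp only: of_nat_add[symmetric]) simp
    thus "of_nat (card {z \<in> ?F \<times> ?F. ?g1 z = u}) * ?h u + of_nat (card {z \<in> ?F2. ?g2 z = u}) * ?h u = 2 * ?h u"
      by (simp only: distrib_right[symmetric])
  qed
  also have "\<dots> = 2 * (\<Sum>d\<in>?F. \<Sum>t\<in>F. \<psi> ((1 + c / d) * t))"
    unfolding sum_distrib_left[symmetric] sum.cartesian_product[symmetric]
    by (subst sum.swap) (simp add: mult.commute)
  also have "(\<Sum>d\<in>?F. \<Sum>t\<in>F. \<psi> ((1 + c / d) * t)) = (\<Sum>d\<in>?F. if d = - c then of_nat q else 0)"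
  proof (rule sum.cong[OF refl])
    fix d assume d: "d \<in> ?F"
    hence "1 + c / d \<in> F" using c by auto
    moreover have "1 + c / d = 0 \<longleftrightarrow> d = - c" using d by (auto simp: field_simps add_eq_0_iff)
    ultimately show "(\<Sum>t\<in>F. \<psi> ((1 + c / d) * t)) = (if d = - c then of_nat q else 0)"
      using add_char_sum[OF \<psi>] by simp
  qed
  also have "\<dots> = of_nat q" using c fin by (subst sum.delta) auto
  finally show ?thesis by (simp add: algebra_simps)
qed

lemma add_char_trace:
  assumes \<psi>: "add_char F \<psi>" and odd: "(2::'a) \<noteq> 0"
  shows "add_char (fix_field (q\<^sup>2)) (\<lambda>x. \<psi> (x + x ^ q))"
proof -
  have qadd: "(x + y) ^ q = x ^ q + y ^ q" for x y :: 'a unfolding q by (rule char_pow_add[OF p])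
  have tr: "x + x ^ q \<in> F" if "x \<in> fix_field (q\<^sup>2)" for x
    using that by (simp add: fix_field_iff qadd fix_field_def power2_eq_square power_mult)
  have sub: "x \<in> fix_field (q\<^sup>2)" if "x \<in> F" for x
    using that by (simp add: fix_field_iff fix_field_def power2_eq_square power_mult)
  show ?thesis unfolding add_char_def
  proof (intro conjI ballI)
    fix x y :: 'a assume xy: "x \<in> fix_field (q\<^sup>2)" "y \<in> fix_field (q\<^sup>2)"
    show "\<psi> (x + y + (x + y) ^ q) = \<psi> (x + x ^ q) * \<psi> (y + y ^ q)"
    proof -
      have "x + y + (x + y) ^ q = (x + x ^ q) + (y + y ^ q)" by (simp add: qadd)
      thus ?thesis using \<psi> tr[OF xy(1)] tr[OF xy(2)] unfolding add_char_def by metis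
    qed
  next
    fix x :: 'a assume x: "x \<in> fix_field (q\<^sup>2)"
    show "cmod (\<psi> (x + x ^ q)) = 1" using \<psi> tr[OF x] by (simp add: add_char_def)
    have "x ^ CHAR('a) + (x ^ CHAR('a)) ^ q = (x + x ^ q) ^ CHAR('a)"
      using char_pow_add[OF p, of x "x ^ q" 1] by (simp add: power_mult[symmetric] mult.commute)
    thus "\<psi> (x ^ CHAR('a) + (x ^ CHAR('a)) ^ q) = \<psi> (x + x ^ q)" using \<psi> tr[OF x] by (simp add: add_char_def)
  next
    obtain u where u: "u \<in> F" "\<psi> u \<noteq> 1" using \<psi> by (auto simp: add_char_def)
    have "u / 2 \<in> F" using u by auto
    hence "(u / 2) ^ q = u / 2" by (simp only: fix_field_iff)
    hence "u / 2 + (u / 2) ^ q = u" using odd by (simp add: field_simps)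
    with u(2) \<open>u / 2 \<in> F\<close> show "\<exists>x\<in>fix_field (q\<^sup>2). \<psi> (x + x ^ q) \<noteq> 1" using sub by metis
  qed
qed

end


section \<open>The Stepanov-Bombieri argument\<close>

lemma map_poly_hom_mult:
  fixes \<phi> :: "'a::comm_ring_1 \<Rightarrow> 'b::comm_ring_1"
  assumes add: "\<And>x y. \<phi> (x + y) = \<phi> x + \<phi> y" and mult: "\<And>x y. \<phi> (x * y) = \<phi> x * \<phi> y" and zero: "\<phi> 0 = 0"
  shows "map_poly \<phi> (p * r) = map_poly \<phi> p * map_poly \<phi> r"
proof (rule poly_eqI)
  fix n
  have "\<phi> (\<Sum>i\<in>I. g i) = (\<Sum>i\<in>I. \<phi> (g i))" for I and g :: "nat \<Rightarrow> 'a"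
    by (induction I rule: infinite_finite_induct) (auto simp: add zero)
  thus "coeff (map_poly \<phi> (p * r)) n = coeff (map_poly \<phi> p * map_poly \<phi> r) n"
    by (simp add: coeff_map_poly zero coeff_mult mult)
qed

lemma poly_map_poly_hom:
  fixes \<phi> :: "'a::comm_ring_1 \<Rightarrow> 'b::comm_ring_1"
  assumes add: "\<And>x y. \<phi> (x + y) = \<phi> x + \<phi> y" and mult: "\<And>x y. \<phi> (x * y) = \<phi> x * \<phi> y" and zero: "\<phi> 0 = 0"
  shows "poly (map_poly \<phi> p) (\<phi> x) = \<phi> (poly p x)"
  by (induction p) (auto simp: map_poly_pCons zero add mult)

text \<open>
  Substituting \<open>T\<^sup>s\<close> for the outer variable is injective on polynomials of inner degree below \<open>s\<close>, by
  uniqueness of base-\<open>s\<close> digits of exponents.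
\<close>

lemma poly_subst_monom_eq_0:
  fixes P :: "'a::idom poly poly"
  assumes "\<And>j. degree (coeff P j) < s" and "poly P (monom 1 s) = 0"
  shows "P = 0"
  using assms
proof (induction P)
  case (pCons a P)
  have a: "degree a < s" using pCons.prems(1)[of 0] by simp
  have P: "degree (coeff P j) < s" for j using pCons.prems(1)[of "Suc j"] by simp
  have eq: "a + monom 1 s * poly P (monom 1 s) = 0" using pCons.prems(2) by simp
  have "coeff a i = 0" for i
  proof (cases "i < s")
    case True
    have "coeff (a + monom 1 s * poly P (monom 1 s)) i = coeff a i"
      using True by (simp add: coeff_monom_mult)
    thus ?thesis using eq by simp
  qed (use a in \<open>simp add: coeff_eq_0\<close>)
  hence "a = 0" by (simp add: poly_eq_iff)
  moreover from this eq have "poly P (monom 1 s) = 0" by simp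
  hence "P = 0" using pCons.IH P by blast
  ultimately show ?case by simp
qed auto

lemma degree_coeff_mult_le:
  fixes P R :: "'a::comm_ring_1 poly poly"
  assumes "\<And>j. degree (coeff P j) \<le> a" "\<And>j. degree (coeff R j) \<le> b"
  shows "degree (coeff (P * R) j) \<le> a + b"
  unfolding coeff_mult
  by (rule degree_sum_le) (auto intro!: order.trans[OF degree_mult_le] add_mono assms)

lemma power_char_eq_subst:
  fixes f :: "'a::field poly"
  assumes p: "prime CHAR('a)" and s: "s = CHAR('a) ^ k"
  shows "poly (map_poly (\<lambda>c. [:c ^ s:]) f) (monom 1 s) = f ^ s"
proof -
  have s0: "s > 0" using p s prime_gt_0_nat by simp
  show ?thesis
  proof (induction f)
    case 0 thus ?case using s0 by (simp add: power_0_left)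
  next
    case (pCons a f)
    have "pCons a f ^ s = ([:a:] + monom 1 1 * f) ^ s" by (simp add: monom_altdef)
    also have "\<dots> = [:a:] ^ s + (monom 1 1 * f) ^ s"
      unfolding s using p by (intro freshmans_dream'[of _ k]) auto
    also have "\<dots> = [:a ^ s:] + monom 1 s * f ^ s"
      by (simp add: power_mult_distrib monom_power poly_const_pow)
    finally show ?case using pCons s0 by (simp add: map_poly_pCons power_0_left)
  qed
qed

text \<open>
  Let \<open>p(T, Y)\<close> and \<open>r(T, Y)\<close> be the two bivariate polynomials, with \<open>Y\<close> the outer variable. Squaring
  \<open>p(T, T\<^sup>s) = - r(T, T\<^sup>s) f\<^sup>(\<^sup>s\<^sup>-\<^sup>1\<^sup>)\<^sup>/\<^sup>2\<close> and multiplying by \<open>f\<close> gives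
  \<open>f(T) p(T, T\<^sup>s)\<^sup>2 = f(T)\<^sup>s r(T, T\<^sup>s)\<^sup>2\<close>. Here \<open>f(T)\<^sup>s\<close> is a polynomial \<open>g\<close> in \<open>T\<^sup>s\<close>, so the degree bounds allow to
  separate the variables: \<open>f(T) p(T, Y)\<^sup>2 = g(Y) r(T, Y)\<^sup>2\<close>. A simple root of \<open>f\<close> gives a
  simple root of \<open>g\<close>, at which the two sides vanish to even and odd order in \<open>Y\<close>.
\<close>

lemma no_square_relation:
  fixes P R :: "'a::field poly poly" and f :: "'a poly"
  assumes p: "prime CHAR('a)" and s: "s = CHAR('a) ^ k" "odd s"
    and f: "f = [:-\<alpha>, 1:] * h" "poly h \<alpha> \<noteq> 0" and deg: "degree f \<le> 2 * d"
    and P: "\<And>j. degree (coeff P j) \<le> a" "2 * a + 2 * d < s"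
    and R: "\<And>j. degree (coeff R j) \<le> b" "2 * b < s"
    and eq: "poly P (monom 1 s) + poly R (monom 1 s) * f ^ ((s - 1) div 2) = 0"
  shows "P = 0"
proof (rule ccontr)
  assume P0: "P \<noteq> 0"
  define \<phi> where "\<phi> = (\<lambda>c::'a. [:c ^ s:])"
  have s0: "s > 0" using s(2) by (cases s) auto
  have hom: "\<phi> (x + y) = \<phi> x + \<phi> y" "\<phi> (x * y) = \<phi> x * \<phi> y" "\<phi> 0 = 0" for x y
    using s0 by (simp_all add: \<phi>_def s(1) char_pow_add[OF p] power_mult_distrib power_0_left)
  define \<Phi> where "\<Phi> = map_poly \<phi> f"
  have "h \<noteq> 0" using f(2) by auto
  hence f0: "f \<noteq> 0" unfolding f(1) mult_eq_0_iff by simp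
  have "poly P (monom 1 s) = - (poly R (monom 1 s) * f ^ ((s - 1) div 2))"
    using eq by (simp add: eq_neg_iff_add_eq_0)
  hence "f * poly P (monom 1 s) ^ 2 = f * (f ^ ((s - 1) div 2)) ^ 2 * poly R (monom 1 s) ^ 2"
    by (simp add: power_mult_distrib mult_ac)
  also have "f * (f ^ ((s - 1) div 2)) ^ 2 = f ^ s"
  proof -
    have "Suc ((s - 1) div 2 * 2) = s" using s(2) s0 by (auto elim: oddE)
    thus ?thesis by (metis power_Suc power_mult)
  qed
  also have "f ^ s = poly \<Phi> (monom 1 s)"
    unfolding \<Phi>_def \<phi>_def by (rule power_char_eq_subst[OF p s(1), symmetric])
  finally have "poly ([:f:] * (P * P) - \<Phi> * (R * R)) (monom 1 s) = 0"
    by (simp add: power2_eq_square)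
  moreover have "degree (coeff ([:f:] * (P * P) - \<Phi> * (R * R)) j) < s" for j
  proof -
    have 1: "degree (coeff [:f:] j) \<le> 2 * d" for j using deg by (cases j) auto
    have 2: "degree (coeff \<Phi> j) \<le> 0" for j
      by (simp add: \<Phi>_def coeff_map_poly hom) (simp add: \<phi>_def)
    have "degree (coeff ([:f:] * (P * P)) j) \<le> 2 * d + (a + a)"
      by (intro degree_coeff_mult_le P 1)
    moreover have "degree (coeff (\<Phi> * (R * R)) j) \<le> 0 + (b + b)"
      by (intro degree_coeff_mult_le R 2)
    ultimately have "degree (coeff ([:f:] * (P * P)) j - coeff (\<Phi> * (R * R)) j) \<le> max (2 * d + (a + a)) (b + b)"
      by (intro degree_diff_le) auto
    thus ?thesis using P(2) R(2) by simp
  qed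
  ultimately have "[:f:] * (P * P) - \<Phi> * (R * R) = 0" by (rule poly_subst_monom_eq_0[rotated])
  hence rel: "[:f:] * (P * P) = \<Phi> * (R * R)" by simp
  have ne: "[:f:] * (P * P) \<noteq> 0" using P0 f0 by simp
  hence ne': "\<Phi> \<noteq> 0" "R \<noteq> 0" unfolding rel by auto
  let ?y = "\<phi> \<alpha>"
  have "Polynomial.order ?y ([:f:] * (P * P)) = 2 * Polynomial.order ?y P"
    using ne P0 f0 by (simp add: Polynomial.order_mult Polynomial.order_0I del: mult_pCons_left)
  moreover have "Polynomial.order ?y \<Phi> = 1"
  proof -
    have dec: "\<Phi> = [:-?y, 1:] * map_poly \<phi> h"
    proof -
      have neg: "\<phi> (-\<alpha>) = - \<phi> \<alpha>" by (simp add: \<phi>_def s(1) char_pow_uminus[OF p])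
      have one: "\<phi> 1 = 1" by (simp add: \<phi>_def one_pCons)
      show ?thesis unfolding \<Phi>_def f map_poly_hom_mult[of \<phi>, OF hom]
        by (simp add: map_poly_pCons hom neg one)
    qed
    have "poly (map_poly \<phi> h) ?y \<noteq> 0"
      unfolding poly_map_poly_hom[of \<phi>, OF hom] using f(2) by (simp add: \<phi>_def)
    hence "Polynomial.order ?y (map_poly \<phi> h) = 0" by (rule Polynomial.order_0I)
    moreover have "Polynomial.order ?y [:-?y, 1:] = 1" using order_power_n_n[of ?y 1] by simp
    ultimately show ?thesis using ne' unfolding dec by (subst Polynomial.order_mult) auto
  qed
  hence "Polynomial.order ?y (\<Phi> * (R * R)) = 1 + 2 * Polynomial.order ?y R"
    using ne' by (simp add: Polynomial.order_mult)
  ultimately have "2 * Polynomial.order ?y P = 1 + 2 * Polynomial.order ?y R" using rel by simp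
  thus False by presburger
qed

lemma card_digit_set:
  fixes s a :: nat
  assumes "s > 0" "J \<subseteq> {..<s}"
  shows "finite {e. e div s < a \<and> e mod s \<in> J}" "card {e. e div s < a \<and> e mod s \<in> J} = a * card J"
proof -
  have fJ: "finite J" using assms finite_subset by blast
  have "bij_betw (\<lambda>(i, j). i * s + j) ({..<a} \<times> J) {e. e div s < a \<and> e mod s \<in> J}"
    by (rule bij_betw_byWitness[of _ "\<lambda>e. (e div s, e mod s)"]) (use assms in auto)
  from bij_betw_finite[OF this] bij_betw_same_card[OF this] fJ
  show "finite {e. e div s < a \<and> e mod s \<in> J}" "card {e. e div s < a \<and> e mod s \<in> J} = a * card J"
    by (auto simp: card_cartesian_product)
qed

text \<open>
  A linear system with more unknowns than equations: the unknowns are the \<open>l m\<close> coefficients of \<open>A\<close> at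
  exponents with base-\<open>s\<close> digits below \<open>l\<close> and \<open>m\<close>, the equations say that the coefficients of \<open>A g\<close>
  with last digit \<open>\<ge> m\<close> vanish. Over a finite field the pigeonhole principle provides a solution.
\<close>

lemma (in finite_subfield) exists_sparse_multiple:
  fixes g :: "'a poly"
  assumes g: "\<And>e. coeff g e \<in> F" "degree g \<le> d * s" and s: "s > 0"
    and l: "(l + d) * (s - m) < l * m" and m: "m \<le> s"
  obtains A where "A \<noteq> 0" "\<And>e. coeff A e \<in> F" "\<And>e. coeff A e \<noteq> 0 \<Longrightarrow> e div s < l \<and> e mod s < m"
    "\<And>e. coeff (A * g) e \<noteq> 0 \<Longrightarrow> e div s < l + d \<and> e mod s < m"
proof -
  define E where "E = {e. e div s < l \<and> e mod s \<in> {..<m}}"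
  define B where "B = {e. e div s < l + d \<and> e mod s \<in> {m..<s}}"
  have E: "finite E" "card E = l * m" unfolding E_def using card_digit_set[of s "{..<m}" l] s m by auto
  have B: "finite B" "card B = (l + d) * (s - m)" unfolding B_def using card_digit_set[of s "{m..<s}" "l + d"] s m by (simp_all add: ivl_disj_un subset_eq)
  define pol where "pol = (\<lambda>h. \<Sum>e\<in>E. monom (h e :: 'a) e)"
  have cpol: "coeff (pol h) e = (if e \<in> E then h e else 0)" for h e
    unfolding pol_def by (simp add: coeff_sum E sum.delta' if_distrib cong: if_cong)
  have Fmult: "coeff (P * g) e \<in> F" if "\<And>e. coeff P e \<in> F" for P e
    unfolding coeff_mult using that g(1) by auto
  let ?\<Phi> = "\<lambda>h. restrict (coeff (pol h * g)) B"
  have "?\<Phi> ` (E \<rightarrow>\<^sub>E F) \<subseteq> (B \<rightarrow>\<^sub>E F)"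
  proof (intro image_subsetI)
    fix h assume "h \<in> E \<rightarrow>\<^sub>E F"
    hence "coeff (pol h) e \<in> F" for e unfolding cpol by auto
    thus "?\<Phi> h \<in> B \<rightarrow>\<^sub>E F" using Fmult by auto
  qed
  moreover have "card (B \<rightarrow>\<^sub>E F) < card (E \<rightarrow>\<^sub>E F)"
    using E B l fix_field_gt_1 by (simp add: card_funcsetE card_F)
  moreover have "finite (B \<rightarrow>\<^sub>E F)" using B finite_F by (intro finite_PiE) auto
  ultimately have "\<not> inj_on ?\<Phi> (E \<rightarrow>\<^sub>E F)" by (meson card_inj_on_le not_le)
  then obtain h h' where h: "h \<in> E \<rightarrow>\<^sub>E F" "h' \<in> E \<rightarrow>\<^sub>E F" "?\<Phi> h = ?\<Phi> h'" "h \<noteq> h'"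
    by (auto simp: inj_on_def)
  define A where "A = pol h - pol h'"
  have cA: "coeff A e = (if e \<in> E then h e - h' e else 0)" for e
    by (simp add: A_def cpol)
  obtain e where "e \<in> E" "h e \<noteq> h' e" using h by (meson PiE_ext)
  hence "A \<noteq> 0" using cA[of e] by auto
  moreover have AF: "coeff A e \<in> F" for e using h unfolding cA by auto
  moreover have As: "e div s < l \<and> e mod s < m" if "coeff A e \<noteq> 0" for e
    using that unfolding cA E_def by (auto split: if_splits)
  moreover have "e div s < l + d \<and> e mod s < m" if e: "coeff (A * g) e \<noteq> 0" for e
  proof
    have "degree A div s < l" using As[of "degree A"] \<open>A \<noteq> 0\<close> by simp
    hence "degree A < l * s" using s by (simp add: div_less_iff_less_mult)
    moreover have "e \<le> degree A + degree g" using e le_degree degree_mult_le order_trans by blast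
    ultimately have "e < (l + d) * s" using g(2) by (simp add: algebra_simps)
    thus 1: "e div s < l + d" using s by (simp add: div_less_iff_less_mult)
    show "e mod s < m"
    proof (rule ccontr)
      assume "\<not> e mod s < m"
      hence "e \<in> B" using 1 s by (simp add: B_def)
      hence "coeff (pol h * g) e = coeff (pol h' * g) e" using h(3) by (metis restrict_apply')
      thus False using e by (simp add: A_def left_diff_distrib)
    qed
  qed
  ultimately show thesis using that by blast
qed

text \<open>
  An exponent \<open>e = s i + j\<close> with \<open>j < s\<close> becomes \<open>T\<^sup>i Y\<^sup>j\<close> with \<open>Y\<close> the outer variable, and after the substitution \<open>Y = T\<^sup>s\<close>
  it becomes \<open>T\<^sup>i\<^sup>+\<^sup>s\<^sup>j\<close>: the two digits are exchanged. Coefficients are raised to the power \<open>s\<close>.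
\<close>

definition digit_swap :: "nat \<Rightarrow> 'a::field poly \<Rightarrow> 'a poly poly" where
  "digit_swap s A = (\<Sum>e\<le>degree A. monom (monom (coeff A e ^ s) (e div s)) (e mod s))"

lemma digit_swap_coeff_degree:
  assumes "\<And>e. coeff A e \<noteq> 0 \<Longrightarrow> e div s < l" "s > 0"
  shows "degree (coeff (digit_swap s A) j) \<le> l - 1"
  unfolding digit_swap_def coeff_sum
proof (rule degree_sum_le)
  fix e
  show "degree (coeff (monom (monom (coeff A e ^ s) (e div s)) (e mod s)) j) \<le> l - 1"
  proof (cases "coeff A e = 0")
    case True thus ?thesis using assms(2) by (simp add: power_0_left)
  next
    case False
    from assms(1)[OF this] have "e div s \<le> l - 1" by linarith
    thus ?thesis by (auto intro: order_trans[OF degree_monom_le])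
  qed
qed auto

lemma digit_swap_eq_0:
  assumes "digit_swap s A = 0" "s > 0"
  shows "A = 0"
proof (rule ccontr)
  assume "A \<noteq> 0"
  define n where "n = degree A"
  have cn: "coeff A n \<noteq> 0" using \<open>A \<noteq> 0\<close> by (simp add: n_def)
  have "coeff (coeff (digit_swap s A) (n mod s)) (n div s)
      = (\<Sum>e\<le>n. if e = n then coeff A n ^ s else 0)"
    unfolding digit_swap_def coeff_sum n_def[symmetric]
  proof (rule sum.cong[OF refl])
    fix e
    have "e = n" if "e mod s = n mod s" "e div s = n div s" using that by (metis div_mult_mod_eq)
    thus "coeff (coeff (monom (monom (coeff A e ^ s) (e div s)) (e mod s)) (n mod s)) (n div s)
        = (if e = n then coeff A n ^ s else 0)" by auto
  qed
  thus False using assms cn by simp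
qed

lemma digit_swap_subst:
  "poly (digit_swap s A) (monom 1 s) = (\<Sum>e\<le>degree A. monom (coeff A e ^ s) (e div s + s * (e mod s)))"
  by (simp add: digit_swap_def poly_sum poly_monom monom_power mult_monom)

lemma digit_swap_degree:
  assumes "\<And>e. coeff A e \<noteq> 0 \<Longrightarrow> e div s < l \<and> e mod s < m" "s > 0"
  shows "degree (poly (digit_swap s A) (monom 1 s)) \<le> (l - 1) + s * (m - 1)"
  unfolding digit_swap_subst
proof (rule degree_sum_le)
  fix e
  show "degree (monom (coeff A e ^ s) (e div s + s * (e mod s))) \<le> (l - 1) + s * (m - 1)"
  proof (cases "coeff A e = 0")
    case True thus ?thesis using assms(2) by (simp add: power_0_left)
  next
    case False
    from assms(1)[OF this] have "e div s \<le> l - 1" "e mod s \<le> m - 1" by linarith+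
    hence "e div s + s * (e mod s) \<le> (l - 1) + s * (m - 1)" by (intro add_mono mult_mono) auto
    thus ?thesis by (rule order_trans[OF degree_monom_le])
  qed
qed auto

text \<open>
  On the field with \<open>q = s\<^sup>2\<close> elements raising to the power \<open>s\<close> is an involution, and on exponents modulo \<open>s\<^sup>2 - 1\<close> it
  exchanges the two digits. Hence the value of the digit-swapped polynomial is the conjugate of the value of \<open>A\<close>.
\<close>

lemma (in finite_subfield) digit_swap_eval:
  assumes s: "s = CHAR('a) ^ k" "q = s\<^sup>2" and A: "\<And>e. coeff A e \<in> F" and z: "z \<in> F"
  shows "poly (poly (digit_swap s A) (monom 1 s)) z ^ s = poly A z"
proof -
  have ss: "x ^ s ^ 2 = x" if "x \<in> F" for x using that by (simp add: fix_field_iff s)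
  have "poly (poly (digit_swap s A) (monom 1 s)) z ^ s
      = (\<Sum>e\<le>degree A. coeff A e ^ s * z ^ (e div s + s * (e mod s))) ^ s"
    by (simp add: digit_swap_subst poly_sum poly_monom)
  also have "\<dots> = (\<Sum>e\<le>degree A. (coeff A e ^ s * z ^ (e div s + s * (e mod s))) ^ s)"
    unfolding s(1) by (rule char_pow_sum[OF p])
  also have "\<dots> = (\<Sum>e\<le>degree A. coeff A e * z ^ e)"
  proof (rule sum.cong[OF refl])
    fix e
    have "(coeff A e ^ s) ^ s = coeff A e" using ss[OF A[of e]] by (simp add: power2_eq_square power_mult)
    moreover have "(z ^ (e div s + s * (e mod s))) ^ s = z ^ (s * (e div s)) * (z ^ s ^ 2) ^ (e mod s)"
      by (simp add: power_add power_mult_distrib power_mult[symmetric] power2_eq_square mult_ac)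
    moreover have "z ^ (s * (e div s)) * z ^ (e mod s) = z ^ e"
      by (simp add: power_add[symmetric])
    ultimately show "(coeff A e ^ s * z ^ (e div s + s * (e mod s))) ^ s = coeff A e * z ^ e"
      using ss[OF z] by (simp add: power_mult_distrib)
  qed
  finally show ?thesis by (simp add: poly_altdef)
qed

text \<open>
  The Stepanov-Bombieri argument. Let \<open>g = f\<^sup>(\<^sup>s\<^sup>-\<^sup>1\<^sup>)\<^sup>/\<^sup>2\<close>, so that \<open>g(z)\<^sup>s\<^sup>+\<^sup>1 = 1\<close> at the points to be counted.
  Choose sparse \<open>A\<close> and \<open>B\<close> with \<open>A g + B = 0\<close>, let \<open>A*\<close> and \<open>B*\<close> be their digit-swapped versions, and put
  \<open>G = A* + B* g\<close>. At the points in question \<open>G\<^sup>s = A + B g\<^sup>s = A - A g\<^sup>s\<^sup>+\<^sup>1 = 0\<close>, whereas \<open>G\<close> is not the zero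
  polynomial by \<open>no_square_relation\<close>. So its degree, which is about \<open>s\<^sup>2 / 2\<close>, bounds their number.
\<close>

lemma (in finite_subfield) card_square_values_le:
  fixes f :: "'a poly"
  assumes s: "s = CHAR('a) ^ k" "q = s\<^sup>2" "odd s" "2 * d < s"
    and f: "\<And>e. coeff f e \<in> F" "degree f \<le> 2 * d" "f = [:-\<alpha>, 1:] * h" "poly h \<alpha> \<noteq> 0"
  shows "card {z \<in> F. poly f z ^ ((q - 1) div 2) = 1} \<le> s * ((s + 1) div 2 + 2 * d)"
proof -
  obtain w where w: "s = 2 * w + 1" using s(3) by (auto elim: oddE)
  have wd: "d \<le> w" using s(4) w by simp
  define g where "g = f ^ w"
  \<comment> \<open>The degree of \<open>G\<close> is governed by \<open>s m\<close>, so \<open>m\<close> has to be close to \<open>s / 2\<close>. The solvability condition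
    \<open>(l + d) (s - m) < l m\<close> and the condition \<open>2 (l + d - 1) < s\<close> of \<open>no_square_relation\<close> lead to these choices.\<close>
  define l where "l = w + 1 - d"
  define m where "m = w + 1 + d"
  show ?thesis
  proof (cases "m \<le> s")
    case False
    hence "w \<le> d" by (simp add: m_def w)
    have "card {z \<in> F. poly f z ^ ((q - 1) div 2) = 1} \<le> q"
      using card_mono[OF finite_F, of "{z \<in> F. poly f z ^ ((q - 1) div 2) = 1}"] card_F by auto
    also have "\<dots> \<le> s * ((s + 1) div 2 + 2 * d)"
      unfolding s(2) power2_eq_square using \<open>w \<le> d\<close> by (intro mult_left_mono) (auto simp: w)
    finally show ?thesis .
  next
    case True
    have gF: "coeff g e \<in> F" for e
    proof -
      have "\<forall>e. coeff (f ^ j) e \<in> F" for j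
        by (induction j) (auto simp: coeff_mult coeff_1 intro!: fix_field_sum fix_field_mult f(1))
      thus ?thesis by (simp add: g_def)
    qed
    have dg: "degree g \<le> d * (s - 1)"
    proof -
      have "degree g \<le> degree f * w" unfolding g_def by (rule degree_power_le)
      also have "\<dots> \<le> (2 * d) * w" using f(2) by (rule mult_right_mono) simp
      finally show ?thesis by (simp add: w)
    qed
    have "(l + d) * (s - m) < l * m"
    proof -
      define j where "j = w - d"
      have "w = d + j" using wd by (simp add: j_def)
      thus ?thesis unfolding l_def m_def w by (simp add: algebra_simps)
    qed
    moreover have "degree g \<le> d * s" using dg by (rule order_trans) simp
    ultimately obtain A where A: "A \<noteq> 0" "\<And>e. coeff A e \<in> F"
      "\<And>e. coeff A e \<noteq> 0 \<Longrightarrow> e div s < l \<and> e mod s < m"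
      "\<And>e. coeff (A * g) e \<noteq> 0 \<Longrightarrow> e div s < l + d \<and> e mod s < m"
      using exists_sparse_multiple[of g d s l m, OF gF] w True by (metis add_gr_0 zero_less_one)
    define B where "B = - (A * g)"
    have B: "coeff B e \<in> F" for e unfolding B_def coeff_minus coeff_mult
      by (intro fix_field_uminus fix_field_sum fix_field_mult A(2) gF)
    have B': "e div s < l + d \<and> e mod s < m" if "coeff B e \<noteq> 0" for e
      using that A(4) by (simp add: B_def)
    have s0: "s > 0" using w by simp
    let ?TA = "poly (digit_swap s A) (monom 1 s)" and ?TB = "poly (digit_swap s B) (monom 1 s)"
    define G where "G = ?TA + ?TB * g"
    have w': "(s - 1) div 2 = w" using w by simp
    have G0: "G \<noteq> 0"
    proof
      assume "G = 0"
      hence "?TA + ?TB * f ^ ((s - 1) div 2) = 0" by (simp only: G_def g_def w')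
      moreover have "2 * (l - 1) + 2 * d < s" "2 * (l + d - 1) < s" using wd w by (auto simp: l_def)
      ultimately have "digit_swap s A = 0"
        using A(3) B' s0
        by (intro no_square_relation[OF p s(1,3) f(3,4,2), of "digit_swap s A" "l - 1" "digit_swap s B" "l + d - 1"]
              digit_swap_coeff_degree) auto
      hence "A = 0" using s0 by (rule digit_swap_eq_0)
      thus False using A(1) by simp
    qed
    have "degree G \<le> s * ((s + 1) div 2 + 2 * d)"
    proof -
      have 1: "degree ?TA \<le> (l - 1) + s * (m - 1)" using A(3) s0 by (rule digit_swap_degree)
      have "degree ?TB \<le> (l + d - 1) + s * (m - 1)" using B' s0 by (rule digit_swap_degree)
      hence 2: "degree (?TB * g) \<le> (l + d - 1) + s * (m - 1) + d * (s - 1)"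
        using degree_mult_le[of ?TB g] dg by linarith
      have "(l - 1) + s * (m - 1) \<le> s * ((s + 1) div 2 + 2 * d)"
        "(l + d - 1) + s * (m - 1) + d * (s - 1) \<le> s * ((s + 1) div 2 + 2 * d)"
        using wd by (auto simp: l_def m_def w algebra_simps)
      thus ?thesis unfolding G_def using 1 2 by (intro degree_add_le) auto
    qed
    moreover have "{z \<in> F. poly f z ^ ((q - 1) div 2) = 1} \<subseteq> {z. poly G z = 0}"
    proof clarify
      fix z assume z: "z \<in> F" "poly f z ^ ((q - 1) div 2) = 1"
      have "(q - 1) div 2 = w * (s + 1)" by (simp add: s(2) w power2_eq_square algebra_simps)
      hence gs: "poly g z ^ (s + 1) = 1" using z(2) by (simp only: g_def poly_power power_mult)
      have "poly G z ^ s = poly ?TA z ^ s + (poly ?TB z * poly g z) ^ s"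
        unfolding G_def s(1) poly_add poly_mult by (rule char_pow_add[OF p])
      also have "\<dots> = poly A z + poly B z * poly g z ^ s"
        by (simp only: power_mult_distrib digit_swap_eval[OF s(1,2) A(2) z(1)] digit_swap_eval[OF s(1,2) B z(1)])
      also have "poly B z * poly g z ^ s = - (poly A z * poly g z ^ (s + 1))"
        by (simp add: B_def algebra_simps)
      finally have "poly G z ^ s = 0" unfolding gs by simp
      thus "poly G z = 0" by simp
    qed
    ultimately show ?thesis
      using card_mono[OF poly_roots_finite[OF G0]] card_poly_roots_bound[OF G0] by (meson order_trans)
  qed
qed


section \<open>The Weil bound for Kloosterman sums\<close>

context finite_subfield
begin

lemma two_neq_0:
  assumes "odd CHAR('a)"
  shows "(2::'a) \<noteq> 0"
proof
  assume "(2::'a) = 0"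
  hence "of_nat 2 = (0::'a)" by simp
  hence "CHAR('a) dvd 2" unfolding of_nat_eq_0_iff_char_dvd .
  hence "CHAR('a) \<le> 2" by (rule dvd_imp_le) simp
  hence "CHAR('a) = 2" using prime_ge_2_nat[OF p] by simp
  thus False using assms by simp
qed

text \<open>
  For fixed \<open>z\<close> and \<open>v = t + z\<^sup>p - z\<close> the equation \<open>x + c / x = v\<close> is quadratic with discriminant
  \<open>f(z) = v\<^sup>2 - 4 c\<close>. So each \<open>z\<close> with \<open>f(z)\<close> a nonzero square contributes two points, each root of \<open>f\<close> one, and the
  other \<open>z\<close> none. The roots of \<open>f\<close> are simple, because \<open>f = (U - e) (U + e)\<close> with \<open>U = t + T\<^sup>p - T\<close>, \<open>e\<^sup>2 = 4 c\<close> and \<open>U' = -1\<close>.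
\<close>

lemma card_curve_points_le:
  assumes s: "s = CHAR('a) ^ k" "q = s\<^sup>2" "2 * CHAR('a) < s" and odd: "odd CHAR('a)"
    and t: "t \<in> F" and c: "c \<in> F" "c \<noteq> 0"
  shows "card {(x, z) \<in> (F - {0}) \<times> F. x + c / x = t + z ^ CHAR('a) - z} \<le> s\<^sup>2 + 7 * CHAR('a) * s"
proof -
  define d where "d = CHAR('a)"
  have d: "d > 2" using odd prime_ge_2_nat[OF p] unfolding d_def by (cases "CHAR('a) = 2") auto
  have two: "(2::'a) \<noteq> 0" using odd by (rule two_neq_0)
  have odds: "odd s" using odd s(1) by simp
  define U where "U = [:t, -1:] + monom (1::'a) d"
  define f where "f = U\<^sup>2 - [:4 * c:]"
  have Uz: "poly U z = t + z ^ d - z" for z by (simp add: U_def poly_monom)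
  have coU: "coeff U e \<in> F" for e
    unfolding U_def coeff_add using t by (auto simp: coeff_pCons split: nat.splits)
  have cof: "coeff f e \<in> F" for e
    unfolding f_def power2_eq_square coeff_diff coeff_mult
    by (intro fix_field_diff fix_field_sum fix_field_mult coU) (use c in \<open>auto simp: coeff_pCons split: nat.splits\<close>)
  have degU: "degree U \<le> d" unfolding U_def using d by (intro degree_add_le degree_monom_le) auto
  have degf: "degree f \<le> 2 * d"
    unfolding f_def power2_eq_square using degU degree_mult_le[of U U] by (intro degree_diff_le) auto
  obtain e where e: "e ^ 2 = 4 * c" using nth_root_exists[of 2 "4 * c"] by auto
  have four: "(4::'a) \<noteq> 0" using two by (metis mult_2_right mult_eq_0_iff numeral_Bit0 numeral_times_numeral one_add_one mult_numeral_1_right)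
  have e0: "e \<noteq> 0" using e c four by auto
  have "coeff (U - [:e:]) d = 1" using d by (simp add: U_def coeff_pCons split: nat.splits)
  hence "degree (U - [:e:]) > 0" using d le_degree[of "U - [:e:]" d] by simp
  then obtain \<alpha> where \<alpha>: "poly (U - [:e:]) \<alpha> = 0" using alg_closed_imp_poly_has_root by blast
  then obtain h1 where h1: "U - [:e:] = [:-\<alpha>, 1:] * h1" unfolding poly_eq_0_iff_dvd by (elim dvdE)
  have "pderiv (U - [:e:]) = -1"
    by (simp add: U_def pderiv_add pderiv_diff pderiv_monom pderiv_pCons d_def one_pCons)
  moreover have "poly (pderiv ([:-\<alpha>, 1:] * h1)) \<alpha> = poly h1 \<alpha>"
    by (simp only: pderiv_mult poly_add poly_mult) (simp add: pderiv_pCons)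
  ultimately have h1a: "poly h1 \<alpha> \<noteq> 0" unfolding h1[symmetric] by auto
  have fdec: "f = [:-\<alpha>, 1:] * (h1 * (U + [:e:]))"
  proof -
    have "[:4 * c:] = [:e:] ^ 2" using e by (simp add: power2_eq_square)
    hence "f = (U - [:e:]) * (U + [:e:])" unfolding f_def by (simp only:) (simp add: algebra_simps power2_eq_square del: mult_pCons_left mult_pCons_right)
    thus ?thesis unfolding h1 by (simp only: mult.assoc)
  qed
  have "poly (h1 * (U + [:e:])) \<alpha> = poly h1 \<alpha> * (2 * e)"
    using \<alpha> by simp
  hence ha: "poly (h1 * (U + [:e:])) \<alpha> \<noteq> 0" using h1a two e0 by simp
  have f0: "f \<noteq> 0"
  proof
    assume "f = 0"
    hence "h1 * (U + [:e:]) = 0" using fdec by (metis mult_eq_0_iff pCons_eq_0_iff zero_neq_one)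
    hence "poly (h1 * (U + [:e:])) \<alpha> = 0" by (simp only: poly_0)
    with ha show False by contradiction
  qed
  define N where "N = {z \<in> F. poly f z ^ ((q - 1) div 2) = 1}"
  have N: "card N \<le> s * ((s + 1) div 2 + 2 * d)"
    unfolding N_def using s odds cof degf fdec ha by (intro card_square_values_le[of s k d f \<alpha>]) (auto simp: d_def)
  define Z where "Z = {z. poly f z = 0}"
  have Z: "finite Z" "card Z \<le> 2 * d"
    unfolding Z_def using poly_roots_finite[OF f0] card_poly_roots_bound[OF f0] degf by auto
  define V where "V = (\<lambda>z. {x \<in> F - {0}. x + c / x = t + z ^ d - z})"
  have finX: "finite (V z)" for z unfolding V_def using finite_F by auto
  have card2: "card (V z) \<le> 2" for z
  proof -
    let ?p = "[:c, -(t + z ^ d - z), 1:]"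
    have "V z \<subseteq> {x. poly ?p x = 0}"
    proof
      fix x assume x: "x \<in> V z"
      hence *: "x + c / x = t + z ^ d - z" "x \<noteq> 0" by (auto simp: V_def)
      have "poly ?p x = c + x * x - (t + z ^ d - z) * x" by (simp add: algebra_simps)
      also have "\<dots> = 0" unfolding *(1)[symmetric] using *(2) by (simp add: algebra_simps)
      finally show "x \<in> {x. poly ?p x = 0}" by simp
    qed
    hence "card (V z) \<le> card {x. poly ?p x = 0}" by (intro card_mono poly_roots_finite) auto
    also have "\<dots> \<le> degree ?p" by (rule card_poly_roots_bound) simp
    finally show ?thesis by simp
  qed
  have disc: "(2 * x - (t + z ^ d - z))\<^sup>2 = poly f z" "2 * x - (t + z ^ d - z) \<in> F" if x: "x \<in> V z" "z \<in> F" for x z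
  proof -
    have w: "t + z ^ d - z = x + c / x" "x \<noteq> 0" "x \<in> F" using x by (auto simp: V_def)
    have "poly f z = (t + z ^ d - z)\<^sup>2 - 4 * c" by (simp add: f_def Uz)
    thus "(2 * x - (t + z ^ d - z))\<^sup>2 = poly f z" unfolding w(1) using w(2)
      by (simp add: power2_eq_square field_simps)
    show "2 * x - (t + z ^ d - z) \<in> F" unfolding w(1) using w c by auto
  qed
  have cX: "card (V z) \<le> of_bool (z \<in> Z) + 2 * of_bool (z \<in> N)" if z: "z \<in> F" for z
  proof (cases "z \<in> Z")
    case True
    have "x = (t + z ^ d - z) / 2" if "x \<in> V z" for x
    proof -
      have "2 * x - (t + z ^ d - z) = 0" using disc(1)[OF that z] True by (simp add: Z_def)
      hence "2 * x = t + z ^ d - z" by simp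
      thus ?thesis using two by (metis nonzero_mult_div_cancel_left)
    qed
    hence "V z \<subseteq> {(t + z ^ d - z) / 2}" by blast
    hence "card (V z) \<le> card {(t + z ^ d - z) / 2}" by (intro card_mono) auto
    thus ?thesis using True by simp
  next
    case False
    have "z \<in> N" if x: "x \<in> V z" for x
    proof -
      define y where "y = 2 * x - (t + z ^ d - z)"
      have y: "y\<^sup>2 = poly f z" "y ^ q = y" using disc[OF x z] by (simp_all add: y_def fix_field_iff)
      have "y \<noteq> 0" using y(1) False by (auto simp: Z_def)
      moreover have "y ^ q = y ^ (q - 1) * y" using fix_field_gt_1 by (cases q) simp_all
      ultimately have "y ^ (q - 1) = 1" using y(2) by simp
      moreover have "q - 1 = 2 * ((q - 1) div 2)" using odds s(2) by (auto elim!: oddE simp: power2_eq_square)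
      ultimately have "poly f z ^ ((q - 1) div 2) = 1" unfolding y(1)[symmetric] by (metis power_mult)
      thus ?thesis using z by (simp add: N_def)
    qed
    thus ?thesis using card2[of z] False by (cases "V z = {}") auto
  qed
  have "{(x, z) \<in> (F - {0}) \<times> F. x + c / x = t + z ^ CHAR('a) - z} = prod.swap ` Sigma F V"
    by (auto simp: V_def d_def image_iff)
  hence "card {(x, z) \<in> (F - {0}) \<times> F. x + c / x = t + z ^ CHAR('a) - z} = card (Sigma F V)"
    by (simp add: card_image)
  also have "\<dots> = (\<Sum>z\<in>F. card (V z))" using finite_F finX by (simp add: card_SigmaI)
  also have "\<dots> \<le> (\<Sum>z\<in>F. of_bool (z \<in> Z) + 2 * of_bool (z \<in> N))" by (rule sum_mono) (rule cX)
  also have "\<dots> = card (F \<inter> Z) + 2 * card (F \<inter> N)"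
    using finite_F by (simp add: sum.distrib sum_distrib_left[symmetric] sum_of_bool_eq Int_def)
  also have "\<dots> \<le> 2 * d + 2 * (s * ((s + 1) div 2 + 2 * d))"
  proof -
    have "card (F \<inter> Z) \<le> card Z" "card (F \<inter> N) \<le> card N"
      using Z finite_F by (auto intro!: card_mono simp: N_def)
    thus ?thesis using Z N by linarith
  qed
  also have "\<dots> \<le> s\<^sup>2 + 7 * d * s"
  proof -
    obtain w where w: "s = 2 * w + 1" using odds by (auto elim: oddE)
    have "2 * (s * ((s + 1) div 2 + 2 * d)) = s * s + s + 4 * d * s" by (simp add: w algebra_simps)
    moreover have "1 * s \<le> d * s" "2 * d * 1 \<le> 2 * d * s" using d w by (intro mult_le_mono; simp)+
    ultimately show ?thesis unfolding power2_eq_square mult.assoc[symmetric] by linarith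
  qed
  finally show ?thesis by (simp add: d_def)
qed

text \<open>
  Since \<open>\<psi>(z\<^sup>p - z) = 1\<close>, averaging over \<open>z\<close> gives \<open>q K = \<Sum>\<^sub>t \<psi>(t) M(t)\<close> where \<open>M(t)\<close> is the number of points counted in the
  preceding lemma. An upper bound \<open>M(t) \<le> L\<close> alone suffices: as \<open>\<Sum>\<^sub>t \<psi>(t) = 0\<close>, one may replace \<open>M(t)\<close> by
  \<open>M(t) - L\<close>, which has constant sign, and \<open>\<Sum>\<^sub>t M(t) = q (q - 1)\<close> is known exactly.
\<close>

lemma kloosterman_bound_square:
  assumes s: "s = CHAR('a) ^ k" "q = s\<^sup>2" "2 * CHAR('a) < s" and odd: "odd CHAR('a)"
    and \<psi>: "add_char F \<psi>" and c: "c \<in> F" "c \<noteq> 0"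
  shows "cmod (kloosterman F \<psi> c) \<le> 7 * CHAR('a) * s + 1"
proof -
  define d where "d = CHAR('a)"
  let ?F = "F - {0}"
  let ?g = "\<lambda>(x, z). x + c / x - (z ^ d - z)"
  define M where "M = (\<lambda>t. card {u \<in> ?F \<times> F. ?g u = t})"
  define L where "L = s\<^sup>2 + 7 * d * s"
  have fin: "finite (?F \<times> F)" using finite_F by auto
  have img: "?g ` (?F \<times> F) \<subseteq> F" using c by auto
  have M_le: "M t \<le> L" if "t \<in> F" for t
  proof -
    have "{u \<in> ?F \<times> F. ?g u = t} = {(x, z) \<in> (F - {0}) \<times> F. x + c / x = t + z ^ CHAR('a) - z}"
      by (auto simp: d_def algebra_simps)
    thus ?thesis unfolding M_def L_def d_def using card_curve_points_le[OF s odd that c] by simp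
  qed
  have mult: "\<psi> (x + y) = \<psi> x * \<psi> y" "cmod (\<psi> x) = 1" "\<psi> (x ^ d) = \<psi> x" if "x \<in> F" "y \<in> F" for x y
    using \<psi> that by (simp_all add: add_char_def d_def)
  have shift: "\<psi> (?g (x, z)) = \<psi> (x + c / x)" if xz: "x \<in> ?F" "z \<in> F" for x z
  proof -
    have mem: "x + c / x \<in> F" "z ^ d - z \<in> F" "?g (x, z) \<in> F" using xz c by auto
    have "\<psi> (z ^ d) = \<psi> (z ^ d - z) * \<psi> z" using mult(1)[OF mem(2) xz(2)] by simp
    moreover have "\<psi> z \<noteq> 0" using mult(2)[OF xz(2) xz(2)] by auto
    ultimately have "\<psi> (z ^ d - z) = 1" using mult(3)[OF xz(2) xz(2)] by simp
    moreover have "\<psi> (x + c / x) = \<psi> (?g (x, z)) * \<psi> (z ^ d - z)"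
      using mult(1)[OF mem(3,2)] by simp
    ultimately show ?thesis by simp
  qed
  have "of_nat q * kloosterman F \<psi> c = (\<Sum>(x, z)\<in>?F \<times> F. \<psi> (x + c / x))"
    by (simp add: kloosterman_def sum.cartesian_product[symmetric] card_F sum_distrib_left)
  also have "\<dots> = (\<Sum>u\<in>?F \<times> F. \<psi> (?g u))"
  proof (rule sum.cong[OF refl])
    fix u assume "u \<in> ?F \<times> F"
    thus "(case u of (x, z) \<Rightarrow> \<psi> (x + c / x)) = \<psi> (?g u)" using shift by (cases u) simp
  qed
  also have "\<dots> = (\<Sum>t\<in>F. \<Sum>u\<in>{u \<in> ?F \<times> F. ?g u = t}. \<psi> (?g u))"
    by (rule sum.group[symmetric, OF fin finite_F img])
  also have "\<dots> = (\<Sum>t\<in>F. of_nat (M t) * \<psi> t)"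
    unfolding M_def by (rule sum.cong[OF refl]) simp
  also have "\<dots> = (\<Sum>t\<in>F. of_nat (M t) * \<psi> t) - of_nat L * (\<Sum>t\<in>F. \<psi> (1 * t))"
    using add_char_sum[OF \<psi> fix_field_1] by simp
  also have "\<dots> = - (\<Sum>t\<in>F. (of_nat L - of_nat (M t)) * \<psi> t)"
    by (simp add: sum_distrib_left sum_subtractf left_diff_distrib)
  finally have "of_nat q * kloosterman F \<psi> c = \<dots>" .
  hence "real q * cmod (kloosterman F \<psi> c) = cmod (\<Sum>t\<in>F. (of_nat L - of_nat (M t)) * \<psi> t)"
    by (metis norm_minus_cancel norm_mult norm_of_nat)
  also have "\<dots> \<le> (\<Sum>t\<in>F. real L - real (M t))"
  proof (rule sum_norm_le)
    fix t assume t: "t \<in> F"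
    have "cmod (of_nat L - of_nat (M t)) = cmod (of_real (real L - real (M t)))" by simp
    also have "\<dots> = real L - real (M t)" unfolding norm_of_real using M_le[OF t] by simp
    finally have "cmod (of_nat L - of_nat (M t)) = real L - real (M t)" .
    thus "cmod ((of_nat L - of_nat (M t)) * \<psi> t) \<le> real L - real (M t)"
      using mult(2)[OF t t] by (simp add: norm_mult)
  qed
  also have "\<dots> = real q * real L - real (\<Sum>t\<in>F. M t)"
    by (simp add: sum_subtractf card_F)
  also have "(\<Sum>t\<in>F. M t) = card (?F \<times> F)"
    using sum.group[OF fin finite_F img, of "\<lambda>_. 1::nat"] by (simp add: M_def)
  also have "\<dots> = (q - 1) * q" by (simp add: card_cartesian_product card_F finite_F)
  also have "real q * real L - real ((q - 1) * q) = real q * (7 * d * s + 1)"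
  proof -
    have "real ((q - 1) * q) = (real q - 1) * real q" using fix_field_gt_1 by (simp add: of_nat_diff)
    moreover have "real L = real q + 7 * d * s" by (simp add: L_def s(2))
    ultimately show ?thesis by (simp add: algebra_simps)
  qed
  finally show ?thesis using fix_field_gt_1 by (simp add: d_def)
qed

text \<open>
  If \<open>\<bar>K\<bar> = (2 + \<delta>) \<surd>q\<close>, then \<open>\<bar>2 q - K\<^sup>2\<bar> \<ge> ((2 + \<delta>)\<^sup>2 - 2) q \<ge> (2 + 4 \<delta>) q\<close>: each quadratic extension at least
  quadruples the relative excess over the Weil bound.
\<close>

lemma kloosterman_tower:
  assumes \<psi>: "add_char F \<psi>" and c: "c \<in> F" "c \<noteq> 0" and two: "(2::'a) \<noteq> 0"
    and big: "cmod (kloosterman F \<psi> c) \<ge> (2 + \<epsilon>) * sqrt q" "\<epsilon> \<ge> 0"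
  shows "\<exists>\<psi>'. add_char (fix_field (q ^ 2 ^ i)) \<psi>' \<and> c \<in> fix_field (q ^ 2 ^ i) \<and>
     cmod (kloosterman (fix_field (q ^ 2 ^ i)) \<psi>' c) \<ge> (2 + 4 ^ i * \<epsilon>) * sqrt (q ^ 2 ^ i)"
proof (induction i)
  case 0
  show ?case using assms F by auto
next
  case (Suc i)
  then obtain \<psi>' where \<psi>': "add_char (fix_field (q ^ 2 ^ i)) \<psi>'" "c \<in> fix_field (q ^ 2 ^ i)"
    "cmod (kloosterman (fix_field (q ^ 2 ^ i)) \<psi>' c) \<ge> (2 + 4 ^ i * \<epsilon>) * sqrt (q ^ 2 ^ i)" by blast
  define Q where "Q = q ^ 2 ^ i"
  interpret E: finite_subfield Q "n * 2 ^ i" "fix_field Q :: 'a set"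
    by (rule finite_subfield.intro) (use p n in \<open>auto simp: Q_def q power_mult\<close>)
  have Q2: "q ^ 2 ^ Suc i = Q\<^sup>2" by (simp add: Q_def power_mult[symmetric] mult.commute)
  let ?K = "kloosterman (fix_field Q) \<psi>' c" and ?\<psi> = "\<lambda>x. \<psi>' (x + x ^ Q)"
  have 1: "add_char (fix_field (Q\<^sup>2)) ?\<psi>"
    by (rule E.add_char_trace[OF _ two]) (use \<psi>' in \<open>simp add: Q_def\<close>)
  have 2: "c \<in> fix_field (Q\<^sup>2)"
    using \<psi>'(2) by (simp add: Q_def[symmetric] fix_field_def power2_eq_square power_mult)
  have eq: "kloosterman (fix_field (Q\<^sup>2)) ?\<psi> c = 2 * of_nat Q - ?K\<^sup>2"
    using E.kloosterman_quadratic[of \<psi>' c] \<psi>' c by (simp add: Q_def)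
  have "((2 + 4 ^ i * \<epsilon>) * sqrt Q)\<^sup>2 \<le> (cmod ?K)\<^sup>2"
    using \<psi>'(3) big(2) by (intro power_mono) (auto simp: Q_def)
  hence "(2 + 4 ^ i * \<epsilon>)\<^sup>2 * Q \<le> cmod (?K\<^sup>2)" by (simp add: power_mult_distrib norm_power)
  moreover have "cmod (?K\<^sup>2) - 2 * Q \<le> cmod (2 * of_nat Q - ?K\<^sup>2)"
    using norm_triangle_ineq2[of "?K\<^sup>2" "2 * of_nat Q"] by (simp add: norm_minus_commute norm_mult)
  moreover have "(2 + 4 ^ Suc i * \<epsilon>) * Q \<le> (2 + 4 ^ i * \<epsilon>)\<^sup>2 * Q - 2 * Q"
  proof -
    have "(2 + 4 ^ i * \<epsilon>)\<^sup>2 - 2 = (2 + 4 ^ Suc i * \<epsilon>) + (4 ^ i * \<epsilon>)\<^sup>2"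
      by (simp add: power2_eq_square algebra_simps)
    hence "(2 + 4 ^ Suc i * \<epsilon>) \<le> (2 + 4 ^ i * \<epsilon>)\<^sup>2 - 2" by simp
    hence "(2 + 4 ^ Suc i * \<epsilon>) * Q \<le> ((2 + 4 ^ i * \<epsilon>)\<^sup>2 - 2) * Q" by (rule mult_right_mono) simp
    thus ?thesis by (simp add: left_diff_distrib)
  qed
  ultimately have "(2 + 4 ^ Suc i * \<epsilon>) * sqrt (Q\<^sup>2) \<le> cmod (kloosterman (fix_field (Q\<^sup>2)) ?\<psi> c)"
    unfolding eq by simp
  thus ?case unfolding Q2 using 1 2 by blast
qed

theorem weil_kloosterman:
  assumes \<psi>: "add_char F \<psi>" and c: "c \<in> F" "c \<noteq> 0" and odd: "odd CHAR('a)"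
  shows "cmod (kloosterman F \<psi> c) \<le> 2 * sqrt q"
proof (rule ccontr)
  assume not_le: "\<not> cmod (kloosterman F \<psi> c) \<le> 2 * sqrt q"
  define \<epsilon> where "\<epsilon> = cmod (kloosterman F \<psi> c) / sqrt q - 2"
  have q0: "sqrt q > 0" using fix_field_gt_1 by simp
  have \<epsilon>: "\<epsilon> > 0" "(2 + \<epsilon>) * sqrt q = cmod (kloosterman F \<psi> c)"
    using not_le q0 by (simp_all add: \<epsilon>_def field_simps)
  have d: "CHAR('a) > 2" using odd prime_ge_2_nat[OF p] by (cases "CHAR('a) = 2") auto
  have two: "(2::'a) \<noteq> 0" using odd by (rule two_neq_0)
  obtain j where j: "(7 * CHAR('a) + 1) / \<epsilon> < 4 ^ j"
    using real_arch_pow[of 4 "(7 * CHAR('a) + 1) / \<epsilon>"] by auto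
  \<comment> \<open>The two additional steps in the tower ensure \<open>s \<ge> p\<^sup>2 > 2 p\<close>.\<close>
  define i where "i = Suc (Suc j)"
  have "(4::real) ^ j \<le> 4 ^ i" by (intro power_increasing) (auto simp: i_def)
  hence "4 ^ j * \<epsilon> \<le> 4 ^ i * \<epsilon>" using \<epsilon>(1) by (intro mult_right_mono) auto
  moreover have "7 * CHAR('a) + 1 < 4 ^ j * \<epsilon>" using j \<epsilon>(1) by (simp add: pos_divide_less_eq)
  ultimately have i: "7 * CHAR('a) + 1 < 4 ^ i * \<epsilon>" by linarith
  define s where "s = q ^ 2 ^ Suc j"
  have qs: "q ^ 2 ^ i = s\<^sup>2" by (simp add: s_def i_def power_mult[symmetric] mult.commute)
  have s: "s = CHAR('a) ^ (n * 2 ^ Suc j)" by (simp add: s_def q power_mult)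
  have "CHAR('a) ^ 2 \<le> s" unfolding s
  proof (rule power_increasing)
    have "(1::nat) \<le> 2 ^ j" by simp
    hence "1 * 2 \<le> n * (2 * 2 ^ j)" using n by (intro mult_le_mono) auto
    thus "2 \<le> n * 2 ^ Suc j" by simp
  qed (use d in auto)
  moreover have "2 * CHAR('a) < CHAR('a) ^ 2" using d by (simp add: power2_eq_square)
  ultimately have s2: "2 * CHAR('a) < s" by linarith
  interpret E: finite_subfield "s\<^sup>2" "n * 2 ^ i" "fix_field (s\<^sup>2) :: 'a set"
    by (rule finite_subfield.intro) (use p n in \<open>auto simp: qs[symmetric] q power_mult\<close>)
  obtain \<psi>' where \<psi>': "add_char (fix_field (s\<^sup>2)) \<psi>'" "c \<in> fix_field (s\<^sup>2)"
     "cmod (kloosterman (fix_field (s\<^sup>2)) \<psi>' c) \<ge> (2 + 4 ^ i * \<epsilon>) * sqrt (s\<^sup>2)"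
    using kloosterman_tower[OF \<psi> c two, of \<epsilon> i] \<epsilon> unfolding qs by auto
  have "(2 + 4 ^ i * \<epsilon>) * real s \<le> 7 * CHAR('a) * s + 1"
    using \<psi>'(3) E.kloosterman_bound_square[OF s refl s2 odd \<psi>'(1,2) c(2)] by simp
  also have "\<dots> \<le> (7 * CHAR('a) + 1) * real s" using s2 by (simp add: algebra_simps)
  finally have "2 + 4 ^ i * \<epsilon> \<le> 7 * CHAR('a) + 1" using s2 by simp
  thus False using i by simp
qed

end


section \<open>The residue field of an inert prime\<close>

definition weil_holds :: "nat \<Rightarrow> bool" where
  "weil_holds p \<longleftrightarrow> (\<forall>a b. \<not> int p dvd gnorm a \<longrightarrow> \<not> int p dvd gnorm b \<longrightarrow>
     cmod (\<Sum>z\<in>gbox (int p). kloos (int p) a b z) \<le> 2 * real p)"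

text \<open>
  A type cannot depend on the variable \<open>p\<close>, but it may depend on a constant. The constant chosen here is a counterexample
  to the bound if there is any, so proving the bound for this prime proves it for all.
\<close>

definition test_prime :: nat where
  "test_prime = (SOME p. prime p \<and> p mod 4 = 3 \<and>
     (weil_holds p \<longrightarrow> (\<forall>p'. prime p' \<longrightarrow> p' mod 4 = 3 \<longrightarrow> weil_holds p')))"

lemma test_prime:
  "prime test_prime" "test_prime mod 4 = 3"
  "weil_holds test_prime \<Longrightarrow> prime p \<Longrightarrow> p mod 4 = 3 \<Longrightarrow> weil_holds p"
proof -
  have "\<exists>p. prime p \<and> p mod 4 = 3 \<and>
     (weil_holds p \<longrightarrow> (\<forall>p'. prime p' \<longrightarrow> p' mod 4 = 3 \<longrightarrow> weil_holds p'))"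
  proof (cases "\<exists>p. prime p \<and> p mod 4 = 3 \<and> \<not> weil_holds p")
    case False
    hence "prime (3::nat) \<and> (3::nat) mod 4 = 3 \<and> (weil_holds 3 \<longrightarrow> (\<forall>p'. prime p' \<longrightarrow> p' mod 4 = 3 \<longrightarrow> weil_holds p'))"
      by auto
    thus ?thesis by blast
  qed blast
  from someI_ex[OF this, folded test_prime_def]
  show "prime test_prime" "test_prime mod 4 = 3"
    "weil_holds test_prime \<Longrightarrow> prime p \<Longrightarrow> p mod 4 = 3 \<Longrightarrow> weil_holds p" by blast+
qed

lemma test_prime_gt_2: "test_prime > 2"
proof -
  have "test_prime \<noteq> 2" using test_prime(2) by auto
  thus ?thesis using prime_ge_2_nat[OF test_prime(1)] by simp
qed

typedef gf = "{0..<int test_prime}"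
  using test_prime_gt_2 by (intro exI[of _ 0]) auto

setup_lifting type_definition_gf

instantiation gf :: field
begin

lift_definition zero_gf :: gf is 0 using test_prime_gt_2 by auto
lift_definition one_gf :: gf is 1 using test_prime_gt_2 by auto
lift_definition plus_gf :: "gf \<Rightarrow> gf \<Rightarrow> gf" is "\<lambda>x y. (x + y) mod int test_prime" using test_prime_gt_2 by auto
lift_definition minus_gf :: "gf \<Rightarrow> gf \<Rightarrow> gf" is "\<lambda>x y. (x - y) mod int test_prime" using test_prime_gt_2 by auto
lift_definition uminus_gf :: "gf \<Rightarrow> gf" is "\<lambda>x. (- x) mod int test_prime" using test_prime_gt_2 by auto
lift_definition times_gf :: "gf \<Rightarrow> gf \<Rightarrow> gf" is "\<lambda>x y. (x * y) mod int test_prime" using test_prime_gt_2 by auto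
lift_definition inverse_gf :: "gf \<Rightarrow> gf" is "modular_inverse (int test_prime)"
  using test_prime_gt_2 modular_inverse_int_nonneg modular_inverse_int_less by auto
definition divide_gf :: "gf \<Rightarrow> gf \<Rightarrow> gf" where "divide_gf x y = x * inverse y"

instance
proof
  fix a b c :: gf
  show "a + b + c = a + (b + c)" by transfer (simp add: mod_simps add.assoc)
  show "a + b = b + a" by transfer (simp add: add.commute)
  show "0 + a = a" by transfer simp
  show "- a + a = 0" by transfer (simp add: mod_simps)
  show "a - b = a + - b" by transfer (simp add: mod_simps)
  show "a * b * c = a * (b * c)" by transfer (simp add: mod_simps mult.assoc)
  show "a * b = b * a" by transfer (simp add: mult.commute)
  show "1 * a = a" by transfer simp
  show "(a + b) * c = a * c + b * c" by transfer (simp add: mod_simps distrib_right)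
  show "(0::gf) \<noteq> 1" by transfer simp
  show "a div b = a * inverse b" by (simp add: divide_gf_def)
  show "inverse (0::gf) = 0" by transfer (use test_prime_gt_2 in \<open>simp add: mult_modular_inverse_of_not_coprime\<close>)
  show "inverse a * a = 1" if "a \<noteq> 0" using that
  proof transfer
    fix a assume a: "a \<in> {0..<int test_prime}" "a \<noteq> 0"
    have "\<not> int test_prime dvd a" using a by (auto dest: zdvd_imp_le)
    hence "coprime a (int test_prime)" using prime_imp_coprime[of "int test_prime" a] test_prime(1)
      by (simp add: coprime_commute)
    from cong_modular_inverse2[OF this] show "modular_inverse (int test_prime) a * a mod int test_prime = 1"
      using test_prime_gt_2 by (simp add: cong_def)
  qed
qed

end

lemma CHAR_gf: "CHAR(gf) = test_prime"
proof -
  have of_nat: "Rep_gf (of_nat n) = int n mod int test_prime" for n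
  proof (induction n)
    case 0 show ?case by (simp add: zero_gf.rep_eq)
  next
    case (Suc n) thus ?case by (simp add: plus_gf.rep_eq one_gf.rep_eq mod_simps)
  qed
  have zero: "of_nat n = (0::gf) \<longleftrightarrow> test_prime dvd n" for n
    unfolding Rep_gf_inject[symmetric] of_nat zero_gf.rep_eq by (metis dvd_eq_mod_eq_0 int_dvd_int_iff)
  show ?thesis by (rule CHAR_eqI) (simp_all add: zero)
qed

lemma CHAR_gf_closure: "CHAR(gf alg_closure) = test_prime"
  by (simp add: CHAR_gf)

interpretation Fp: finite_subfield test_prime 1 "fix_field test_prime :: gf alg_closure set"
  by (rule finite_subfield.intro) (use test_prime in \<open>simp_all add: CHAR_gf\<close>)

interpretation Fq: finite_subfield "test_prime\<^sup>2" 2 "fix_field (test_prime\<^sup>2) :: gf alg_closure set"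
  by (rule finite_subfield.intro) (use test_prime in \<open>simp_all add: CHAR_gf\<close>)

definition imag_unit :: "gf alg_closure" where
  "imag_unit = (SOME x. x\<^sup>2 = -1)"

lemma imag_unit: "imag_unit * imag_unit = -1"
proof -
  have "\<exists>x::gf alg_closure. x\<^sup>2 = -1" using nth_root_exists[of 2 "-1 :: gf alg_closure"] by auto
  from someI_ex[OF this] show ?thesis by (simp add: imag_unit_def power2_eq_square)
qed

text \<open>
  Reduction modulo the test prime, followed by the embedding of the residue field of \<open>\<int>[i]\<close> into the algebraic closure.
\<close>

definition gred :: "gint \<Rightarrow> gf alg_closure" where
  "gred z = of_int (gre z) + of_int (gim z) * imag_unit"

lemma gred_hom: "gred (z + w) = gred z + gred w" "gred (z - w) = gred z - gred w"
    "gred (z * w) = gred z * gred w" "gred (of_int n) = of_int n"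
proof -
  show "gred (z + w) = gred z + gred w" "gred (z - w) = gred z - gred w" "gred (of_int n) = of_int n"
    by (simp_all add: gred_def algebra_simps)
  have "gred z * gred w = of_int (gre z * gre w) + of_int (gre z * gim w + gim z * gre w) * imag_unit
      + of_int (gim z * gim w) * (imag_unit * imag_unit)"
    by (simp add: gred_def algebra_simps)
  thus "gred (z * w) = gred z * gred w" unfolding imag_unit by (simp add: gred_def algebra_simps)
qed

lemma of_int_eq_0_closure: "of_int n = (0 :: gf alg_closure) \<longleftrightarrow> int test_prime dvd n"
  using of_int_eq_0_iff_char_dvd[of n, where ?'a = "gf alg_closure"] by (simp add: CHAR_gf)

lemma gred_eq_0_iff: "gred z = 0 \<longleftrightarrow> of_int (int test_prime) dvd z" and gred_eq_0_iff_gnorm: "gred z = 0 \<longleftrightarrow> int test_prime dvd gnorm z"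
proof -
  have 1: "int test_prime dvd gnorm z" if "gred z = 0"
  proof -
    have "of_int (gnorm z) = gred z * gred (gcnj z)" by (simp only: gred_hom(3,4)[symmetric] mult_gcnj)
    thus ?thesis using that by (simp add: of_int_eq_0_closure)
  qed
  have 2: "of_int (int test_prime) dvd z" if "int test_prime dvd gnorm z" using inert_dvd[OF test_prime(1,2) that] .
  have 3: "gred z = 0" if "of_int (int test_prime) dvd z"
  proof -
    from that obtain w where "z = of_int (int test_prime) * w" by blast
    hence "gred z = of_int (int test_prime) * gred w" by (simp only: gred_hom)
    thus ?thesis using of_int_eq_0_closure[of "int test_prime"] by (metis dvd_refl mult_zero_left)
  qed
  show "gred z = 0 \<longleftrightarrow> of_int (int test_prime) dvd z" "gred z = 0 \<longleftrightarrow> int test_prime dvd gnorm z" using 1 2 3 by blast+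
qed

lemma gred_eq_iff: "gred z = gred w \<longleftrightarrow> of_int (int test_prime) dvd z - w"
  using gred_eq_0_iff[of "z - w"] by (simp add: gred_hom)

text \<open>
  Frobenius on the residue field is complex conjugation, because the test prime is 3 modulo 4.
\<close>

lemma gred_power: "gred z ^ test_prime = gred (gcnj z)"
proof -
  have int: "(of_int n :: gf alg_closure) ^ test_prime = of_int n" for n
  proof -
    have "of_int n \<in> (fix_field test_prime :: gf alg_closure set)"
      by (cases n rule: int_cases2) (auto intro: Fp.fix_field_of_nat Fp.fix_field_uminus)
    thus ?thesis by (simp add: Fp.fix_field_iff)
  qed
  obtain m where m: "test_prime = 4 * m + 3" using test_prime(2) by (metis mult.commute mod_mult_div_eq add.commute div_mult_mod_eq)
  have "imag_unit ^ 4 = 1" using imag_unit by (simp add: power4_eq_xxxx mult.assoc)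
  moreover have "imag_unit ^ test_prime = (imag_unit ^ 4) ^ m * (imag_unit * imag_unit * imag_unit)"
    unfolding m by (simp add: power_add power_mult power3_eq_cube mult.assoc)
  ultimately have i: "imag_unit ^ test_prime = - imag_unit" by (simp add: imag_unit)
  have "gred z ^ test_prime = of_int (gre z) ^ test_prime + (of_int (gim z) * imag_unit) ^ test_prime"
    unfolding gred_def using char_pow_add[of "of_int (gre z) :: gf alg_closure" "of_int (gim z) * imag_unit" 1] test_prime(1)
    by (simp add: CHAR_gf)
  thus ?thesis by (simp add: int i power_mult_distrib gred_def)
qed

text \<open>
  The kernel of the reduction is generated by the test prime, so the reduction is injective on the
  square, and both sides have \<open>p\<^sup>2\<close> elements.
\<close>

lemma bij_gred: "bij_betw gred (gbox (int test_prime)) (fix_field (test_prime\<^sup>2))"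
proof -
  have inj: "inj_on gred (gbox (int test_prime))"
    by (rule inj_onI) (use gred_eq_iff box_unique in blast)
  have sub: "gred ` gbox (int test_prime) \<subseteq> fix_field (test_prime\<^sup>2)"
    by (auto simp: fix_field_def power2_eq_square power_mult gred_power gcnj_def)
  have "card (gred ` gbox (int test_prime)) = card (fix_field (test_prime\<^sup>2) :: gf alg_closure set)"
    using card_image[OF inj] Fq.card_F by (simp add: card_box)
  with sub have "gred ` gbox (int test_prime) = fix_field (test_prime\<^sup>2)" using Fq.finite_F by (intro card_subset_eq)
  thus ?thesis using inj by (simp add: bij_betw_def)
qed

lemma gred_mem: "gred z \<in> fix_field (test_prime\<^sup>2)"
proof -
  have "gred z = gred (gmod (int test_prime) z)" using gmod_dvd[of "int test_prime" z] by (metis gred_eq_iff)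
  thus ?thesis using bij_gred gmod_box[of "int test_prime" z] test_prime_gt_2 by (auto simp: bij_betw_def)
qed

definition gchar :: "gf alg_closure \<Rightarrow> complex" where
  "gchar x = ee (int test_prime) (gre (inv_into (gbox (int test_prime)) gred x))"

lemma gchar_gred: "gchar (gred z) = ee (int test_prime) (gre z)"
proof -
  let ?w = "inv_into (gbox (int test_prime)) gred (gred z)"
  have "gred z \<in> gred ` gbox (int test_prime)" using gred_mem bij_gred by (auto simp: bij_betw_def)
  hence "gred ?w = gred z" by (rule f_inv_into_f)
  thus ?thesis unfolding gchar_def gred_eq_iff by (rule ee_gcong)
qed

lemma fix_field_cases: "x \<in> fix_field (test_prime\<^sup>2) \<Longrightarrow> \<exists>z. x = gred z"
  using bij_gred by (auto simp: bij_betw_def)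

lemma add_char_gchar: "add_char (fix_field (test_prime\<^sup>2)) gchar"
  unfolding add_char_def
proof (intro conjI ballI)
  fix x y :: "gf alg_closure" assume "x \<in> fix_field (test_prime\<^sup>2)" "y \<in> fix_field (test_prime\<^sup>2)"
  then obtain z w where "x = gred z" "y = gred w" using fix_field_cases by blast
  thus "gchar (x + y) = gchar x * gchar y" by (simp add: gred_hom(1)[symmetric] gchar_gred ee_add)
next
  fix x :: "gf alg_closure" assume "x \<in> fix_field (test_prime\<^sup>2)"
  then obtain z where z: "x = gred z" using fix_field_cases by blast
  show "cmod (gchar x) = 1" by (simp add: z gchar_gred)
  show "gchar (x ^ CHAR(gf alg_closure)) = gchar x" unfolding z CHAR_gf_closure gred_power gchar_gred by simp
next
  have "\<not> int test_prime dvd 1" using test_prime_gt_2 by auto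
  hence "gchar (gred 1) \<noteq> 1" using test_prime_gt_2 by (simp add: gchar_gred ee_eq_1_iff)
  thus "\<exists>x\<in>fix_field (test_prime\<^sup>2). gchar x \<noteq> 1" using gred_mem by blast
qed

text \<open>
  The substitution \<open>x \<mapsto> a x\<close> brings \<open>a x + b / x\<close> into the normal form \<open>x + a b / x\<close>.
\<close>

lemma weil_test_prime: "weil_holds test_prime"
  unfolding weil_holds_def
proof (intro allI impI)
  fix a b assume a: "\<not> int test_prime dvd gnorm a" and b: "\<not> int test_prime dvd gnorm b"
  let ?F = "fix_field (test_prime\<^sup>2) :: gf alg_closure set"
  define A B where "A = gred a" and "B = gred b"
  have AB: "A \<in> ?F" "B \<in> ?F" "A \<noteq> 0" "B \<noteq> 0"
    using gred_mem a b by (simp_all add: A_def B_def gred_eq_0_iff_gnorm)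
  have cop: "coprime (gnorm z) (int test_prime) \<longleftrightarrow> gred z \<noteq> 0" for z
  proof -
    have "prime (int test_prime)" using test_prime(1) by simp
    hence "coprime (gnorm z) (int test_prime) \<longleftrightarrow> \<not> int test_prime dvd gnorm z"
      by (metis coprime_commute prime_imp_coprime not_prime_unit coprime_absorb_left)
    thus ?thesis by (simp add: gred_eq_0_iff_gnorm)
  qed
  have kloos_term: "kloos (int test_prime) a b z = (if gred z \<noteq> 0 then gchar (A * gred z + B / gred z) else 0)" for z
  proof (cases "gred z = 0")
    case False
    have "of_int (int test_prime) dvd z * ginv (int test_prime) z - 1" using False cop by (intro ginv) simp
    hence "gred (z * ginv (int test_prime) z) = gred 1" unfolding gred_eq_iff .
    hence "gred z * gred (ginv (int test_prime) z) = 1" by (simp add: gred_hom) (simp add: gred_def)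
    hence "gred (ginv (int test_prime) z) = 1 / gred z" using False by (simp add: field_simps)
    hence "A * gred z + B / gred z = gred (a * z + b * ginv (int test_prime) z)" by (simp add: gred_hom A_def B_def)
    thus ?thesis using False cop by (simp only: gchar_gred) (simp add: kloos_def)
  qed (simp add: kloos_def cop)
  have "(\<Sum>z\<in>gbox (int test_prime). kloos (int test_prime) a b z)
      = (\<Sum>z\<in>gbox (int test_prime). (\<lambda>x. if x \<noteq> 0 then gchar (A * x + B / x) else 0) (gred z))"
    unfolding kloos_term ..
  also have "\<dots> = (\<Sum>x\<in>?F. if x \<noteq> 0 then gchar (A * x + B / x) else 0)"
    by (rule sum.reindex_bij_betw[OF bij_gred])
  also have "\<dots> = (\<Sum>x\<in>?F - {0}. gchar (A * x + B / x))"
    using Fq.finite_F by (intro sum.mono_neutral_cong_right) auto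
  also have "\<dots> = (\<Sum>x\<in>?F - {0}. gchar (x + A * B / x))"
    by (rule sum.reindex_bij_witness[of _ "\<lambda>x. x / A" "\<lambda>x. A * x"]) (use AB in auto)
  also have "\<dots> = kloosterman ?F gchar (A * B)" by (simp add: kloosterman_def)
  finally have eq: "(\<Sum>z\<in>gbox (int test_prime). kloos (int test_prime) a b z) = kloosterman ?F gchar (A * B)" .
  have "odd test_prime" using test_prime(2) by presburger
  hence "cmod (kloosterman ?F gchar (A * B)) \<le> 2 * sqrt (real (test_prime\<^sup>2))"
    using AB by (intro Fq.weil_kloosterman add_char_gchar) (auto simp: CHAR_gf)
  thus "cmod (\<Sum>z\<in>gbox (int test_prime). kloos (int test_prime) a b z) \<le> 2 * real test_prime"
    unfolding eq by simp
qed

theorem weil_gaussian: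
  assumes "prime p" "p mod 4 = 3" "\<not> int p dvd gnorm a" "\<not> int p dvd gnorm b"
  shows "cmod (\<Sum>z\<in>gbox (int p). kloos (int p) a b z) \<le> 2 * real p"
  using test_prime(3)[OF weil_test_prime assms(1,2)] assms(3,4) by (auto simp: weil_holds_def)


section \<open>The sum as a Kloosterman sum over the Gaussian integers\<close>

lemma Zp_e_eq: "Zp_e p k z = ee (int p ^ k) (z k)"
  by (simp add: Zp_e_def ee_def Zp_residue_def)

lemma Zp_apply:
  "(x \<otimes>\<^bsub>Zp p\<^esub> y) k = (x k * y k) mod int p ^ k" "(x \<oplus>\<^bsub>Zp p\<^esub> y) k = (x k + y k) mod int p ^ k"
  "Zp_of_int p a k = a mod int p ^ k"
  by (simp_all add: Zp_def Zp_of_int_def)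

lemma ee_mod: "ee q (n mod q) = ee q n"
  by (rule ee_cong) (simp add: mod_eq_dvd_iff[symmetric])

lemma S4_term_eq:
  assumes p: "p > 0" and m: "m2 \<in> carrier (Zp p)" "m3 \<in> carrier (Zp p)"
  shows "S4_term p m2 m3 n2 n3 k c w x y
    = ee (int p ^ k) (gre (GI (n2 k) (- n3 k) * GI x y + of_int c * GI (m2 k) (- m3 k) * (GI x (- y) * of_int (modular_inverse (int p ^ k) w))))"
proof -
  have "S4_term p m2 m3 n2 n3 k c w x y
      = ee (int p ^ k) (c * (m2 k * x - m3 k * y) * modular_inverse (int p ^ k) w) * ee (int p ^ k) (n2 k * x + n3 k * y)"
    unfolding S4_term_def Zp_e_eq
    by (simp add: Zp_apply Zp_minus_apply[OF p Zp_mult_closed[OF p m(1) Zp_of_int_closed[OF p]] Zp_mult_closed[OF p m(2) Zp_of_int_closed[OF p]]]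
       mod_simps ee_mod)
  also have "\<dots> = ee (int p ^ k) (gre (GI (n2 k) (- n3 k) * GI x y + of_int c * GI (m2 k) (- m3 k) * (GI x (- y) * of_int (modular_inverse (int p ^ k) w))))"
    unfolding ee_add[symmetric] by (simp add: algebra_simps)
  finally show ?thesis .
qed

lemma sum_pairs_eq_sum_gbox:
  "(\<Sum>(x, y)\<in>{(x, y). x \<in> {0..<q} \<and> y \<in> {0..<q} \<and> R x y}. t x y)
     = (\<Sum>z\<in>gbox q. if R (gre z) (gim z) then t (gre z) (gim z) else (0::complex))"
proof -
  have "{(x, y). x \<in> {0..<q} \<and> y \<in> {0..<q} \<and> R x y} = {u \<in> {0..<q} \<times> {0..<q}. R (fst u) (snd u)}" by auto
  hence "(\<Sum>(x, y)\<in>{(x, y). x \<in> {0..<q} \<and> y \<in> {0..<q} \<and> R x y}. t x y)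
     = (\<Sum>u\<in>{0..<q} \<times> {0..<q}. if R (fst u) (snd u) then t (fst u) (snd u) else 0)"
    by (simp only: sum.inter_filter finite_cartesian_product finite_atLeastLessThan_int case_prod_unfold)
  also have "\<dots> = (\<Sum>x\<in>{0..<q}. \<Sum>y\<in>{0..<q}. if R x y then t x y else 0)"
    by (simp add: sum.cartesian_product case_prod_unfold)
  finally show ?thesis by (simp only: sum_box gint.sel)
qed

lemma coprime_two_power: "k > 0 \<Longrightarrow> coprime n (2 ^ k) \<longleftrightarrow> odd (n :: int)"
  by (simp add: coprime_right_2_iff_odd)

lemma S4_inert:
  assumes p: "prime p" "p mod 4 = 3" and m: "m2 \<in> carrier (Zp p)" "m3 \<in> carrier (Zp p)"
  shows "S4 m2 m3 n2 n3 p (2 * k)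
    = (\<Sum>z\<in>gbox (int p ^ k). kloos (int p ^ k) (GI (n2 k) (- n3 k)) (of_int (-2) * GI (m2 k) (- m3 k)) z)"
proof -
  have p0: "p > 0" using p(1) prime_gt_0_nat by blast
  have "S4 m2 m3 n2 n3 p (2 * k) = (\<Sum>z\<in>gbox (int p ^ k). if 2 * k = 0 \<or> \<not> (int p dvd gre z \<and> int p dvd gim z)
      then S4_term p m2 m3 n2 n3 k (-2) ((gre z)\<^sup>2 + (gim z)\<^sup>2) (gre z) (gim z) else 0)"
    by (subst sum_pairs_eq_sum_gbox[where R = "\<lambda>x y. 2 * k = 0 \<or> \<not> (int p dvd x \<and> int p dvd y)"
        and t = "\<lambda>x y. S4_term p m2 m3 n2 n3 k (-2) (x\<^sup>2 + y\<^sup>2) x y", symmetric])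
      (simp add: S4_def p(2))
  also have "\<dots> = (\<Sum>z\<in>gbox (int p ^ k). kloos (int p ^ k) (GI (n2 k) (- n3 k)) (of_int (-2) * GI (m2 k) (- m3 k)) z)"
  proof (rule sum.cong[OF refl])
    fix z
    have "int p dvd gnorm z \<longleftrightarrow> int p dvd gre z \<and> int p dvd gim z"
      using inert_dvd[OF p, of z] dvd_gnorm[of "int p" z] of_int_dvd_gint_iff[of "int p" z] by blast
    hence "2 * k = 0 \<or> \<not> (int p dvd gre z \<and> int p dvd gim z) \<longleftrightarrow> coprime (gnorm z) (int p ^ k)"
      using coprime_P[OF p refl, of "gnorm z" k] by simp
    thus "(if 2 * k = 0 \<or> \<not> (int p dvd gre z \<and> int p dvd gim z)
      then S4_term p m2 m3 n2 n3 k (-2) ((gre z)\<^sup>2 + (gim z)\<^sup>2) (gre z) (gim z) else 0)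
      = kloos (int p ^ k) (GI (n2 k) (- n3 k)) (of_int (-2) * GI (m2 k) (- m3 k)) z"
      unfolding kloos_def S4_term_eq[OF p0 m] ginv_def gcnj_def gnorm_def[symmetric] by simp
  qed
  finally show ?thesis .
qed

lemma S4_dyadic_odd:
  assumes m: "m2 \<in> carrier (Zp 2)" "m3 \<in> carrier (Zp 2)" and k: "k > 0"
  shows "S4 m2 m3 n2 n3 2 (2 * k + 1)
    = (\<Sum>z\<in>gbox (2 ^ k). kloos (2 ^ k) (GI (n2 k) (- n3 k)) (of_int (-1) * GI (m2 k) (- m3 k)) z)"
proof -
  have "S4 m2 m3 n2 n3 2 (2 * k + 1) = (\<Sum>z\<in>gbox (2 ^ k). if \<not> (2 dvd gre z \<and> 2 dvd gim z) \<and> 2 dvd gre z * gim z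
      then S4_term 2 m2 m3 n2 n3 k (-1) ((gre z)\<^sup>2 + (gim z)\<^sup>2) (gre z) (gim z) else 0)"
    by (subst sum_pairs_eq_sum_gbox[where R = "\<lambda>x y. \<not> (2 dvd x \<and> 2 dvd y) \<and> 2 dvd x * y"
        and t = "\<lambda>x y. S4_term 2 m2 m3 n2 n3 k (-1) (x\<^sup>2 + y\<^sup>2) x y", symmetric])
      (use k in \<open>simp add: S4_def\<close>)
  also have "\<dots> = (\<Sum>z\<in>gbox (2 ^ k). kloos (2 ^ k) (GI (n2 k) (- n3 k)) (of_int (-1) * GI (m2 k) (- m3 k)) z)"
  proof (rule sum.cong[OF refl])
    fix z
    have "\<not> (2 dvd gre z \<and> 2 dvd gim z) \<and> 2 dvd gre z * gim z \<longleftrightarrow> coprime (gnorm z) (2 ^ k)"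
      unfolding coprime_two_power[OF k] gnorm_def by auto
    thus "(if \<not> (2 dvd gre z \<and> 2 dvd gim z) \<and> 2 dvd gre z * gim z
      then S4_term 2 m2 m3 n2 n3 k (-1) ((gre z)\<^sup>2 + (gim z)\<^sup>2) (gre z) (gim z) else 0)
      = kloos (2 ^ k) (GI (n2 k) (- n3 k)) (of_int (-1) * GI (m2 k) (- m3 k)) z"
      unfolding kloos_def S4_term_eq[OF zero_less_numeral m] ginv_def gcnj_def gnorm_def[symmetric] by simp
  qed
  finally show ?thesis .
qed

text \<open>
  Here \<open>(x\<^sup>2 + y\<^sup>2) / 2\<close> is the norm of \<open>u = z / (1 + i)\<close>, and \<open>bar z = (1 - i) bar u\<close>, which yields the extra
  factors in the coefficients. Both \<open>x\<close> and \<open>y\<close> are odd if and only if \<open>u\<close> exists and has odd norm.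
\<close>

lemma S4_dyadic_even:
  assumes m: "m2 \<in> carrier (Zp 2)" "m3 \<in> carrier (Zp 2)" and k: "k > 0"
  shows "S4 m2 m3 n2 n3 2 (2 * k)
    = (\<Sum>z\<in>gbox (2 ^ k). if even (gre z + gim z) then
        kloos (2 ^ k) (GI (n2 k) (- n3 k) * GI 1 1) (of_int (-1) * GI (m2 k) (- m3 k) * GI 1 (-1)) (ghalf z) else 0)"
proof -
  let ?a = "GI (n2 k) (- n3 k)" and ?b = "of_int (-1) * GI (m2 k) (- m3 k)"
  have "S4 m2 m3 n2 n3 2 (2 * k) = (\<Sum>z\<in>gbox (2 ^ k). if \<not> 2 dvd gre z * gim z
      then S4_term 2 m2 m3 n2 n3 k (-1) (((gre z)\<^sup>2 + (gim z)\<^sup>2) div 2) (gre z) (gim z) else 0)"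
    by (subst sum_pairs_eq_sum_gbox[where R = "\<lambda>x y. \<not> 2 dvd x * y"
        and t = "\<lambda>x y. S4_term 2 m2 m3 n2 n3 k (-1) ((x\<^sup>2 + y\<^sup>2) div 2) x y", symmetric])
      (use k in \<open>simp add: S4_def\<close>)
  also have "\<dots> = (\<Sum>z\<in>gbox (2 ^ k). if even (gre z + gim z) then
        kloos (2 ^ k) (?a * GI 1 1) (?b * GI 1 (-1)) (ghalf z) else 0)"
  proof (rule sum.cong[OF refl])
    fix z
    show "(if \<not> 2 dvd gre z * gim z
      then S4_term 2 m2 m3 n2 n3 k (-1) (((gre z)\<^sup>2 + (gim z)\<^sup>2) div 2) (gre z) (gim z) else 0)
      = (if even (gre z + gim z) then kloos (2 ^ k) (?a * GI 1 1) (?b * GI 1 (-1)) (ghalf z) else 0)"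
    proof (cases "even (gre z + gim z)")
      case True
      define u where "u = ghalf z"
      have zu: "z = GI 1 1 * u" unfolding u_def using True by (rule ghalf)
      have norm: "(gre z)\<^sup>2 + (gim z)\<^sup>2 = 2 * gnorm u"
        unfolding gnorm_def[symmetric] zu gnorm_mult by (simp add: gnorm_def)
      have "\<not> 2 dvd gre z * gim z \<longleftrightarrow> odd (gnorm u)"
        unfolding zu gnorm_def by auto
      hence cop: "\<not> 2 dvd gre z * gim z \<longleftrightarrow> coprime (gnorm u) (2 ^ k)" by (simp only: coprime_two_power[OF k])
      have A: "?a * GI (gre z) (gim z) = (?a * GI 1 1) * u"
        by (simp add: gint_eq_iff zu algebra_simps)
      have B: "?b * (GI (gre z) (- gim z) * of_int j) = (?b * GI 1 (-1)) * (GI (gre u) (- gim u) * of_int j)" for j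
        by (simp add: gint_eq_iff zu algebra_simps)
      have "((gre z)\<^sup>2 + (gim z)\<^sup>2) div 2 = gnorm u" by (simp add: norm)
      thus ?thesis using True cop
        unfolding kloos_def S4_term_eq[OF zero_less_numeral m] ginv_def gcnj_def u_def[symmetric] A B by simp
    next
      case False
      thus ?thesis by auto
    qed
  qed
  finally show ?thesis .
qed

lemma Zp_mod_power:
  assumes x: "x \<in> carrier (Zp p)" and "j \<le> k"
  shows "x k mod int p ^ j = x j"
  using assms(2)
proof (induction k)
  case 0 thus ?case using Zp_mod_self[OF x, of 0] by simp
next
  case (Suc k)
  show ?case
  proof (cases "j = Suc k")
    case True thus ?thesis using Zp_mod_self[OF x, of "Suc k"] by (simp only:)
  next
    case False
    have "x (Suc k) mod int p ^ k = x k" using x by (simp add: Zp_def)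
    moreover have "x (Suc k) mod int p ^ k mod int p ^ j = x (Suc k) mod int p ^ j"
      using False Suc.prems by (intro mod_mod_cancel le_imp_power_dvd) simp
    ultimately show ?thesis using Suc False by simp
  qed
qed

text \<open>
  The quotient is obtained by dividing the components by \<open>p\<close>; division loses one digit of precision,
  hence the shift of the index.
\<close>

lemma Zp_dvd:
  assumes p: "p > 0" and x: "x \<in> carrier (Zp p)" and k: "k > 0" "int p dvd x k"
  shows "Zp_of_int p (int p) divides\<^bsub>Zp p\<^esub> x"
proof -
  define y where "y = (\<lambda>n. x (Suc n) div int p)"
  have dvd: "int p dvd x (Suc n)" for n
  proof -
    have "x k mod int p = x 1" "x (Suc n) mod int p = x 1"
      using Zp_mod_power[OF x, of 1 k] Zp_mod_power[OF x, of 1 "Suc n"] k by simp_all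
    thus ?thesis using k by (simp add: dvd_eq_mod_eq_0)
  qed
  have "y \<in> carrier (Zp p)"
  proof -
    have "0 \<le> y n \<and> y n < int p ^ n" for n
    proof -
      have "\<forall>n. x n \<in> {0..<int p ^ n}" using x by (simp add: Zp_def)
      from spec[OF this, of "Suc n"] have "0 \<le> x (Suc n)" "x (Suc n) < int p * int p ^ n" by simp_all
      moreover have "x (Suc n) = int p * y n" using dvd by (simp add: y_def)
      ultimately show ?thesis using p by (simp add: zero_le_mult_iff)
    qed
    moreover have "y (Suc n) mod int p ^ n = y n" for n
    proof -
      have "\<forall>n. x (Suc n) mod int p ^ n = x n" using x by (simp add: Zp_def)
      from spec[OF this, of "Suc n"] have "x (Suc (Suc n)) mod (int p * int p ^ n) = x (Suc n)" by simp
      moreover have xy: "x (Suc (Suc n)) = int p * y (Suc n)" "x (Suc n) = int p * y n" using dvd by (simp_all add: y_def)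
      ultimately have "int p * y (Suc n) mod (int p * int p ^ n) = int p * y n" by (simp only: xy)
      hence "int p * (y (Suc n) mod int p ^ n) = int p * y n" by (simp only: mult_mod_right)
      thus ?thesis using p by simp
    qed
    ultimately show ?thesis by (simp add: Zp_def)
  qed
  moreover have "x = Zp_of_int p (int p) \<otimes>\<^bsub>Zp p\<^esub> y"
  proof
    fix n
    have "x (Suc n) = int p * y n" using dvd by (simp add: y_def)
    moreover have "x (Suc n) mod int p ^ n = x n" using x by (simp add: Zp_def)
    ultimately show "x n = (Zp_of_int p (int p) \<otimes>\<^bsub>Zp p\<^esub> y) n" by (simp add: Zp_apply mod_simps)
  qed
  ultimately show ?thesis by (auto simp: factor_def)
qed

lemma Zp_coprime_residue:
  assumes "Zp_coprime p V" "p > 0" "V \<subseteq> carrier (Zp p)" "k > 0"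
  shows "\<exists>x\<in>V. \<not> int p dvd x k"
  using assms Zp_dvd unfolding Zp_coprime_def by blast

lemma Zp_coprime_mult_residue:
  assumes "Zp_coprime p {x \<otimes>\<^bsub>Zp p\<^esub> y}" "p > 0" "x \<in> carrier (Zp p)" "y \<in> carrier (Zp p)" "k > 0"
  shows "\<not> int p dvd x k" "\<not> int p dvd y k"
proof -
  have "\<not> int p dvd (x \<otimes>\<^bsub>Zp p\<^esub> y) k"
    using Zp_coprime_residue[OF assms(1,2) _ assms(5)] Zp_mult_closed[OF assms(2-4)] by auto
  moreover have "int p dvd int p ^ k" using assms(5) by simp
  ultimately have "\<not> int p dvd x k * y k" by (simp add: Zp_apply dvd_mod_iff)
  thus "\<not> int p dvd x k" "\<not> int p dvd y k" by auto
qed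

lemma cmod_sum_gbox_le:
  assumes "\<And>z. cmod (f z) \<le> 1" "q \<ge> 0"
  shows "cmod (\<Sum>z\<in>gbox q. f z) \<le> (real_of_int q)\<^sup>2"
proof -
  have "cmod (\<Sum>z\<in>gbox q. f z) \<le> (\<Sum>z\<in>gbox q. 1)" by (rule sum_norm_le) (rule assms)
  thus ?thesis using assms(2) by (simp add: card_box)
qed

text \<open>
  For \<open>r \<le> 3\<close> the sum has at most four terms. For larger \<open>r\<close> both \<open>n\<^sub>2\<close> and \<open>n\<^sub>3\<close> are odd, so the norm of
  \<open>n\<close> is 2 modulo 4, and the stationary phase bounds apply.
\<close>

lemma S4_dyadic_bound:
  assumes c: "m2 \<in> carrier (Zp 2)" "m3 \<in> carrier (Zp 2)" "n2 \<in> carrier (Zp 2)" "n3 \<in> carrier (Zp 2)"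
    and n: "r > 3 \<Longrightarrow> Zp_coprime 2 {n2 \<otimes>\<^bsub>Zp 2\<^esub> n3}"
  shows "cmod (S4 m2 m3 n2 n3 2 r) \<le> 1024 * 2 ^ (r div 2)"
proof -
  define k where "k = r div 2"
  let ?a = "GI (n2 k) (- n3 k)"
  have norm_a: "gnorm ?a mod 4 = 2" if "r > 3"
  proof -
    have "odd (n2 k)" "odd (n3 k)" using Zp_coprime_mult_residue[OF n[OF that] _ c(3,4), of k] that by (auto simp: k_def)
    then obtain i j where "n2 k = 2 * i + 1" "n3 k = 2 * j + 1" by (auto elim!: oddE)
    hence "gnorm ?a = 4 * (i * i + i + j * j + j) + 2" by (simp add: gnorm_def power2_eq_square algebra_simps)
    thus ?thesis by presburger
  qed
  have "r = 0 \<or> r = 1 \<or> (odd r \<and> r \<ge> 3) \<or> (even r \<and> r \<ge> 2)" by presburger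
  then consider "r = 0" | "r = 1" | "odd r" "r \<ge> 3" | "even r" "r \<ge> 2" by blast
  thus ?thesis
  proof cases
    case 1
    have "{(x, y). x \<in> {0..<1::int} \<and> y \<in> {0..<1::int}} = {(0, 0)}" by auto
    hence "S4 m2 m3 n2 n3 2 r = S4_term 2 m2 m3 n2 n3 0 (-1) 0 0 0" using 1 by (simp add: S4_def)
    thus ?thesis using 1 by (simp add: S4_term_eq[OF zero_less_numeral c(1,2)])
  next
    case 2
    thus ?thesis by (simp add: S4_def)
  next
    case 3
    hence r: "r = 2 * k + 1" and k: "k > 0" by (auto simp: k_def)
    show ?thesis
    proof (cases "r > 3")
      case True
      have "\<not> 8 dvd gnorm ?a" using norm_a[OF True] by presburger
      from dyadic_bound[OF this k] show ?thesis unfolding r S4_dyadic_odd[OF c(1,2) k] by simp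
    next
      case False
      hence "k = 1" using r k by simp
      have "cmod (S4 m2 m3 n2 n3 2 r) \<le> (real_of_int (2 ^ k))\<^sup>2"
        unfolding r S4_dyadic_odd[OF c(1,2) k] by (rule cmod_sum_gbox_le) (auto simp: norm_kloos)
      thus ?thesis using r \<open>k = 1\<close> by simp
    qed
  next
    case 4
    hence r: "r = 2 * k" and k: "k > 0" by (auto simp: k_def)
    show ?thesis
    proof (cases "r > 3")
      case True
      hence "k \<ge> 2" using r by simp
      from dyadic_ramified_bound[OF norm_a[OF True] this]
      show ?thesis unfolding r S4_dyadic_even[OF c(1,2) k] by simp
    next
      case False
      hence "k = 1" using r k by simp
      have "cmod (S4 m2 m3 n2 n3 2 r) \<le> (real_of_int (2 ^ k))\<^sup>2"
        unfolding r S4_dyadic_even[OF c(1,2) k] by (rule cmod_sum_gbox_le) (auto simp: norm_kloos)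
      thus ?thesis using r \<open>k = 1\<close> by simp
    qed
  qed
qed

text \<open>
  The exponent \<open>k = r / 2\<close> decides: a single term for \<open>k = 0\<close>, the Weil bound for \<open>k = 1\<close>, stationary
  phase for \<open>k \<ge> 2\<close>. For odd \<open>r\<close> the sum is zero by definition.
\<close>

lemma S4_inert_bound:
  assumes p: "prime p" "p mod 4 = 3"
    and c: "m2 \<in> carrier (Zp p)" "m3 \<in> carrier (Zp p)" "n2 \<in> carrier (Zp p)" "n3 \<in> carrier (Zp p)"
    and n: "r > 2 \<Longrightarrow> Zp_coprime p {n2 \<otimes>\<^bsub>Zp p\<^esub> n3}"
    and r2: "r = 2 \<Longrightarrow> Zp_coprime p {m2, m3} \<and> Zp_coprime p {n2, n3}"
  shows "cmod (S4 m2 m3 n2 n3 p r) \<le> 2 * real p ^ (r div 2)"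
proof (cases "even r")
  case False
  hence "S4 m2 m3 n2 n3 p r = 0" using p(2) by (auto simp: S4_def)
  thus ?thesis by simp
next
  case True
  define k where "k = r div 2"
  have r: "r = 2 * k" using True by (simp add: k_def)
  have p0: "p > 0" using p(1) prime_gt_0_nat by blast
  let ?a = "GI (n2 k) (- n3 k)" and ?b = "of_int (-2) * GI (m2 k) (- m3 k)"
  have S: "S4 m2 m3 n2 n3 p r = (\<Sum>z\<in>gbox (int p ^ k). kloos (int p ^ k) ?a ?b z)"
    unfolding r by (rule S4_inert[OF p c(1,2)])
  have not_dvd: "\<not> int p dvd gnorm (GI x (- y))" if "\<not> int p dvd x \<or> \<not> int p dvd y" for x y
    using inert_dvd[OF p, of "GI x (- y)"] that of_int_dvd_gint_iff[of "int p" "GI x (- y)"] by auto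
  have a: "\<not> int p dvd gnorm ?a" if "k > 0"
  proof (cases "k = 1")
    case True
    hence "Zp_coprime p {n2, n3}" using r2 r by simp
    from Zp_coprime_residue[OF this p0 _ that] c show ?thesis by (intro not_dvd) auto
  next
    case False
    hence "r > 2" using that r by simp
    from Zp_coprime_mult_residue(1)[OF n[OF this] p0 c(3,4) that] show ?thesis by (intro not_dvd) simp
  qed
  consider "k = 0" | "k = 1" | "k > 1" by linarith
  thus ?thesis
  proof cases
    case 1
    have "cmod (S4 m2 m3 n2 n3 p r) \<le> (real_of_int (int p ^ k))\<^sup>2"
      unfolding S by (rule cmod_sum_gbox_le) (auto simp: norm_kloos)
    thus ?thesis using 1 by (simp add: r)
  next
    case 2
    hence "Zp_coprime p {m2, m3}" using r2 r by simp
    from Zp_coprime_residue[OF this p0 _ , of k] c 2 have "\<not> int p dvd m2 k \<or> \<not> int p dvd m3 k" by auto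
    hence "\<not> int p dvd gnorm (GI (m2 k) (- m3 k))" by (rule not_dvd)
    moreover have "\<not> int p dvd 2"
    proof
      assume "int p dvd 2"
      hence "p \<le> 2" by (auto dest: zdvd_imp_le)
      moreover have "p \<noteq> 2" using p(2) by auto
      ultimately show False using prime_ge_2_nat[OF p(1)] by simp
    qed
    moreover have "gnorm ?b = 2 * 2 * gnorm (GI (m2 k) (- m3 k))"
      unfolding gnorm_mult gnorm_of_int by simp
    moreover have pp: "prime (int p)" using p(1) by simp
    ultimately have "\<not> int p dvd gnorm ?b" by (simp only: prime_dvd_mult_iff[OF pp] simp_thms)
    from weil_gaussian[OF p a this] show ?thesis unfolding S using 2 by (simp add: r)
  next
    case 3
    show ?thesis
    proof (cases "even k")
      case True
      then obtain t where t: "k = 2 * t" by blast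
      from inert_even_bound[OF p refl a, of t ?b] show ?thesis unfolding S using t 3 by (simp add: r)
    next
      case False
      then obtain t where t: "k = 2 * t + 1" by (elim oddE)
      from inert_odd_bound[OF p refl a _ t, of ?b] show ?thesis unfolding S using t 3 by (simp add: r)
    qed
  qed
qed

theorem theorem1p6:
  shows "\<exists>C::real. C > 0 \<and>
    (\<forall>(p::nat) (r::nat). \<forall>m2 \<in> carrier (Zp p). \<forall>m3 \<in> carrier (Zp p).
       \<forall>n2 \<in> carrier (Zp p). \<forall>n3 \<in> carrier (Zp p).
      prime p \<longrightarrow> p mod 4 \<noteq> 1 \<longrightarrow>
      ((p mod 4 = 3 \<and> r > 2 \<or> p = 2 \<and> r > 3) \<longrightarrow>
         Zp_coprime p {n2 \<otimes>\<^bsub>Zp p\<^esub> n3} \<and>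
         (Zp_residue (r div 4) ((m2 \<otimes>\<^bsub>Zp p\<^esub> n3) \<ominus>\<^bsub>Zp p\<^esub> (m3 \<otimes>\<^bsub>Zp p\<^esub> n2)) \<noteq> 0 \<or>
          Zp_residue (r div 4) ((m2 \<otimes>\<^bsub>Zp p\<^esub> n2) \<oplus>\<^bsub>Zp p\<^esub> (m3 \<otimes>\<^bsub>Zp p\<^esub> n3)) \<noteq> 0)) \<longrightarrow>
      (p mod 4 = 3 \<and> r = 2 \<longrightarrow>
         Zp_coprime p {m2, m3} \<and> Zp_coprime p {n2, n3} \<and>
         Zp_coprime p {(m2 \<otimes>\<^bsub>Zp p\<^esub> n3) \<oplus>\<^bsub>Zp p\<^esub> (m3 \<otimes>\<^bsub>Zp p\<^esub> n2)}) \<longrightarrow>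
      (p mod 4 = 3 \<and> (\<exists>t\<ge>1. r = 4 * t + 2) \<longrightarrow>
         Zp_coprime p {(m2 \<otimes>\<^bsub>Zp p\<^esub> m2) \<oplus>\<^bsub>Zp p\<^esub> (m3 \<otimes>\<^bsub>Zp p\<^esub> m3)}) \<longrightarrow>
      (p = 2 \<and> even r \<longrightarrow> Zp_coprime p {m2 \<otimes>\<^bsub>Zp p\<^esub> m3}) \<longrightarrow>
      cmod (S4 m2 m3 n2 n3 p r) \<le> C * real p powr (real r / 2))"
\<comment> \<open>The constant comes from \<open>p = 2\<close>; for the other primes 2 would do.\<close>
proof (intro exI[of _ 1024] conjI allI ballI impI)
  fix p r :: nat and m2 m3 n2 n3
  assume c: "m2 \<in> carrier (Zp p)" "m3 \<in> carrier (Zp p)" "n2 \<in> carrier (Zp p)" "n3 \<in> carrier (Zp p)"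
    and p: "prime p" "p mod 4 \<noteq> 1"
    and h1: "(p mod 4 = 3 \<and> r > 2 \<or> p = 2 \<and> r > 3) \<longrightarrow>
         Zp_coprime p {n2 \<otimes>\<^bsub>Zp p\<^esub> n3} \<and>
         (Zp_residue (r div 4) ((m2 \<otimes>\<^bsub>Zp p\<^esub> n3) \<ominus>\<^bsub>Zp p\<^esub> (m3 \<otimes>\<^bsub>Zp p\<^esub> n2)) \<noteq> 0 \<or>
          Zp_residue (r div 4) ((m2 \<otimes>\<^bsub>Zp p\<^esub> n2) \<oplus>\<^bsub>Zp p\<^esub> (m3 \<otimes>\<^bsub>Zp p\<^esub> n3)) \<noteq> 0)"
    and h2: "p mod 4 = 3 \<and> r = 2 \<longrightarrow>
         Zp_coprime p {m2, m3} \<and> Zp_coprime p {n2, n3} \<and>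
         Zp_coprime p {(m2 \<otimes>\<^bsub>Zp p\<^esub> n3) \<oplus>\<^bsub>Zp p\<^esub> (m3 \<otimes>\<^bsub>Zp p\<^esub> n2)}"
  have "p = 2 \<or> p mod 4 = 3"
  proof (cases "p = 2")
    case False
    hence "odd p" using p(1) prime_odd_nat prime_ge_2_nat by (metis le_neq_implies_less)
    thus ?thesis using p(2) by presburger
  qed simp
  hence "cmod (S4 m2 m3 n2 n3 p r) \<le> 1024 * real p ^ (r div 2)"
  proof
    assume "p = 2"
    thus ?thesis using S4_dyadic_bound[of m2 m3 n2 n3 r] c h1 by simp
  next
    assume "p mod 4 = 3"
    hence "cmod (S4 m2 m3 n2 n3 p r) \<le> 2 * real p ^ (r div 2)"
      using h1 h2 by (intro S4_inert_bound p c) auto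
    also have "\<dots> \<le> 1024 * real p ^ (r div 2)" by (intro mult_right_mono) auto
    finally show ?thesis .
  qed
  \<comment> \<open>For odd \<open>r\<close> this is where the rounding of \<open>r / 2\<close> is absorbed.\<close>
  also have "real p ^ (r div 2) \<le> real p powr (real r / 2)"
  proof -
    have p0: "real p \<ge> 1" using prime_ge_2_nat[OF p(1)] by simp
    have "real p ^ (r div 2) = real p powr real (r div 2)" using p0 by (simp add: powr_realpow)
    also have "\<dots> \<le> real p powr (real r / 2)" by (rule powr_mono) (use p0 in \<open>auto simp: field_simps\<close>)
    finally show ?thesis .
  qed
  finally show "cmod (S4 m2 m3 n2 n3 p r) \<le> 1024 * real p powr (real r / 2)" by simp
qed simp

end
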